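(* Let $F$ be an algebraically closed field, fix an integer $m\geq1$, reals $0<\delta<1$ and $\varepsilon>0$, and a rational number $\alpha$ such that $\alpha^2-m\alpha+1<0$ and $m\delta+\alpha-2\alpha\delta>0$. Define $$\varepsilon_m(\alpha,\delta)=\frac{m\delta+\alpha-2\alpha\delta-\sqrt{(m\delta-\alpha)^2+4\delta(1-\delta)}}{2\alpha\delta}.$$ Then $\varepsilon_m(\alpha,\delta)>0$, and there exist $(\delta,\varepsilon)$-expander representations of $K(m)$ of dimension vector $(d_1,d_2)$ for all pairs of positive integers $(d_1,d_2)$ with $d_2/d_1=\alpha$ if and only if $\varepsilon\leq\varepsilon_m(\alpha,\delta)$.
   Context: $K(m)$ is the quiver with two vertices $1,2$ and $m$ arrows from $1$ to $2$; a representation of dimension vector $(d_1,d_2)$ is a tuple of $F$-linear maps $f_1,\ldots,f_m:V\to W$ with $\dim V=d_1$, $\dim W=d_2$. For $0<\delta<1$, $\varepsilon>0$ and nonzero finite-dimensional $V,W$, such a representation is a $(\delta,\varepsilon)$-expander representation if for every subspace $0\neq U\subset V$ with $\dim U/\dim V\leq\delta$ one has $\dim\sum_{k=1}^m f_k(U)\geq(1+\varepsilon)\frac{\dim W}{\dim V}\dim U$. *)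

theory Defs
  imports "HOL-Computational_Algebra.Polynomial" "HOL-Library.Function_Algebras" Complex_Main
begin

text \<open>Coordinate vector spaces F^d, realised as functions nat => F vanishing outside {0..<d}.\<close>

definition fscale :: "'a::field \<Rightarrow> (nat \<Rightarrow> 'a) \<Rightarrow> (nat \<Rightarrow> 'a)" where
  "fscale c v = (\<lambda>i. c * v i)"

lemma vector_space_fscale: "vector_space (fscale :: 'a::field \<Rightarrow> _)"
  by unfold_locales (auto simp: fscale_def algebra_simps)

definition coord_space :: "nat \<Rightarrow> (nat \<Rightarrow> 'a::field) set" where
  "coord_space d = {v. \<forall>i\<ge>d. v i = 0}"

definition vdim :: "(nat \<Rightarrow> 'a::field) set \<Rightarrow> nat" where
  "vdim U = vector_space.dim fscale U"

definition is_subspace :: "(nat \<Rightarrow> 'a::field) set \<Rightarrow> bool" where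
  "is_subspace U = module.subspace fscale U"

definition Km_rep :: "nat \<Rightarrow> nat \<Rightarrow> nat \<Rightarrow> (nat \<Rightarrow> (nat \<Rightarrow> 'a::field) \<Rightarrow> (nat \<Rightarrow> 'a)) \<Rightarrow> bool" where
  "Km_rep m d1 d2 f \<longleftrightarrow> (\<forall>k<m. Vector_Spaces.linear fscale fscale (f k) \<and>
      f k ` coord_space d1 \<subseteq> coord_space d2)"

definition img_sum :: "nat \<Rightarrow> (nat \<Rightarrow> (nat \<Rightarrow> 'a::field) \<Rightarrow> (nat \<Rightarrow> 'a)) \<Rightarrow> (nat \<Rightarrow> 'a) set \<Rightarrow> (nat \<Rightarrow> 'a) set" where
  "img_sum m f U = module.span fscale (\<Union>k<m. f k ` U)"

definition expander_rep :: "real \<Rightarrow> real \<Rightarrow> nat \<Rightarrow> nat \<Rightarrow> nat \<Rightarrow> (nat \<Rightarrow> (nat \<Rightarrow> 'a::field) \<Rightarrow> (nat \<Rightarrow> 'a)) \<Rightarrow> bool" where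
  "expander_rep \<delta> \<epsilon> m d1 d2 f \<longleftrightarrow> Km_rep m d1 d2 f \<and>
     (\<forall>U. is_subspace U \<and> U \<subseteq> coord_space d1 \<and> U \<noteq> {0} \<and> real (vdim U) / real d1 \<le> \<delta> \<longrightarrow>
        real (vdim (img_sum m f U)) \<ge> (1 + \<epsilon>) * (real d2 / real d1) * real (vdim U))"

definition eps_m :: "nat \<Rightarrow> real \<Rightarrow> real \<Rightarrow> real" where
  "eps_m m \<alpha> \<delta> = (real m * \<delta> + \<alpha> - 2 * \<alpha> * \<delta> - sqrt ((real m * \<delta> - \<alpha>)^2 + 4 * \<delta> * (1 - \<delta>))) / (2 * \<alpha> * \<delta>)"

end

(* Let <e,d> = e1 d1 + e2 d2 - m e1 d2 be the Euler form of K(m). The representations of dimension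
   vector d that have a subrepresentation of dimension vector e are parametrised by
   m d1 d2 + <e,d-e> variables, so a general one has none if <e,d-e> < 0. For slopes e2/e1 below
   (1 + eps_m) alpha and e1/d1 <= delta this is the case, which gives the expanders.

   If eps exceeds eps_m, there are e and d = e + (v,w) with e1/d1 <= delta, e2/e1 < (1 + eps) alpha
   and <e,d-e> > 0, and both e and (v,w) lie in the imaginary cone. Take B to be a sum of copies of
   the dual of a semistable representation, with dimension vector (v,w). A second parameter count
   shows Ext(A,B) = 0 for a general A of dimension vector e if d is large. Then A + B lies in the
   interior of the closed set of representations with a subrepresentation of dimension vector e.
   Instead of algebraic geometry, this is used as follows: on the line from A + B to a given
   representation, A deforms formally to a subrepresentation over F((s)), and a place F((s)) -> F
   with s |-> 1 specialises it to one of the given representation, which is thus no expander. *)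

theory Submission
  imports Defs "HOL-Library.FuncSet" "HOL-Computational_Algebra.Formal_Laurent_Series"
    "HOL-Computational_Algebra.Polynomial_FPS"
begin

section \<open>Function spaces and pivot bases\<close>

text \<open>The parameter counts use no dimension theory. A polynomial map from fewer variables than
  it has target coordinates misses a point, and finitely many such maps jointly miss one; a general
  representation is thus a single point outside finitely many images, one for each choice of pivot
  sets. This works over any infinite field; algebraic closedness enters only through the place. The
  number eps_m arises because (1 + eps_m) alpha is the smaller root in t of <e, d - e> when e1/d1 =
  delta and e2/e1 = t. The obstacle in the converse is that <e, d - e> > 0 alone does not force
  Ext(A, B) = 0. As B consists of copies of one fixed representation, vanishing has to be shown for
  that one only; the number of parameters that do not grow with d is then bounded, while the surplus
  of the count grows linearly. It suffices to treat one large d, as expanders are required for all d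
  of slope alpha. The place is needed because the formal deformation consists of power series, which
  cannot be evaluated at s = 1.\<close>

definition fsc :: "'k::field \<Rightarrow> ('i \<Rightarrow> 'k) \<Rightarrow> ('i \<Rightarrow> 'k)" where
  "fsc c v = (\<lambda>i. c * v i)"

interpretation fs: vector_space "fsc :: 'k::field \<Rightarrow> ('i \<Rightarrow> 'k) \<Rightarrow> _"
  by unfold_locales (auto simp: fsc_def algebra_simps)

lemma fscale_eq_fsc: "fscale = fsc"
  by (intro ext) (simp add: fscale_def fsc_def)

lemma fsc_apply: "fsc c v i = c * v i"
  by (simp add: fsc_def)

lemma sum_fun_apply: "(\<Sum>a\<in>A. f a) i = (\<Sum>a\<in>A. f a i :: 'k::comm_monoid_add)"
  by (induction A rule: infinite_finite_induct) auto

lemma more_vectors_than_span_dependent: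
  fixes v :: "nat \<Rightarrow> ('i \<Rightarrow> 'k::field)"
  assumes "finite T" "card T < K" "\<And>n. n < K \<Longrightarrow> v n \<in> fs.span T"
  shows "\<exists>c. (\<exists>n<K. c n \<noteq> 0) \<and> (\<forall>i. (\<Sum>n<K. c n * v n i) = 0)"
proof (cases "inj_on v {..<K}")
  case True
  have "fs.dependent (v ` {..<K})"
    using fs.independent_span_bound[of T "v ` {..<K}"] assms True by (auto simp: card_image)
  then obtain u where u: "\<exists>w\<in>v ` {..<K}. u w \<noteq> 0" "(\<Sum>w\<in>v ` {..<K}. fsc (u w) w) = 0"
    by (subst (asm) fs.dependent_finite) auto
  have "(\<Sum>n<K. fsc (u (v n)) (v n)) = 0"
    using u(2) True by (simp add: sum.reindex)
  then have "(\<Sum>n<K. u (v n) * v n i) = 0" for i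
    by (metis (no_types, lifting) fsc_apply sum.cong sum_fun_apply zero_fun_apply)
  then show ?thesis using u(1) by (intro exI[of _ "u \<circ> v"]) auto
next
  case False
  then obtain a b where ab: "a < K" "b < K" "a \<noteq> b" "v a = v b" by (auto simp: inj_on_def)
  define c where "c = (\<lambda>n. if n = a then 1 else if n = b then -1 else (0::'k))"
  have "(\<Sum>n<K. c n * v n i) = 0" for i
  proof -
    have "(\<Sum>n<K. c n * v n i) = (\<Sum>n\<in>{a,b}. c n * v n i)"
      by (rule sum.mono_neutral_right) (use ab in \<open>auto simp: c_def\<close>)
    then show ?thesis using ab by (simp add: c_def)
  qed
  moreover have "c a \<noteq> 0" by (simp add: c_def)
  ultimately show ?thesis using ab by blast
qed

section \<open>Echelon bases with entries in a valuation ring\<close>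

definition valuation_ring :: "'k::field set \<Rightarrow> bool" where
  "valuation_ring R \<longleftrightarrow> 0 \<in> R \<and> 1 \<in> R \<and> (\<forall>x\<in>R. \<forall>y\<in>R. x + y \<in> R \<and> x * y \<in> R) \<and>
     (\<forall>x\<in>R. - x \<in> R) \<and> (\<forall>x. x \<in> R \<or> inverse x \<in> R)"

lemma valuation_ringD:
  assumes "valuation_ring R"
  shows "0 \<in> R" "1 \<in> R" "x \<in> R \<Longrightarrow> y \<in> R \<Longrightarrow> x + y \<in> R" "x \<in> R \<Longrightarrow> y \<in> R \<Longrightarrow> x * y \<in> R"
    "x \<in> R \<Longrightarrow> - x \<in> R" "x \<in> R \<Longrightarrow> y \<in> R \<Longrightarrow> x - y \<in> R" "x \<notin> R \<Longrightarrow> inverse x \<in> R"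
proof -
  show "x \<in> R \<Longrightarrow> y \<in> R \<Longrightarrow> x - y \<in> R"
    using assms unfolding valuation_ring_def by (metis add_uminus_conv_diff)
qed (use assms in \<open>auto simp: valuation_ring_def\<close>)

lemma valuation_ring_UNIV: "valuation_ring UNIV"
  by (simp add: valuation_ring_def)

text \<open>The entry found has least valuation, so division by it keeps the whole vector in
  \<open>R\<close>. It exists because divisibility up to \<open>R\<close> is a total preorder on the
  nonzero entries.\<close>

lemma max_valuation_entry:
  assumes R: "valuation_ring R" and "finite N" and "\<exists>i\<in>N. v i \<noteq> 0"
  shows "\<exists>p\<in>N. v p \<noteq> 0 \<and> (\<forall>i\<in>N. v i / v p \<in> R)"
  using assms(2,3)
proof (induction N rule: finite_induct)
  case (insert a N)
  show ?case
  proof (cases "\<exists>i\<in>N. v i \<noteq> 0")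
    case False
    then show ?thesis using insert valuation_ringD[OF R] by auto
  next
    case True
    then obtain p where p: "p \<in> N" "v p \<noteq> 0" "\<forall>i\<in>N. v i / v p \<in> R" using insert by blast
    show ?thesis
    proof (cases "v a / v p \<in> R")
      case True
      then show ?thesis using p by auto
    next
      case False
      then have 1: "v p / v a \<in> R" and "v a \<noteq> 0"
        using valuation_ringD(7)[OF R False] valuation_ringD(1)[OF R] by auto
      have "v i / v a \<in> R" if "i \<in> N" for i
        using valuation_ringD(4)[OF R p(3)[rule_format, OF that] 1] p(2) by simp
      then show ?thesis using \<open>v a \<noteq> 0\<close> valuation_ringD(2)[OF R] by auto
    qed
  qed
qed auto

text \<open>This is a reduced echelon basis: the coordinates of \<open>v\<close> are its own entries
  at the pivots. Membership in \<open>U\<close> thus becomes polynomial in the entries, as the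
  parameter counts require, and the identity block survives ring homomorphisms.\<close>

definition pivot_basis :: "('i \<Rightarrow> 'k::field) set \<Rightarrow> 'i set \<Rightarrow> ('i \<Rightarrow> 'i \<Rightarrow> 'k) \<Rightarrow> bool" where
  "pivot_basis U P u \<longleftrightarrow> finite P \<and> (\<forall>p\<in>P. u p \<in> U \<and> (\<forall>q\<in>P. u p q = (if p = q then 1 else 0))) \<and>
     (\<forall>v\<in>U. \<forall>i. v i = (\<Sum>p\<in>P. v p * u p i))"

text \<open>Gaussian elimination with pivots of least valuation. For \<open>R = UNIV\<close> it is
  the ordinary one; for the valuation ring of a place it gives a basis that can be specialised. A
  maximal partial echelon family spans, as a nonzero remainder would enlarge it.\<close>

lemma pivot_basis_exists:
  fixes U :: "('i \<Rightarrow> 'k::field) set"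
  assumes R: "valuation_ring R" and U: "fs.subspace U" and N: "finite N"
    and supp: "\<And>v i. v \<in> U \<Longrightarrow> i \<notin> N \<Longrightarrow> v i = 0"
  shows "\<exists>P u. P \<subseteq> N \<and> pivot_basis U P u \<and> (\<forall>p\<in>P. \<forall>i. u p i \<in> R)"
proof -
  define Q where "Q = (\<lambda>P u. P \<subseteq> N \<and> (\<forall>p\<in>P. u p \<in> U \<and> (\<forall>i. u p i \<in> R) \<and>
     (\<forall>q\<in>P. u p q = (if p = q then 1 else 0))))"
  have "Q {} (\<lambda>_ _. 0)" by (simp add: Q_def)
  moreover have bound: "card P \<le> card N" if "Q P u" for P u
    using that N by (auto simp: Q_def intro: card_mono)
  ultimately have "\<exists>P. (\<exists>u. Q P u) \<and> (\<forall>P'. (\<exists>u. Q P' u) \<longrightarrow> card P' \<le> card P)"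
    by (intro ex_has_greatest_nat[where k = "{}" and b = "Suc (card N)"]) (auto simp: less_Suc_eq_le)
  then obtain P where P: "\<exists>u. Q P u" and maxP: "\<And>P'. \<exists>u. Q P' u \<Longrightarrow> card P' \<le> card P"
    by blast
  obtain u where u: "Q P u" using P by blast
  have fP: "finite P" using u N by (auto simp: Q_def intro: finite_subset)
  have "v i = (\<Sum>p\<in>P. v p * u p i)" if v: "v \<in> U" for v i
  proof (rule ccontr)
    assume ne: "v i \<noteq> (\<Sum>p\<in>P. v p * u p i)"
    define w where "w = v - (\<Sum>p\<in>P. fsc (v p) (u p))"
    have w_apply: "w j = v j - (\<Sum>p\<in>P. v p * u p j)" for j
      by (simp add: w_def sum_fun_apply fsc_apply)
    have wU: "w \<in> U"
      unfolding w_def using u v by (intro fs.subspace_diff[OF U] fs.subspace_sum[OF U] fs.subspace_scale[OF U])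
        (auto simp: Q_def)
    have w0: "w q = 0" if "q \<in> P" for q
    proof -
      have "(\<Sum>p\<in>P. v p * u p q) = (\<Sum>p\<in>P. if p = q then v p else 0)"
        using u that by (intro sum.cong) (auto simp: Q_def)
      then show ?thesis using fP that by (simp add: w_apply)
    qed
    have "w i \<noteq> 0" using ne by (simp add: w_apply)
    then have "\<exists>i\<in>N. w i \<noteq> 0" using supp[OF wU] by blast
    then obtain r where r: "r \<in> N" "w r \<noteq> 0" "\<forall>i\<in>N. w i / w r \<in> R"
      using max_valuation_entry[OF R N] by blast
    have rP: "r \<notin> P" using w0 r by auto
    define x where "x = fsc (inverse (w r)) w"
    have xU: "x \<in> U" unfolding x_def by (rule fs.subspace_scale[OF U wU])
    have xR: "x i \<in> R" for i
      using r supp[OF wU, of i] valuation_ringD(1)[OF R]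
      by (cases "i \<in> N") (auto simp: x_def fsc_apply field_simps)
    have xr: "x r = 1" using r by (simp add: x_def fsc_apply)
    have x0: "x q = 0" if "q \<in> P" for q using w0[OF that] by (simp add: x_def fsc_apply)
    \<comment> \<open>Column \<open>r\<close> is cleared in the old vectors with multipliers
      \<open>u p r\<close> from \<open>R\<close>, so the enlarged family keeps its entries in
      \<open>R\<close>.\<close>
    define u' where "u' = (\<lambda>p. if p = r then x else u p - fsc (u p r) x)"
    have "Q (insert r P) u'"
      unfolding Q_def
    proof (intro conjI ballI)
      show "insert r P \<subseteq> N" using r u by (auto simp: Q_def)
    next
      fix p assume p: "p \<in> insert r P"
      show "u' p \<in> U" using p xU u
        by (auto simp: u'_def Q_def intro!: fs.subspace_diff[OF U] fs.subspace_scale[OF U])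
      show "\<forall>i. u' p i \<in> R" using p xR u
        by (auto simp: u'_def Q_def fsc_apply intro!: valuation_ringD(6)[OF R] valuation_ringD(4)[OF R])
      fix q assume q: "q \<in> insert r P"
      show "u' p q = (if p = q then 1 else 0)" using p q x0 xr rP u
        by (auto simp: u'_def Q_def fsc_apply)
    qed
    then have "card (insert r P) \<le> card P" using maxP by blast
    then show False using rP fP by simp
  qed
  then have "pivot_basis U P u" using u fP by (simp add: pivot_basis_def Q_def)
  then show ?thesis using u unfolding Q_def by blast
qed

lemma pivot_basis_independent:
  assumes "pivot_basis U P u"
  shows "fs.independent (u ` P)" "inj_on u P"
proof -
  show inj: "inj_on u P"
    unfolding inj_on_def using assms zero_neq_one unfolding pivot_basis_def by metis
  have fP: "finite P" using assms by (simp add: pivot_basis_def)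
  show "fs.independent (u ` P)"
  proof (rule fs.independent_if_scalars_zero)
    show "finite (u ` P)" using fP by simp
    fix f x assume s: "(\<Sum>x\<in>u ` P. fsc (f x) x) = 0" and "x \<in> u ` P"
    then obtain q where q: "q \<in> P" "x = u q" by auto
    have "(\<Sum>p\<in>P. f (u p) * u p q) = 0"
      using s inj by (simp add: sum.reindex fun_eq_iff sum_fun_apply fsc_apply)
    also have "(\<Sum>p\<in>P. f (u p) * u p q) = (\<Sum>p\<in>P. if p = q then f (u p) else 0)"
      using assms q by (intro sum.cong) (auto simp: pivot_basis_def)
    finally show "f x = 0" using fP q by simp
  qed
qed

lemma pivot_basis_expand:
  assumes "pivot_basis U P u" "v \<in> U"
  shows "v = (\<Sum>p\<in>P. fsc (v p) (u p))"
  using assms unfolding pivot_basis_def by (auto simp: fun_eq_iff sum_fun_apply fsc_apply)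

lemma pivot_basis_dim:
  assumes "pivot_basis U P u"
  shows "fs.dim U = card P"
proof -
  have "U \<subseteq> fs.span (u ` P)"
  proof
    fix v assume "v \<in> U"
    then have "v = (\<Sum>p\<in>P. fsc (v p) (u p))" by (rule pivot_basis_expand[OF assms])
    then show "v \<in> fs.span (u ` P)"
      by (metis (no_types, lifting) fs.span_base fs.span_scale fs.span_sum imageI)
  qed
  moreover have "u ` P \<subseteq> U" using assms by (auto simp: pivot_basis_def)
  ultimately show ?thesis
    using pivot_basis_independent[OF assms] by (metis fs.dim_unique card_image)
qed

text \<open>Over a finite field, 1 plus the product of all \<open>[:-a, 1:]\<close> is nonconstant
  and has no root.\<close>

lemma alg_closed_infinite: "infinite (UNIV :: 'a::alg_closed_field set)"
proof
  assume fin: "finite (UNIV :: 'a set)"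
  define p :: "'a poly" where "p = (\<Prod>a\<in>UNIV. [:-a, 1:]) + 1"
  have pr: "degree (\<Prod>a\<in>(UNIV::'a set). [:-a, 1:]) = card (UNIV :: 'a set)"
    by (subst degree_prod_eq_sum_degree) auto
  have "card (UNIV :: 'a set) > 0" using fin by (simp add: card_gt_0_iff)
  then have "degree p > 0" using pr unfolding p_def by (subst degree_add_eq_left) auto
  then obtain x where "poly p x = 0" using alg_closed_imp_poly_has_root by blast
  moreover have "poly (\<Prod>a\<in>UNIV. [:-a, 1:]) x = 0"
    using fin by (auto simp: poly_prod prod_zero_iff intro!: bexI[of _ x])
  ultimately show False by (simp add: p_def)
qed

section \<open>Images of polynomial maps\<close>

text \<open>Polynomials are kept as functions with an upper bound \<open>n\<close> for the degree,
  since only the size of a spanning set is ever used.\<close>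

inductive polyfun :: "'v set \<Rightarrow> nat \<Rightarrow> (('v \<Rightarrow> 'a::field) \<Rightarrow> 'a) \<Rightarrow> bool" for I where
  polyfun_const: "polyfun I n (\<lambda>_. c)"
| polyfun_var: "i \<in> I \<Longrightarrow> polyfun I (Suc n) (\<lambda>z. z i)"
| polyfun_add: "polyfun I n f \<Longrightarrow> polyfun I n g \<Longrightarrow> polyfun I n (\<lambda>z. f z + g z)"
| polyfun_mult: "polyfun I a f \<Longrightarrow> polyfun I b g \<Longrightarrow> polyfun I (a + b) (\<lambda>z. f z * g z)"

lemma polyfun_mono: "polyfun I n f \<Longrightarrow> n \<le> n' \<Longrightarrow> polyfun I n' f"
proof (induction arbitrary: n' rule: polyfun.induct)
  case (polyfun_var i n)
  then show ?case by (cases n') (auto intro: polyfun.polyfun_var)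
next
  case (polyfun_mult a f b g)
  have "polyfun I (a + (n' - a)) (\<lambda>z. f z * g z)"
    by (rule polyfun.polyfun_mult) (use polyfun_mult in auto)
  then show ?case using polyfun_mult.prems by simp
qed (auto intro: polyfun.intros)

lemma polyfun_uminus: "polyfun I n f \<Longrightarrow> polyfun I n (\<lambda>z. - f z)"
  using polyfun_mult[OF polyfun_const[of I 0 "-1"], of n f] by simp

lemma polyfun_diff: "polyfun I n f \<Longrightarrow> polyfun I n g \<Longrightarrow> polyfun I n (\<lambda>z. f z - g z)"
  using polyfun_add[OF _ polyfun_uminus, of I n f g] by simp

lemma polyfun_sum: "(\<And>x. x \<in> A \<Longrightarrow> polyfun I n (f x)) \<Longrightarrow> polyfun I n (\<lambda>z. \<Sum>x\<in>A. f x z)"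
  by (induction A rule: infinite_finite_induct) (auto intro: polyfun.intros)

lemma polyfun_power: "polyfun I n f \<Longrightarrow> polyfun I (k * n) (\<lambda>z. f z ^ k)"
  by (induction k) (auto intro: polyfun.intros)

lemma polyfun_prod:
  "finite A \<Longrightarrow> (\<And>x. x \<in> A \<Longrightarrow> polyfun I (n x) (f x)) \<Longrightarrow> polyfun I (\<Sum>x\<in>A. n x) (\<lambda>z. \<Prod>x\<in>A. f x z)"
  by (induction A rule: finite_induct) (auto intro: polyfun.intros)

definition monomials :: "'v set \<Rightarrow> nat \<Rightarrow> (('v \<Rightarrow> 'a::field) \<Rightarrow> 'a) set" where
  "monomials I n = {\<lambda>z. \<Prod>i\<in>I. z i ^ a i | a. sum a I \<le> n}"

text \<open>Every single exponent is at most \<open>n\<close>. The bound is crude, but only the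
  order of growth \<open>card I\<close> in \<open>n\<close> matters.\<close>

lemma monomials_finite_card:
  assumes "finite I"
  shows "finite (monomials I n :: (('v \<Rightarrow> 'a::field) \<Rightarrow> 'a) set)"
    and "card (monomials I n :: (('v \<Rightarrow> 'a::field) \<Rightarrow> 'a) set) \<le> (n + 1) ^ card I"
proof -
  let ?E = "I \<rightarrow>\<^sub>E {0..n}"
  have sub: "monomials I n \<subseteq> (\<lambda>a z. \<Prod>i\<in>I. z i ^ a i :: 'a) ` ?E"
  proof
    fix f :: "('v \<Rightarrow> 'a) \<Rightarrow> 'a" assume "f \<in> monomials I n"
    then obtain a where a: "f = (\<lambda>z. \<Prod>i\<in>I. z i ^ a i)" "sum a I \<le> n"
      by (auto simp: monomials_def)
    have "a i \<le> n" if "i \<in> I" for i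
      using member_le_sum[of i I a] that assms a(2) by simp
    then show "f \<in> (\<lambda>a z. \<Prod>i\<in>I. z i ^ a i) ` ?E"
      using a(1) by (intro image_eqI[of _ _ "restrict a I"]) (auto intro!: prod.cong)
  qed
  have finE: "finite ?E" using assms by (intro finite_PiE) auto
  show "finite (monomials I n :: (('v \<Rightarrow> 'a::field) \<Rightarrow> 'a) set)"
    using finite_subset[OF sub] finE by auto
  have "card (monomials I n :: (('v \<Rightarrow> 'a::field) \<Rightarrow> 'a) set) \<le> card ?E"
    by (rule surj_card_le[OF finE sub])
  also have "\<dots> = (n + 1) ^ card I" using assms by (simp add: card_PiE)
  finally show "card (monomials I n :: (('v \<Rightarrow> 'a::field) \<Rightarrow> 'a) set) \<le> (n + 1) ^ card I" .
qed

lemma span_monomials_mult: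
  fixes f g :: "('v \<Rightarrow> 'a::field) \<Rightarrow> 'a"
  assumes "f \<in> fs.span (monomials I a)" "g \<in> fs.span (monomials I b)"
  shows "(\<lambda>z. f z * g z) \<in> fs.span (monomials I (a + b))"
proof -
  have zero: "(\<lambda>z::'v \<Rightarrow> 'a. 0 :: 'a) = 0" by (simp add: fun_eq_iff fsc_apply)
  show ?thesis
    using assms(1)
  proof (induction rule: fs.span_induct_alt)
    case base
    then show ?case by (simp only: zero mult_zero_left mult_zero_right zero_fun_apply fs.span_zero)
  next
    case (step c x y)
    have "(\<lambda>z. x z * g z) \<in> fs.span (monomials I (a + b))"
      using assms(2)
    proof (induction rule: fs.span_induct_alt)
      case base
      then show ?case by (simp only: zero mult_zero_left mult_zero_right zero_fun_apply fs.span_zero)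
    next
      case (step d u v)
      obtain e where e: "x = (\<lambda>z. \<Prod>i\<in>I. z i ^ e i)" "sum e I \<le> a"
        using \<open>x \<in> monomials I a\<close> by (auto simp: monomials_def)
      obtain e' where e': "u = (\<lambda>z. \<Prod>i\<in>I. z i ^ e' i)" "sum e' I \<le> b"
        using step by (auto simp: monomials_def)
      have "(\<lambda>z. x z * u z) = (\<lambda>z. \<Prod>i\<in>I. z i ^ (e i + e' i))"
        by (simp add: e e' power_add prod.distrib)
      moreover have "sum (\<lambda>i. e i + e' i) I \<le> a + b"
        using e(2) e'(2) by (simp add: sum.distrib)
      ultimately have "(\<lambda>z. x z * u z) \<in> monomials I (a + b)"
        unfolding monomials_def by (intro CollectI exI[of _ "\<lambda>i. e i + e' i"]) blast
      then have "fsc d (\<lambda>z. x z * u z) + (\<lambda>z. x z * v z) \<in> fs.span (monomials I (a + b))"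
        by (intro fs.span_add fs.span_scale step.IH fs.span_base)
      moreover have "fsc d (\<lambda>z. x z * u z) + (\<lambda>z. x z * v z) = (\<lambda>z. x z * (fsc d u + v) z)"
        by (simp add: fun_eq_iff fsc_apply algebra_simps)
      ultimately show ?case by simp
    qed
    then have "fsc c (\<lambda>z. x z * g z) + (\<lambda>z. y z * g z) \<in> fs.span (monomials I (a + b))"
      using step by (intro fs.span_add fs.span_scale) auto
    moreover have "fsc c (\<lambda>z. x z * g z) + (\<lambda>z. y z * g z) = (\<lambda>z. (fsc c x + y) z * g z)"
      by (simp add: fun_eq_iff fsc_apply algebra_simps)
    ultimately show ?case by simp
  qed
qed

lemma polyfun_in_span:
  assumes "polyfun I n f" "finite I"
  shows "f \<in> fs.span (monomials I n)"
  using assms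
proof (induction rule: polyfun.induct)
  case (polyfun_const n c)
  have "(\<lambda>z. 1) \<in> monomials I n"
    unfolding monomials_def by (intro CollectI exI[of _ "\<lambda>_. 0"]) auto
  then have "fsc c (\<lambda>z. 1) \<in> fs.span (monomials I n)"
    by (intro fs.span_scale fs.span_base)
  moreover have "fsc c (\<lambda>z. 1) = (\<lambda>z::'a \<Rightarrow> 'b. c)" by (simp add: fun_eq_iff fsc_apply)
  ultimately show ?case by metis
next
  case (polyfun_var i n)
  have "(\<Prod>j\<in>I. z j ^ (if j = i then 1 else 0)) = (z i :: 'b)" for z
  proof -
    have "(\<Prod>j\<in>I. z j ^ (if j = i then 1 else 0)) = (\<Prod>j\<in>I. if j = i then z j else 1)"
      by (rule prod.cong) auto
    then show ?thesis using polyfun_var by simp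
  qed
  then have "(\<lambda>z. z i :: 'b) \<in> monomials I (Suc n)"
    unfolding monomials_def using polyfun_var
    by (intro CollectI exI[of _ "\<lambda>j. if j = i then 1 else 0"]) (auto simp: fun_eq_iff)
  then show ?case by (rule fs.span_base)
next
  case (polyfun_add n f g)
  then have "f + g \<in> fs.span (monomials I n)" by (intro fs.span_add) auto
  then show ?case by (simp add: plus_fun_def)
next
  case (polyfun_mult a f b g)
  then show ?case by (intro span_monomials_mult) auto
qed

lemma digit_sum:
  fixes b n :: nat
  assumes "n < b ^ M"
  shows "(\<Sum>i<M. b ^ i * (n div b ^ i mod b)) = n"
proof -
  have "(\<Sum>i<M. b ^ i * (n div b ^ i mod b)) = n mod b ^ M"
  proof (induction M)
    case (Suc M)
    then show ?case by (simp add: mod_mult2_eq mult.commute[of b "b ^ M"])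
  qed simp
  then show ?thesis using assms by simp
qed

text \<open>A power product of the coordinates of the target in which all exponents are at most \<open>D\<close> has
  its exponents as the base \<open>D + 1\<close> digits of a number \<open>n\<close>. Such products are linearly independent, as
  substituting \<open>x ^ (D + 1) ^ i\<close> for the coordinates turns them into the powers \<open>x ^ n\<close>, and for
  large \<open>D\<close> there are more of them than monomials in the parameters of the degree that is needed.\<close>

lemma exists_outside_polynomial_images:
  fixes \<Psi> :: "'j \<Rightarrow> ('v \<Rightarrow> 'a::field) \<Rightarrow> 'y \<Rightarrow> 'a"
  assumes inf: "infinite (UNIV :: 'a set)"
    and J: "finite J" and Y: "finite Y"
    and I: "\<And>j. j \<in> J \<Longrightarrow> finite (I j)" "\<And>j. j \<in> J \<Longrightarrow> card (I j) < card Y"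
    and \<Psi>: "\<And>j y. j \<in> J \<Longrightarrow> y \<in> Y \<Longrightarrow> polyfun (I j) c (\<lambda>z. \<Psi> j z y)"
  shows "\<exists>w :: 'y \<Rightarrow> 'a. \<forall>j\<in>J. \<forall>z. \<exists>y\<in>Y. \<Psi> j z y \<noteq> w y"
proof (rule ccontr)
  assume contra: "\<not> ?thesis"
  then have cover: "\<exists>j\<in>J. \<exists>z. \<forall>y\<in>Y. \<Psi> j z y = w y" for w :: "'y \<Rightarrow> 'a"
    by (auto dest!: spec[of _ w])
  then obtain j0 where "j0 \<in> J" by blast
  define M where "M = card Y"
  have M: "M > 0" using I(2)[OF \<open>j0 \<in> J\<close>] by (simp add: M_def)
  obtain h where h: "bij_betw h {..<M} Y"
    using ex_bij_betw_nat_finite[OF Y] by (auto simp: M_def atLeast0LessThan)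
  \<comment> \<open>Chosen so that the monomials, whose number is at most
    \<open>card J * (N + 1) ^ (M - 1)\<close>, are bounded by \<open>D * b ^ (M - 1)\<close>, which
    is less than the number \<open>b ^ M\<close> of power products.\<close>
  define D where "D = card J * (M * c + 1) ^ (M - 1)"
  define b where "b = D + 1"
  define R where "R = (\<lambda>n (w::'y \<Rightarrow> 'a). \<Prod>i<M. w (h i) ^ (n div b ^ i mod b))"
  define N where "N = M * (D * c)"
  have polyR: "polyfun (I j) N (\<lambda>z. R n (\<Psi> j z))" if "j \<in> J" for j n
  proof -
    have "polyfun (I j) (\<Sum>i<M. (n div b ^ i mod b) * c) (\<lambda>z. \<Prod>i<M. \<Psi> j z (h i) ^ (n div b ^ i mod b))"
      using that h by (intro polyfun_prod polyfun_power \<Psi>) (auto simp: bij_betw_def)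
    moreover have "(\<Sum>i<M. (n div b ^ i mod b) * c) \<le> (\<Sum>i<M. D * c)"
      unfolding b_def by (intro sum_mono mult_right_mono) (auto simp: less_Suc_eq_le)
    ultimately show ?thesis unfolding R_def N_def by (auto intro: polyfun_mono)
  qed
  \<comment> \<open>Functions on the disjoint union of the parameter spaces: one linear relation
    among the power products then holds on all images at once.\<close>
  define ext where "ext = (\<lambda>(j::'j) (q::('v \<Rightarrow> 'a) \<Rightarrow> 'a) (j' :: 'j, z). if j' = j then q z else 0)"
  define T where "T = (\<Union>j\<in>J. ext j ` monomials (I j) N)"
  have finT: "finite T"
    unfolding T_def using J I(1) by (intro finite_UN_I finite_imageI monomials_finite_card(1))
  have "card T \<le> (\<Sum>j\<in>J. card (ext j ` (monomials (I j) N :: (('v \<Rightarrow> 'a) \<Rightarrow> 'a) set)))"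
    unfolding T_def by (rule card_UN_le[OF J])
  also have "\<dots> \<le> (\<Sum>j\<in>J. (N + 1) ^ (M - 1))"
  proof (rule sum_mono)
    fix j assume j: "j \<in> J"
    have "card (ext j ` (monomials (I j) N :: (('v \<Rightarrow> 'a) \<Rightarrow> 'a) set)) \<le> (N + 1) ^ card (I j)"
      using monomials_finite_card[OF I(1)[OF j]] card_image_le le_trans by blast
    also have "\<dots> \<le> (N + 1) ^ (M - 1)"
      using I(2)[OF j] unfolding M_def[symmetric] by (intro power_increasing) auto
    finally show "card (ext j ` (monomials (I j) N :: (('v \<Rightarrow> 'a) \<Rightarrow> 'a) set)) \<le> (N + 1) ^ (M - 1)" .
  qed
  also have "\<dots> = card J * (N + 1) ^ (M - 1)" by simp
  also have "\<dots> \<le> card J * ((M * c + 1) * b) ^ (M - 1)"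
    by (intro mult_left_mono power_mono) (auto simp: N_def b_def algebra_simps)
  also have "\<dots> = D * b ^ (M - 1)" unfolding D_def power_mult_distrib by simp
  also have "\<dots> < b * b ^ (M - 1)" by (simp add: b_def)
  also have "\<dots> = b ^ M" using M by (simp add: power_eq_if)
  finally have cardT: "card T < b ^ M" .
  define v where "v = (\<lambda>n (j, z). if j \<in> J then R n (\<Psi> j z) else 0)"
  have "v n \<in> fs.span T" for n
  proof -
    have ext_span: "ext j q \<in> fs.span T" if "q \<in> fs.span (monomials (I j) N)" "j \<in> J" for j q
      using that(1)
    proof (induction rule: fs.span_induct_alt)
      case base
      have "ext j 0 = 0" by (auto simp: ext_def fun_eq_iff fsc_apply)
      then show ?case by (simp only: fs.span_zero)
    next
      case (step d x y)
      have "ext j (fsc d x + y) = fsc d (ext j x) + ext j y" by (auto simp: ext_def fun_eq_iff fsc_apply)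
      moreover have "ext j x \<in> T" using step that by (auto simp: T_def)
      ultimately show ?case by (simp only:) (intro fs.span_add fs.span_scale step.IH fs.span_base)
    qed
    have "v n = (\<Sum>j\<in>J. ext j (\<lambda>z. R n (\<Psi> j z)))"
    proof
      fix p show "v n p = (\<Sum>j\<in>J. ext j (\<lambda>z. R n (\<Psi> j z))) p"
        using J by (cases p) (simp add: v_def ext_def sum_fun_apply)
    qed
    then show ?thesis
      using ext_span polyfun_in_span[OF polyR I(1)] by (simp add: fs.span_sum)
  qed
  then obtain a where a: "\<exists>n<b ^ M. a n \<noteq> 0" "\<And>p. (\<Sum>n<b ^ M. a n * v n p) = 0"
    using more_vectors_than_span_dependent[OF finT cardT, of v] by blast
  have zero: "(\<Sum>n<b ^ M. a n * R n w) = 0" for w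
  proof -
    obtain j z where jz: "j \<in> J" "\<forall>y\<in>Y. \<Psi> j z y = w y" using cover by blast
    have "R n (\<Psi> j z) = R n w" for n
      unfolding R_def using jz h by (intro prod.cong) (auto simp: bij_betw_def)
    then show ?thesis using a(2)[of "(j, z)"] jz by (simp add: v_def)
  qed
  \<comment> \<open>As the images are assumed to cover everything, the relation holds at every
    \<open>w\<close>; on the curve of Kronecker substitution it becomes a polynomial with infinitely
    many roots.\<close>
  define P where "P = (\<Sum>n<b ^ M. monom (a n) n)"
  have "poly P x = 0" for x
  proof -
    define w where "w = (\<lambda>y. x ^ (b ^ the_inv_into {..<M} h y))"
    have "R n w = x ^ n" if "n < b ^ M" for n
    proof -
      have "R n w = (\<Prod>i<M. x ^ (b ^ i * (n div b ^ i mod b)))"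
        unfolding R_def w_def using h
        by (intro prod.cong) (auto simp: bij_betw_def the_inv_into_f_f power_mult)
      also have "\<dots> = x ^ n" using digit_sum[OF that] by (simp add: power_sum[symmetric])
      finally show ?thesis .
    qed
    then show ?thesis using zero[of w] by (simp add: P_def poly_sum poly_monom)
  qed
  then have "P = 0" using inf poly_roots_finite[of P] by auto
  moreover obtain n where n: "n < b ^ M" "a n \<noteq> 0" using a by blast
  have "coeff P n = a n" using n by (simp add: P_def coeff_sum)
  ultimately show False using n by simp
qed

section \<open>General representations\<close>

text \<open>\<open>M k i\<close> is the image of the i-th unit vector. The cut-off at
  \<open>d2\<close> makes every array of scalars a representation, so that the arrays form an affine
  space.\<close>

definition mat_rep :: "nat \<Rightarrow> nat \<Rightarrow> (nat \<Rightarrow> nat \<Rightarrow> nat \<Rightarrow> 'a::field) \<Rightarrow> nat \<Rightarrow> (nat \<Rightarrow> 'a) \<Rightarrow> nat \<Rightarrow> 'a" where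
  "mat_rep d1 d2 M k v = (\<lambda>q. if q < d2 then \<Sum>i<d1. v i * M k i q else 0)"

lemma Km_rep_mat_rep: "Km_rep m d1 d2 (mat_rep d1 d2 M)"
proof -
  have "Vector_Spaces.linear fsc fsc (mat_rep d1 d2 M k)" for k
    using fs.vector_space_axioms unfolding Vector_Spaces.linear_iff
    by (auto simp: mat_rep_def fsc_apply fun_eq_iff algebra_simps sum.distrib sum_distrib_left)
  then show ?thesis
    by (auto simp: Km_rep_def fscale_eq_fsc coord_space_def mat_rep_def)
qed

text \<open>A representation with a subrepresentation \<open>(U, W)\<close> is recovered
  polynomially from echelon bases of both spaces, the coordinates of the images of the first basis
  in the second one, and the rows of \<open>M\<close> outside the pivots of \<open>U\<close>. If the
  inequality fails, these are too few variables.\<close>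

lemma generic_rep_subrep_dims:
  assumes inf: "infinite (UNIV :: 'a::field set)"
  shows "\<exists>M :: nat \<Rightarrow> nat \<Rightarrow> nat \<Rightarrow> 'a. \<forall>U W. fs.subspace U \<and> U \<subseteq> coord_space d1 \<and>
     fs.subspace W \<and> W \<subseteq> coord_space d2 \<and> (\<forall>k<m. mat_rep d1 d2 M k ` U \<subseteq> W) \<longrightarrow>
     m * fs.dim U * (d2 - fs.dim W) \<le> fs.dim U * (d1 - fs.dim U) + fs.dim W * (d2 - fs.dim W)"
proof -
  define bad where "bad = (\<lambda>p q. p * (d1 - p) + q * (d2 - q) < m * p * (d2 - q))"
  define J where "J = {(P, Q). P \<subseteq> {..<d1} \<and> Q \<subseteq> {..<d2} \<and> bad (card P) (card Q)}"
  define Y where "Y = {..<m} \<times> {..<d1} \<times> {..<d2}"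
  \<comment> \<open>The first component is a tag: 0 and 1 for the non-pivot entries of the bases of
    \<open>U\<close> and \<open>W\<close>, 2 for the coordinates of the images in \<open>W\<close>,
    3 for the rows of \<open>M\<close> outside \<open>P\<close>.\<close>
  define I :: "nat set \<times> nat set \<Rightarrow> (nat \<times> nat \<times> nat \<times> nat) set" where
    "I = (\<lambda>(P, Q). {0} \<times> {0} \<times> P \<times> ({..<d1} - P) \<union> {1} \<times> {0} \<times> Q \<times> ({..<d2} - Q) \<union>
      {2} \<times> {..<m} \<times> P \<times> Q \<union> {3} \<times> {..<m} \<times> ({..<d1} - P) \<times> {..<d2})"
  \<comment> \<open>For \<open>i\<close> in \<open>P\<close> the basis vector is the i-th unit
    vector plus non-pivot entries, so row \<open>i\<close> of \<open>M\<close> is the image of the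
    basis vector minus the contribution of the rows outside \<open>P\<close>.\<close>
  define \<Psi> :: "nat set \<times> nat set \<Rightarrow> (nat \<times> nat \<times> nat \<times> nat \<Rightarrow> 'a) \<Rightarrow> nat \<times> nat \<times> nat \<Rightarrow> 'a" where
    "\<Psi> = (\<lambda>(P, Q) z (k, i, q). if i \<notin> P then z (3, k, i, q)
      else (\<Sum>r\<in>Q. z (2, k, i, r) * (if q \<in> Q then (if q = r then 1 else 0) else z (1, 0, r, q)))
        - (\<Sum>j\<in>{..<d1} - P. z (0, 0, i, j) * z (3, k, j, q)))"
  have "\<exists>w :: nat \<times> nat \<times> nat \<Rightarrow> 'a. \<forall>j\<in>J. \<forall>z. \<exists>y\<in>Y. \<Psi> j z y \<noteq> w y"
  proof (rule exists_outside_polynomial_images[where I = I and c = 2, OF inf])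
    show "finite J"
      by (rule finite_subset[of _ "Pow {..<d1} \<times> Pow {..<d2}"]) (auto simp: J_def)
    show "finite Y" by (simp add: Y_def)
  next
    fix j assume "j \<in> J"
    then obtain P Q where j: "j = (P, Q)" and P: "P \<subseteq> {..<d1}" and Q: "Q \<subseteq> {..<d2}"
      and b: "bad (card P) (card Q)" by (auto simp: J_def)
    have fin: "finite P" "finite Q" using P Q by (auto intro: finite_subset)
    show "finite (I j)" using fin by (simp add: j I_def)
    have p: "card P \<le> d1" and q: "card Q \<le> d2"
      using card_mono[OF _ P] card_mono[OF _ Q] by auto
    have "card (I j) \<le> card P * (d1 - card P) + card Q * (d2 - card Q) + m * (card P * card Q)
      + m * ((d1 - card P) * d2)"
      unfolding j I_def prod.case
      by (intro order.trans[OF card_Un_le] add_mono) 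
         (use P Q fin in \<open>simp_all add: card_cartesian_product card_Diff_subset\<close>)
    also have "\<dots> < m * card P * (d2 - card Q) + m * (card P * card Q) + m * ((d1 - card P) * d2)"
      using b by (simp add: bad_def)
    also have "\<dots> = m * (card P * ((d2 - card Q) + card Q) + (d1 - card P) * d2)"
      by (simp add: algebra_simps del: le_add_diff_inverse le_add_diff_inverse2)
    also have "\<dots> = m * ((card P + (d1 - card P)) * d2)"
      using q by (simp only: add_mult_distrib le_add_diff_inverse2)
    also have "\<dots> = card Y" using p by (simp add: Y_def card_cartesian_product)
    finally show "card (I j) < card Y" .
    fix y assume "y \<in> Y"
    then obtain k i q where y: "y = (k, i, q)" "k < m" "i < d1" "q < d2" by (auto simp: Y_def)
    have var: "polyfun (I j) 1 (\<lambda>z. z v)" if "v \<in> I j" for v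
      using polyfun_var[OF that, of 0] by simp
    show "polyfun (I j) 2 (\<lambda>z. \<Psi> j z y)"
    proof (cases "i \<in> P")
      case False
      then have "(3, k, i, q) \<in> I j" using y by (auto simp: I_def j)
      then have "polyfun (I j) 2 (\<lambda>z. z (3, k, i, q) :: 'a)" by (intro polyfun_mono[OF var]) auto
      then show ?thesis using False by (simp add: \<Psi>_def j y)
    next
      case True
      have "polyfun (I j) (1 + 1) (\<lambda>z. (\<Sum>r\<in>Q. z (2, k, i, r) *
          (if q \<in> Q then (if q = r then 1 else 0) else z (1, 0, r, q)))
        - (\<Sum>j\<in>{..<d1} - P. z (0, 0, i, j) * z (3, k, j, q)))"
      proof (intro polyfun_diff polyfun_sum polyfun_mult)
        fix r assume "r \<in> Q"
        show "polyfun (I j) 1 (\<lambda>z. if q \<in> Q then (if q = r then 1 else 0) else z (1, 0, r, q))"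
        proof (cases "q \<in> Q")
          case False
          then have "(1, 0, r, q) \<in> I j" using \<open>r \<in> Q\<close> y by (simp add: I_def j)
          then show ?thesis using False var by simp
        qed (simp add: polyfun_const)
      qed (rule var, use True y in \<open>simp add: I_def j\<close>)+
      then show ?thesis using True by (simp add: \<Psi>_def j y numeral_2_eq_2)
    qed
  qed
  then obtain w :: "nat \<times> nat \<times> nat \<Rightarrow> 'a" where w: "\<And>j z. j \<in> J \<Longrightarrow> \<exists>y\<in>Y. \<Psi> j z y \<noteq> w y" by blast
  define M where "M = (\<lambda>k i q. w (k, i, q))"
  show ?thesis
  proof (intro exI[of _ M] allI impI, elim conjE, rule ccontr)
    fix U W assume U: "fs.subspace U" "U \<subseteq> coord_space d1" and W: "fs.subspace W" "W \<subseteq> coord_space d2"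
      and f: "\<forall>k<m. mat_rep d1 d2 M k ` U \<subseteq> W"
      and contra: "\<not> m * fs.dim U * (d2 - fs.dim W) \<le> fs.dim U * (d1 - fs.dim U) + fs.dim W * (d2 - fs.dim W)"
    obtain P u where P: "P \<subseteq> {..<d1}" and u: "pivot_basis U P u"
      using pivot_basis_exists[OF valuation_ring_UNIV U(1), of "{..<d1}"] U(2)
      by (auto simp: coord_space_def subset_iff)
    obtain Q t where Q: "Q \<subseteq> {..<d2}" and t: "pivot_basis W Q t"
      using pivot_basis_exists[OF valuation_ring_UNIV W(1), of "{..<d2}"] W(2)
      by (auto simp: coord_space_def subset_iff)
    have "(P, Q) \<in> J" using P Q contra
      by (simp add: J_def bad_def pivot_basis_dim[OF u] pivot_basis_dim[OF t])
    define z where "z = (\<lambda>(c::nat, k::nat, i::nat, j::nat). if c = 0 then u i j else if c = 1 then t i j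
      else if c = 2 then mat_rep d1 d2 M k (u i) j else M k i j)"
    have z0: "z (0, k, i, j) = u i j" and z3: "z (3, k, i, j) = M k i j" for k i j
      by (auto simp: z_def)
    have "\<Psi> (P, Q) z y = w y" if yY: "y \<in> Y" for y
    proof -
      obtain k i q where y: "y = (k, i, q)" "k < m" "i < d1" "q < d2" using yY by (auto simp: Y_def)
      show ?thesis
      proof (cases "i \<in> P")
        case False
        then show ?thesis by (simp add: \<Psi>_def y z_def M_def)
      next
        case True
        have tq: "t r q = (if q \<in> Q then (if q = r then 1 else 0) else t r q)" if "r \<in> Q" for r
          using t that by (auto simp: pivot_basis_def)
        have "mat_rep d1 d2 M k (u i) \<in> W"
          using f y True u by (auto simp: pivot_basis_def)
        then have "mat_rep d1 d2 M k (u i) q = (\<Sum>r\<in>Q. mat_rep d1 d2 M k (u i) r * t r q)"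
          using t unfolding pivot_basis_def by blast
        also have "\<dots> = (\<Sum>r\<in>Q. z (2, k, i, r) * (if q \<in> Q then (if q = r then 1 else 0) else z (1, 0, r, q)))"
          by (rule sum.cong) (use tq in \<open>auto simp: z_def\<close>)
        finally have 1: "mat_rep d1 d2 M k (u i) q = \<dots>" .
        have "mat_rep d1 d2 M k (u i) q = (\<Sum>j<d1. u i j * M k j q)"
          using y by (simp add: mat_rep_def)
        also have "\<dots> = (\<Sum>j\<in>{..<d1} - P. u i j * M k j q) + (\<Sum>j\<in>P. u i j * M k j q)"
          using P by (subst sum.subset_diff[of P]) auto
        also have "(\<Sum>j\<in>P. u i j * M k j q) = (\<Sum>j\<in>P. if i = j then M k j q else 0)"
          by (rule sum.cong) (use u True in \<open>auto simp: pivot_basis_def\<close>)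
        also have "\<dots> = M k i q" using True P finite_subset[OF P] by simp
        finally show ?thesis using True 1 by (simp add: \<Psi>_def y z0 z3 M_def algebra_simps)
      qed
    qed
    then show False using w[OF \<open>(P, Q) \<in> J\<close>, of z] by blast
  qed
qed

text \<open>\<open>euler_fn m \<alpha> x t\<close> is the value of the Euler form at \<open>(e, d - e)\<close>, divided by \<open>x * d1\<^sup>2\<close>, for
  the dimension vectors \<open>d = (d1, \<alpha> * d1)\<close> and \<open>e = (x * d1, t * x * d1)\<close>.\<close>

definition euler_fn :: "real \<Rightarrow> real \<Rightarrow> real \<Rightarrow> real \<Rightarrow> real" where
  "euler_fn m \<alpha> x t = 1 + t * \<alpha> - m * \<alpha> - x * (1 + t^2 - m * t)"

text \<open>The function is affine in \<open>x\<close>; this interpolates between its values at 0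
  and 1.\<close>

lemma euler_fn_eq:
  "euler_fn m \<alpha> x t = (1 - x) * (1 + t * \<alpha> - m * \<alpha>) + x * ((\<alpha> - t) * (t - m))"
  by (simp add: euler_fn_def algebra_simps power2_eq_square)

lemma quadratic_neg_bounds:
  fixes m \<alpha> :: real
  assumes "m \<ge> 0" "\<alpha>^2 - m * \<alpha> + 1 < 0"
  shows "0 < \<alpha>" "\<alpha> < m"
proof -
  have "m * \<alpha> > 0" using assms(2) zero_le_power2[of \<alpha>] by linarith
  then show p: "0 < \<alpha>" using assms(1) by (simp add: zero_less_mult_iff)
  have "\<alpha> * \<alpha> < m * \<alpha>" using assms(2) by (simp add: power2_eq_square)
  then show "\<alpha> < m" using p by simp
qed

text \<open>Both endpoint values in \<open>x\<close> are negative: at 0 by the assumption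
  \<open>q\<close>, at 1 since \<open>t < \<alpha> < m\<close>. This is what makes general
  representations semistable.\<close>

lemma euler_fn_neg_below:
  assumes m: "m \<ge> 0" and q: "\<alpha>^2 - m * \<alpha> + 1 < 0" and x: "0 \<le> x" "x \<le> 1" and t: "t < \<alpha>"
  shows "euler_fn m \<alpha> x t < 0"
proof -
  note b = quadratic_neg_bounds[OF m q]
  have "t * \<alpha> \<le> \<alpha> * \<alpha>" using b t by (intro mult_right_mono) auto
  then have 1: "1 + t * \<alpha> - m * \<alpha> < 0" using q by (simp add: power2_eq_square)
  have 2: "(\<alpha> - t) * (t - m) < 0" using b t by (intro mult_pos_neg) auto
  show ?thesis
  proof (cases "x = 0")
    case False
    have "(1 - x) * (1 + t * \<alpha> - m * \<alpha>) \<le> 0" using x 1 by (intro mult_nonneg_nonpos) auto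
    moreover have "x * ((\<alpha> - t) * (t - m)) < 0" using x False 2 by (intro mult_pos_neg[of x]) auto
    ultimately show ?thesis by (simp add: euler_fn_eq)
  qed (use 1 in \<open>simp add: euler_fn_eq\<close>)
qed

text \<open>In the range considered below, this is the smaller root in \<open>t\<close> of the
  concave quadratic \<open>euler_fn m \<alpha> \<delta> t\<close>.\<close>

definition crit_slope :: "nat \<Rightarrow> real \<Rightarrow> real \<Rightarrow> real" where
  "crit_slope m \<alpha> \<delta> = (1 + eps_m m \<alpha> \<delta>) * \<alpha>"

context
  fixes m :: nat and \<delta> \<alpha> :: real
  assumes \<delta>: "0 < \<delta>" "\<delta> < 1" and q: "\<alpha>^2 - real m * \<alpha> + 1 < 0"
begin

lemma crit_slope_eq:
  "2 * \<delta> * crit_slope m \<alpha> \<delta> = real m * \<delta> + \<alpha> - sqrt ((real m * \<delta> - \<alpha>)^2 + 4 * \<delta> * (1 - \<delta>))"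
  using \<delta> quadratic_neg_bounds[OF _ q] unfolding crit_slope_def eps_m_def
  by (simp add: field_simps)

text \<open>The squares of the two terms of the numerator differ by
  \<open>- 4 * \<delta> * (1 - \<delta>)\<close> times the Tits form of
  \<open>(1, \<alpha>)\<close>, which is negative.\<close>

lemma eps_m_pos:
  assumes "real m * \<delta> + \<alpha> - 2 * \<alpha> * \<delta> > 0"
  shows "eps_m m \<alpha> \<delta> > 0"
proof -
  have "(real m * \<delta> + \<alpha> - 2 * \<alpha> * \<delta>)^2 - ((real m * \<delta> - \<alpha>)^2 + 4 * \<delta> * (1 - \<delta>)) =
    - (4 * \<delta> * (1 - \<delta>) * (\<alpha>^2 - real m * \<alpha> + 1))"
    by (simp add: algebra_simps power2_eq_square)
  moreover have "4 * \<delta> * (1 - \<delta>) * (\<alpha>^2 - real m * \<alpha> + 1) < 0"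
    using \<delta> q by (intro mult_pos_neg) auto
  ultimately have "sqrt ((real m * \<delta> - \<alpha>)^2 + 4 * \<delta> * (1 - \<delta>)) < real m * \<delta> + \<alpha> - 2 * \<alpha> * \<delta>"
    using assms by (intro real_less_lsqrt) auto
  then show ?thesis
    using \<delta> quadratic_neg_bounds[OF _ q] by (simp add: eps_m_def)
qed

lemma crit_slope_less: "crit_slope m \<alpha> \<delta> < real m"
proof -
  have "\<bar>real m * \<delta> - \<alpha>\<bar> < sqrt ((real m * \<delta> - \<alpha>)^2 + 4 * \<delta> * (1 - \<delta>))"
    using \<delta> by (intro real_less_rsqrt) auto
  then have "2 * \<delta> * crit_slope m \<alpha> \<delta> < 2 * (real m * \<delta>)"
    unfolding crit_slope_eq by linarith
  then show ?thesis using \<delta> by simp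
qed

text \<open>The leading coefficient in \<open>t\<close> is \<open>- \<delta>\<close> and the roots
  have sum \<open>m + \<alpha> / \<delta>\<close>, so the second factor belongs to the larger
  root.\<close>

lemma euler_fn_factor:
  "\<delta> * euler_fn m \<alpha> \<delta> t = (\<delta> * t - \<delta> * crit_slope m \<alpha> \<delta>) * (real m * \<delta> + \<alpha> - \<delta> * crit_slope m \<alpha> \<delta> - \<delta> * t)"
proof -
  define S where "S = sqrt ((real m * \<delta> - \<alpha>)^2 + 4 * \<delta> * (1 - \<delta>))"
  have S: "S * S = (real m * \<delta> - \<alpha>)^2 + 4 * \<delta> * (1 - \<delta>)"
    using \<delta> unfolding S_def by simp
  define y where "y = \<delta> * crit_slope m \<alpha> \<delta>"
  have y: "S = real m * \<delta> + \<alpha> - 2 * y" using crit_slope_eq unfolding S_def y_def by simp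
  have "y * (real m * \<delta> + \<alpha>) - y * y = real m * \<delta> * \<alpha> - \<delta> * (1 - \<delta>)"
    using S unfolding y by (simp add: algebra_simps power2_eq_square)
  then show ?thesis unfolding y_def[symmetric] euler_fn_def
    by (simp add: algebra_simps power2_eq_square)
qed

lemma crit_slope_gap: "\<delta> * crit_slope m \<alpha> \<delta> < real m * \<delta> + \<alpha> - \<delta> * crit_slope m \<alpha> \<delta>"
proof -
  have "sqrt ((real m * \<delta> - \<alpha>)^2 + 4 * \<delta> * (1 - \<delta>)) > 0"
    using \<delta> by (intro real_sqrt_gt_zero add_nonneg_pos) auto
  then show ?thesis using crit_slope_eq by linarith
qed

text \<open>The extremal case is \<open>x = \<delta>\<close>. For \<open>\<alpha> \<le> t\<close>,
  the affine function of \<open>x\<close> is negative at \<open>\<delta>\<close>, below the smaller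
  root, and nonnegative at 1, as \<open>t < m\<close>; hence it is negative to the left of
  \<open>\<delta>\<close>.\<close>

lemma euler_fn_neg:
  assumes x: "0 \<le> x" "x \<le> \<delta>" and t: "t < crit_slope m \<alpha> \<delta>"
  shows "euler_fn m \<alpha> x t < 0"
proof (cases "t < \<alpha>")
  case True
  then show ?thesis using euler_fn_neg_below[OF _ q] x \<delta> by simp
next
  case False
  have "\<delta> * t < \<delta> * crit_slope m \<alpha> \<delta>" using \<delta> t by simp
  then have "\<delta> * euler_fn m \<alpha> \<delta> t < 0"
    unfolding euler_fn_factor using crit_slope_gap by (intro mult_neg_pos) linarith+
  then have neg: "(1 - x) * euler_fn m \<alpha> \<delta> t < 0"
    using \<delta> x by (intro mult_pos_neg) (auto simp: mult_less_0_iff)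
  have "(\<alpha> - t) * (t - m) \<ge> 0"
    using False t crit_slope_less by (intro mult_nonpos_nonpos) auto
  then have "(\<delta> - x) * ((\<alpha> - t) * (t - m)) \<ge> 0" using x by (intro mult_nonneg_nonneg[of "\<delta> - x"]) auto
  moreover have "(1 - \<delta>) * euler_fn m \<alpha> x t =
      (1 - x) * euler_fn m \<alpha> \<delta> t - (\<delta> - x) * ((\<alpha> - t) * (t - m))"
    by (simp add: euler_fn_def algebra_simps power2_eq_square)
  ultimately have "(1 - \<delta>) * euler_fn m \<alpha> x t < 0" using neg by linarith
  then show ?thesis using \<delta> by (simp add: mult_less_0_iff)
qed

end

lemma euler_fn_nonneg:
  fixes m d1 d2 e1 e2 :: nat
  assumes e: "e1 > 0" "e1 \<le> d1" "e2 \<le> d2"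
    and ineq: "m * e1 * (d2 - e2) \<le> e1 * (d1 - e1) + e2 * (d2 - e2)"
  shows "euler_fn m (real d2 / real d1) (real e1 / real d1) (real e2 / real e1) \<ge> 0"
proof -
  have "real m * real e1 * (real d2 - real e2) \<le> real e1 * (real d1 - real e1) + real e2 * (real d2 - real e2)"
    using of_nat_mono[OF ineq, where 'a = real] e by (simp add: of_nat_diff)
  moreover have "real d1 * real e1 * euler_fn m (real d2 / real d1) (real e1 / real d1) (real e2 / real e1) =
     real e1 * (real d1 - real e1) + real e2 * (real d2 - real e2) - real m * real e1 * (real d2 - real e2)"
    using e by (simp add: euler_fn_def field_simps power2_eq_square)
  ultimately have "0 \<le> real d1 * real e1 * euler_fn m (real d2 / real d1) (real e1 / real d1) (real e2 / real e1)"
    by linarith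
  moreover have "real d1 * real e1 > 0" using e by simp
  ultimately show ?thesis by (simp only: zero_le_mult_iff) linarith
qed

section \<open>Semistability and expansion of general representations\<close>

lemma dim_coord_space_le: "U \<subseteq> coord_space d \<Longrightarrow> fs.dim U \<le> d"
proof -
  assume U: "U \<subseteq> coord_space d"
  define b :: "nat \<Rightarrow> nat \<Rightarrow> 'a::field" where "b = (\<lambda>i j. if j = i then 1 else 0)"
  have "v \<in> fs.span (b ` {..<d})" if v: "v \<in> coord_space d" for v :: "nat \<Rightarrow> 'a"
  proof -
    have "v = (\<Sum>i<d. fsc (v i) (b i))"
    proof
      fix j show "v j = (\<Sum>i<d. fsc (v i) (b i)) j"
        using v by (simp add: sum_fun_apply fsc_apply b_def coord_space_def if_distrib cong: if_cong)
    qed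
    then show ?thesis by (metis (no_types, lifting) fs.span_base fs.span_scale fs.span_sum imageI)
  qed
  then have "fs.dim U \<le> card (b ` {..<d})" using U by (intro fs.dim_le_card) auto
  also have "\<dots> \<le> d" by (metis card_image_le card_lessThan finite_lessThan)
  finally show "fs.dim U \<le> d" .
qed

lemma subspace_dim_pos:
  assumes "fs.subspace U" "U \<subseteq> coord_space d" "U \<noteq> {0}"
  shows "fs.dim U > 0"
proof (rule ccontr)
  assume "\<not> ?thesis"
  obtain P u where u: "pivot_basis U P u"
    using pivot_basis_exists[OF valuation_ring_UNIV assms(1), of "{..<d}"] assms(2)
    by (auto simp: coord_space_def subset_iff)
  then have "P = {}" using \<open>\<not> fs.dim U > 0\<close> pivot_basis_dim[OF u] by (simp add: pivot_basis_def)
  then have "v = 0" if "v \<in> U" for v using pivot_basis_expand[OF u that] by simp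
  then show False using assms(3) fs.subspace_0[OF assms(1)] by auto
qed

lemma generic_rep_euler_fn:
  assumes inf: "infinite (UNIV :: 'a::field set)"
  obtains M :: "nat \<Rightarrow> nat \<Rightarrow> nat \<Rightarrow> 'a::field" where "\<And>U W. fs.subspace U \<Longrightarrow> U \<subseteq> coord_space d1 \<Longrightarrow> U \<noteq> {0} \<Longrightarrow>
     fs.subspace W \<Longrightarrow> W \<subseteq> coord_space d2 \<Longrightarrow> (\<And>k. k < m \<Longrightarrow> mat_rep d1 d2 M k ` U \<subseteq> W) \<Longrightarrow>
     euler_fn m (real d2 / real d1) (real (fs.dim U) / real d1) (real (fs.dim W) / real (fs.dim U)) \<ge> 0"
proof -
  obtain M :: "nat \<Rightarrow> nat \<Rightarrow> nat \<Rightarrow> 'a" where M: "\<And>U W. fs.subspace U \<Longrightarrow> U \<subseteq> coord_space d1 \<Longrightarrow>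
     fs.subspace W \<Longrightarrow> W \<subseteq> coord_space d2 \<Longrightarrow> \<forall>k<m. mat_rep d1 d2 M k ` U \<subseteq> W \<Longrightarrow>
     m * fs.dim U * (d2 - fs.dim W) \<le> fs.dim U * (d1 - fs.dim U) + fs.dim W * (d2 - fs.dim W)"
    using generic_rep_subrep_dims[OF inf, of d1 d2 m] by blast
  show thesis
  proof (rule that[of M], rule euler_fn_nonneg)
    fix U W assume U: "fs.subspace U" "U \<subseteq> coord_space d1" "U \<noteq> {0}"
      and W: "fs.subspace W" "W \<subseteq> coord_space d2" and f: "\<And>k. k < m \<Longrightarrow> mat_rep d1 d2 M k ` U \<subseteq> W"
    show "fs.dim U > 0" "fs.dim U \<le> d1" "fs.dim W \<le> d2"
      using subspace_dim_pos[OF U] dim_coord_space_le[OF U(2)] dim_coord_space_le[OF W(2)] by auto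
    show "m * fs.dim U * (d2 - fs.dim W) \<le> fs.dim U * (d1 - fs.dim U) + fs.dim W * (d2 - fs.dim W)"
      using f by (intro M U(1,2) W) auto
  qed
qed

text \<open>For \<open>s = d2 / d1\<close> this is slope semistability, expressed by
  subrepresentations \<open>(U, W)\<close>.\<close>

definition semistable :: "real \<Rightarrow> nat \<Rightarrow> nat \<Rightarrow> nat \<Rightarrow> (nat \<Rightarrow> nat \<Rightarrow> nat \<Rightarrow> 'a::field) \<Rightarrow> bool" where
  "semistable s m d1 d2 M \<longleftrightarrow> (\<forall>U W. fs.subspace U \<and> U \<subseteq> coord_space d1 \<and> fs.subspace W \<and> W \<subseteq> coord_space d2 \<and>
     (\<forall>k<m. mat_rep d1 d2 M k ` U \<subseteq> W) \<longrightarrow> s * real (fs.dim U) \<le> real (fs.dim W))"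

lemma semistable_rep_exists:
  assumes inf: "infinite (UNIV :: 'a::field set)" and "d1 > 0" and s: "real d2 = s * real d1"
    and q: "s^2 - real m * s + 1 < 0"
  obtains M :: "nat \<Rightarrow> nat \<Rightarrow> nat \<Rightarrow> 'a::field" where "semistable s m d1 d2 M"
proof (rule generic_rep_euler_fn[OF inf, of d1 d2 m])
  fix M :: "nat \<Rightarrow> nat \<Rightarrow> nat \<Rightarrow> 'a" assume M: "\<And>U W. fs.subspace U \<Longrightarrow> U \<subseteq> coord_space d1 \<Longrightarrow> U \<noteq> {0} \<Longrightarrow>
     fs.subspace W \<Longrightarrow> W \<subseteq> coord_space d2 \<Longrightarrow> (\<And>k. k < m \<Longrightarrow> mat_rep d1 d2 M k ` U \<subseteq> W) \<Longrightarrow>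
     euler_fn m (real d2 / real d1) (real (fs.dim U) / real d1) (real (fs.dim W) / real (fs.dim U)) \<ge> 0"
  have s': "real d2 / real d1 = s" using assms by simp
  show thesis
  proof (rule that[of M], unfold semistable_def, intro allI impI, elim conjE, rule ccontr)
    fix U W assume U: "fs.subspace U" "U \<subseteq> coord_space d1" and W: "fs.subspace W" "W \<subseteq> coord_space d2"
      and f: "\<forall>k<m. mat_rep d1 d2 M k ` U \<subseteq> W"
      and c: "\<not> s * real (fs.dim U) \<le> real (fs.dim W)"
    have "fs.dim U > 0" using c by (cases "fs.dim U") auto
    moreover have "fs.dim {0 :: nat \<Rightarrow> 'a} \<le> card ({} :: (nat \<Rightarrow> 'a) set)" by (rule fs.dim_le_card) auto
    ultimately have "U \<noteq> {0}" by auto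
    then have "euler_fn m s (real (fs.dim U) / real d1) (real (fs.dim W) / real (fs.dim U)) \<ge> 0"
      using M[OF U _ W] f unfolding s' by simp
    moreover have "real (fs.dim U) \<le> real d1" using dim_coord_space_le[OF U(2)] by simp
    ultimately show False
      using euler_fn_neg_below[OF _ q, of "real (fs.dim U) / real d1" "real (fs.dim W) / real (fs.dim U)"]
        c \<open>fs.dim U > 0\<close> \<open>d1 > 0\<close> by (simp add: field_simps)
  qed
qed

lemma img_sum_props:
  assumes "Km_rep m d1 d2 f" "U \<subseteq> coord_space d1"
  shows "fs.subspace (img_sum m f U)" "img_sum m f U \<subseteq> coord_space d2" "k < m \<Longrightarrow> f k ` U \<subseteq> img_sum m f U"
proof -
  show "fs.subspace (img_sum m f U)" by (simp add: img_sum_def fscale_eq_fsc fs.subspace_span)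
  have "fs.subspace (coord_space d2)"
    by (auto simp: fs.subspace_def coord_space_def fsc_apply)
  moreover have "(\<Union>k<m. f k ` U) \<subseteq> coord_space d2" using assms by (auto simp: Km_rep_def)
  ultimately show "img_sum m f U \<subseteq> coord_space d2"
    unfolding img_sum_def fscale_eq_fsc by (intro fs.span_minimal)
  show "k < m \<Longrightarrow> f k ` U \<subseteq> img_sum m f U"
    unfolding img_sum_def fscale_eq_fsc by (auto intro: fs.span_base)
qed

text \<open>\<open>U\<close> and the sum of its images form a subrepresentation. If expansion
  failed, its slope would be below \<open>crit_slope\<close>, where the Euler form is negative,
  against the choice of \<open>M\<close>.\<close>

lemma expander_rep_exists:
  fixes m :: nat and \<delta> \<epsilon> \<alpha> :: real
  assumes inf: "infinite (UNIV :: 'a::field set)"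
    and \<delta>: "0 < \<delta>" "\<delta> < 1" and q: "\<alpha>^2 - real m * \<alpha> + 1 < 0"
    and \<epsilon>: "\<epsilon> \<le> eps_m m \<alpha> \<delta>" and d: "d1 > 0" "real d2 / real d1 = \<alpha>"
  shows "\<exists>f :: nat \<Rightarrow> (nat \<Rightarrow> 'a) \<Rightarrow> (nat \<Rightarrow> 'a). expander_rep \<delta> \<epsilon> m d1 d2 f"
proof (rule generic_rep_euler_fn[OF inf, of d1 d2 m, unfolded d(2)])
  fix M :: "nat \<Rightarrow> nat \<Rightarrow> nat \<Rightarrow> 'a" assume M: "\<And>U W. fs.subspace U \<Longrightarrow> U \<subseteq> coord_space d1 \<Longrightarrow> U \<noteq> {0} \<Longrightarrow>
     fs.subspace W \<Longrightarrow> W \<subseteq> coord_space d2 \<Longrightarrow> (\<And>k. k < m \<Longrightarrow> mat_rep d1 d2 M k ` U \<subseteq> W) \<Longrightarrow>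
     euler_fn m \<alpha> (real (fs.dim U) / real d1) (real (fs.dim W) / real (fs.dim U)) \<ge> 0"
  let ?f = "mat_rep d1 d2 M"
  have rep: "Km_rep m d1 d2 ?f" by (rule Km_rep_mat_rep)
  have "expander_rep \<delta> \<epsilon> m d1 d2 ?f"
    unfolding expander_rep_def vdim_def is_subspace_def fscale_eq_fsc d(2)
  proof (intro conjI rep allI impI, elim conjE, rule ccontr)
    fix U assume U: "fs.subspace U" "U \<subseteq> coord_space d1" "U \<noteq> {0}" and x: "real (fs.dim U) / real d1 \<le> \<delta>"
      and c: "\<not> (1 + \<epsilon>) * \<alpha> * real (fs.dim U) \<le> real (fs.dim (img_sum m ?f U))"
    have pos: "fs.dim U > 0" by (rule subspace_dim_pos[OF U])
    have "(1 + \<epsilon>) * \<alpha> \<le> crit_slope m \<alpha> \<delta>"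
      using \<epsilon> quadratic_neg_bounds[OF _ q] unfolding crit_slope_def by (intro mult_right_mono) auto
    moreover have "real (fs.dim (img_sum m ?f U)) / real (fs.dim U) < (1 + \<epsilon>) * \<alpha>"
      using c pos by (simp add: field_simps)
    ultimately have "euler_fn m \<alpha> (real (fs.dim U) / real d1) (real (fs.dim (img_sum m ?f U)) / real (fs.dim U)) < 0"
      by (intro euler_fn_neg[OF \<delta> q _ x]) auto
    moreover have "euler_fn m \<alpha> (real (fs.dim U) / real d1) (real (fs.dim (img_sum m ?f U)) / real (fs.dim U)) \<ge> 0"
      by (rule M[OF U img_sum_props[OF rep U(2)]])
    ultimately show False by simp
  qed
  then show ?thesis by blast
qed

section \<open>General vanishing of extensions\<close>

lemma span_combination: "(\<And>a. a \<in> A \<Longrightarrow> x a \<in> S) \<Longrightarrow> (\<Sum>a\<in>A. fsc (c a) (x a)) \<in> fs.span S"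
  by (intro fs.span_sum fs.span_scale fs.span_base)

lemma span_image_expand:
  assumes "v \<in> fs.span (r ` A)" "finite A"
  shows "\<exists>c. v = (\<Sum>i\<in>A. fsc (c i) (r i))"
  using assms(1)
proof (induction rule: fs.span_induct_alt)
  case base
  show ?case by (rule exI[of _ "\<lambda>_. 0"]) simp
next
  case (step c x y)
  then obtain a d where a: "a \<in> A" "x = r a" and d: "y = (\<Sum>i\<in>A. fsc (d i) (r i))" by auto
  have "fsc c x + y = (\<Sum>i\<in>A. fsc (if i = a then c else 0) (r i)) + (\<Sum>i\<in>A. fsc (d i) (r i))"
  proof -
    have "(\<Sum>i\<in>A. fsc (if i = a then c else 0) (r i)) = (\<Sum>i\<in>A. if i = a then fsc c (r i) else 0)"
      by (rule sum.cong) auto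
    then show ?thesis using a d assms(2) by simp
  qed
  also have "\<dots> = (\<Sum>i\<in>A. fsc ((if i = a then c else 0) + d i) (r i))"
    by (simp add: sum.distrib[symmetric] fs.scale_left_distrib)
  finally show ?case by (rule exI[of _ "\<lambda>i. (if i = a then c else 0) + d i"])
qed

text \<open>A family of \<open>m\<close>-tuples of vectors that are killed by a semistable representation \<open>D\<close> of
  slope \<open>s\<close>: all tuples of vectors in \<open>T\<close> form a space of dimension \<open>m * dim T\<close>, on which
  \<open>D\<close> has rank at least \<open>s * dim T\<close>.\<close>

lemma semistable_killed_dim:
  fixes D :: "nat \<Rightarrow> nat \<Rightarrow> nat \<Rightarrow> 'a::field" and G :: "'j \<Rightarrow> nat \<times> nat \<Rightarrow> 'a"
  assumes D: "semistable s m x y D"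
    and supp: "\<And>j k i. j \<in> J \<Longrightarrow> \<not> (k < m \<and> i < x) \<Longrightarrow> G j (k, i) = 0"
    and kill: "\<And>j l. j \<in> J \<Longrightarrow> l < y \<Longrightarrow> (\<Sum>k<m. \<Sum>i<x. D k i l * G j (k, i)) = 0"
    and T: "T = fs.span {\<lambda>i. G j (k, i) | j k. j \<in> J \<and> k < m}"
  shows "real (fs.dim (fs.span (G ` J))) + s * real (fs.dim T) \<le> real m * real (fs.dim T)"
proof -
  have subT: "fs.subspace T" unfolding T by (rule fs.subspace_span)
  have "fs.subspace (coord_space x :: (nat \<Rightarrow> 'a) set)"
    by (auto simp: fs.subspace_def coord_space_def fsc_apply)
  then have Tx: "T \<subseteq> coord_space x"
    unfolding T using supp by (intro fs.span_minimal) (auto simp: coord_space_def)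
  obtain P \<tau> where P: "P \<subseteq> {..<x}" and \<tau>: "pivot_basis T P \<tau>"
    using pivot_basis_exists[OF valuation_ring_UNIV subT, of "{..<x}"] Tx
    by (auto simp: coord_space_def subset_iff)
  \<comment> \<open>The space of all m-tuples of vectors of \<open>T\<close>; the second branch of
    the condition removes indices \<open>k\<close> outside \<open>{..<m}\<close>.\<close>
  define E where "E = {u :: nat \<times> nat \<Rightarrow> 'a. \<forall>k. (if k < m then (\<lambda>i. u (k, i)) \<in> T else \<forall>i. u (k, i) = 0)}"
  have subE: "fs.subspace E"
  proof (rule fs.subspaceI)
    show "0 \<in> E" using fs.subspace_0[OF subT] by (simp add: E_def zero_fun_def)
    fix u v assume uv: "u \<in> E" "v \<in> E"
    have "(\<lambda>i. (u + v) (k, i)) \<in> T" if "k < m" for k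
    proof -
      have "(\<lambda>i. u (k, i)) + (\<lambda>i. v (k, i)) \<in> T"
        using uv that by (intro fs.subspace_add[OF subT]) (auto simp: E_def)
      then show ?thesis by (simp add: plus_fun_def)
    qed
    then show "u + v \<in> E" using uv by (auto simp: E_def)
  next
    fix c u assume u: "u \<in> E"
    have "(\<lambda>i. fsc c u (k, i)) \<in> T" if "k < m" for k
    proof -
      have "fsc c (\<lambda>i. u (k, i)) \<in> T"
        using u that by (intro fs.subspace_scale[OF subT]) (auto simp: E_def)
      then show ?thesis by (simp add: fsc_def)
    qed
    then show "fsc c u \<in> E" using u by (auto simp: E_def fsc_apply)
  qed
  define \<sigma> where "\<sigma> = (\<lambda>(k :: nat, p) (k', i). if k' = k then \<tau> p i else 0)"
  have fin\<sigma>: "finite (\<sigma> ` ({..<m} \<times> P))" using P by (auto intro: finite_subset)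
  have card\<sigma>: "card (\<sigma> ` ({..<m} \<times> P)) \<le> m * fs.dim T"
    using card_image_le[of "{..<m} \<times> P" \<sigma>] finite_subset[OF P] by (simp add: pivot_basis_dim[OF \<tau>])
  have E\<sigma>: "E \<subseteq> fs.span (\<sigma> ` ({..<m} \<times> P))"
  proof
    fix u assume u: "u \<in> E"
    have eq: "u = (\<Sum>q\<in>{..<m} \<times> P. fsc (u q) (\<sigma> q))"
    proof
      fix a :: "nat \<times> nat" obtain k i where a: "a = (k, i)" by (cases a)
      have "(\<Sum>q\<in>{..<m} \<times> P. fsc (u q) (\<sigma> q)) a = (\<Sum>k'<m. \<Sum>p\<in>P. if k = k' then u (k, p) * \<tau> p i else 0)"
        by (simp add: sum_fun_apply fsc_apply a \<sigma>_def sum.cartesian_product split_beta if_distrib cong: if_cong sum.cong)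
      also have "\<dots> = (\<Sum>k'<m. if k = k' then \<Sum>p\<in>P. u (k, p) * \<tau> p i else 0)"
        by (rule sum.cong) auto
      also have "\<dots> = u a"
      proof (cases "k < m")
        case True
        then have "(\<lambda>i. u (k, i)) \<in> T" using u by (auto simp: E_def)
        from True this show ?thesis using \<tau> unfolding pivot_basis_def by (auto simp: a)
      next
        case False
        then show ?thesis using u by (auto simp: E_def a)
      qed
      finally show "u a = (\<Sum>q\<in>{..<m} \<times> P. fsc (u q) (\<sigma> q)) a" by simp
    qed
    show "u \<in> fs.span (\<sigma> ` ({..<m} \<times> P))"
      by (subst eq, rule span_combination) auto
  qed
  define \<Delta> where "\<Delta> = (\<lambda>(u :: nat \<times> nat \<Rightarrow> 'a) l. if l < y then \<Sum>k<m. \<Sum>i<x. D k i l * u (k, i) else 0)"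
  have \<Delta>_add: "\<Delta> (u + v) = \<Delta> u + \<Delta> v" for u v
    by (auto simp: \<Delta>_def fun_eq_iff algebra_simps sum.distrib)
  have \<Delta>_scale: "\<Delta> (fsc c u) = fsc c (\<Delta> u)" for c u
    by (auto simp: \<Delta>_def fun_eq_iff fsc_apply algebra_simps sum_distrib_left)
  have \<Delta>_0: "\<Delta> 0 = 0" by (auto simp: \<Delta>_def fun_eq_iff)
  have subW: "fs.subspace (\<Delta> ` E)"
    using subE \<Delta>_0 by (auto simp: fs.subspace_def \<Delta>_add[symmetric] \<Delta>_scale[symmetric] image_iff)
  have DT: "mat_rep x y D k ` T \<subseteq> \<Delta> ` E" if k: "k < m" for k
  proof
    fix w assume "w \<in> mat_rep x y D k ` T"
    then obtain t where t: "t \<in> T" "w = mat_rep x y D k t" by auto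
    define u where "u = (\<lambda>(k', i). if k' = k then t i else 0)"
    have "(\<lambda>i. u (k', i)) = (if k' = k then t else 0)" for k'
      by (auto simp: u_def fun_eq_iff)
    then have "u \<in> E" using t k fs.subspace_0[OF subT] by (auto simp: u_def E_def)
    moreover have "\<Delta> u = w"
    proof
      fix l
      have "(\<Sum>k'<m. \<Sum>i<x. D k' i l * u (k', i)) = (\<Sum>k'<m. if k' = k then \<Sum>i<x. D k i l * t i else 0)"
        by (rule sum.cong) (auto simp: u_def)
      then show "\<Delta> u l = w l" using k by (simp add: \<Delta>_def t(2) mat_rep_def mult.commute)
    qed
    ultimately show "w \<in> \<Delta> ` E" by blast
  qed
  \<comment> \<open>\<open>T\<close> and the image of \<open>E\<close> form a subrepresentation of
    \<open>D\<close>, to which semistability applies.\<close>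
  have sdim: "s * real (fs.dim T) \<le> real (fs.dim (\<Delta> ` E))"
    by (rule D[unfolded semistable_def, rule_format], intro conjI subT Tx subW)
      (use DT in \<open>auto simp: \<Delta>_def coord_space_def\<close>)
  have GE: "G ` J \<subseteq> E"
    unfolding E_def T using supp by (auto intro!: fs.span_base)
  define S where "S = fs.span (G ` J)"
  have SE: "S \<subseteq> E" unfolding S_def by (rule fs.span_minimal[OF GE subE])
  have S0: "\<Delta> u = 0" if "u \<in> S" for u
    using that unfolding S_def
  proof (induction rule: fs.span_induct_alt)
    case (step c x y)
    have "\<Delta> x = 0" using step(1) kill by (auto simp: \<Delta>_def fun_eq_iff)
    then show ?case unfolding \<Delta>_add \<Delta>_scale step.IH by simp
  qed (rule \<Delta>_0)
  \<comment> \<open>Rank and nullity: \<open>C\<close> is a basis of \<open>E\<close> extending a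
    basis \<open>B\<close> of the killed space \<open>S\<close>, and only \<open>C - B\<close>
    contributes to the image.\<close>
  obtain B where B: "B \<subseteq> S" "fs.independent B" "S \<subseteq> fs.span B" "card B = fs.dim S"
    using fs.basis_exists by metis
  obtain C where C: "B \<subseteq> C" "C \<subseteq> E" "fs.independent C" "E \<subseteq> fs.span C"
    using fs.maximal_independent_subset_extend[of B E] B SE by (metis order.trans)
  have finC: "finite C" and cardC: "card C \<le> m * fs.dim T"
    using fs.independent_span_bound[OF fin\<sigma> C(3) order.trans[OF C(2) E\<sigma>]] card\<sigma> by linarith+
  have "\<Delta> u \<in> fs.span (\<Delta> ` (C - B))" if "u \<in> fs.span C" for u
    using that
  proof (induction rule: fs.span_induct_alt)
    case base
    show ?case unfolding \<Delta>_0 by (rule fs.span_zero)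
  next
    case (step c x y)
    have "\<Delta> x \<in> fs.span (\<Delta> ` (C - B))"
    proof (cases "x \<in> B")
      case True
      then have "\<Delta> x = 0" using S0 B by auto
      then show ?thesis by (simp only: fs.span_zero)
    next
      case False
      then show ?thesis using step by (auto intro: fs.span_base)
    qed
    then show ?case unfolding \<Delta>_add \<Delta>_scale by (intro fs.span_add fs.span_scale step.IH)
  qed
  then have "fs.dim (\<Delta> ` E) \<le> card (\<Delta> ` (C - B))"
    using C(4) finC by (intro fs.dim_le_card) auto
  also have "\<dots> \<le> card (C - B)" using finC by (intro card_image_le) auto
  also have "\<dots> = card C - fs.dim S" using B C finC by (simp add: card_Diff_subset finite_subset)
  finally have "fs.dim (\<Delta> ` E) \<le> card C - fs.dim S" .
  moreover have "fs.dim S \<le> card C" using card_mono[OF finC C(1)] B by simp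
  ultimately have "fs.dim (\<Delta> ` E) + fs.dim S \<le> m * fs.dim T" using cardC by linarith
  then have "real (fs.dim (\<Delta> ` E)) + real (fs.dim S) \<le> real m * real (fs.dim T)"
    by (metis of_nat_add of_nat_le_iff of_nat_mult)
  then show ?thesis using sdim unfolding S_def by linarith
qed


text \<open>The tensors \<open>g\<close> below form the dual of \<open>Ext(A, B)\<close>, where \<open>B\<close> is the transpose of \<open>D\<close>. If
  \<open>g \<noteq> 0\<close> has rank \<open>r\<close> as a map to \<open>F\<^sup>x\<close> and \<open>L\<close> as a map to \<open>F\<^bsup>v'\<^esup>\<close>, then \<open>L \<le> (m - y / x) * r\<close>
  by semistability of \<open>D\<close>. The \<open>A\<close> with \<open>A g = 0\<close> form a space of codimension \<open>r * w'\<close>, whereas \<open>g\<close>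
  depends on \<open>L * v'\<close> parameters and a number of further ones that depends only on \<open>m\<close> and \<open>x\<close>.\<close>

lemma generic_ext_vanishing:
  fixes D :: "nat \<Rightarrow> nat \<Rightarrow> nat \<Rightarrow> 'a::field"
  assumes inf: "infinite (UNIV :: 'a set)"
    and D: "semistable s m x y D"
    and x: "x > 0" and y: "real y = s * real x" and ym: "y \<le> m * x"
    and large: "x * (x * x + m * x * (m * x)) + m * x * v' < x * w' + y * v'"
  obtains A :: "nat \<Rightarrow> nat \<Rightarrow> nat \<Rightarrow> 'a" where
    "\<And>g k i j. (\<And>l j. l < y \<Longrightarrow> j < v' \<Longrightarrow> (\<Sum>k<m. \<Sum>i<x. D k i l * g k i j) = 0) \<Longrightarrow>
      (\<And>i q. i < x \<Longrightarrow> q < w' \<Longrightarrow> (\<Sum>k<m. \<Sum>j<v'. A k j q * g k i j) = 0) \<Longrightarrow>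
      k < m \<Longrightarrow> i < x \<Longrightarrow> j < v' \<Longrightarrow> g k i j = 0"
proof -
  define X where "X = {..<m} \<times> {..<v'}"
  \<comment> \<open>\<open>P\<close> stands for the pivots of the row space of a nonzero
    \<open>g\<close>, so its size lies between 1 and \<open>x\<close>. The last condition is L <= (m
    - y/x) * card P with the denominator cleared.\<close>
  define Js where "Js = {(P, L). P \<subseteq> X \<and> 1 \<le> card P \<and> card P \<le> x \<and> L \<le> m * x \<and> L * x + y * card P \<le> m * x * card P}"
  define Y where "Y = {..<m} \<times> {..<v'} \<times> {..<w'}"
  \<comment> \<open>Tag 0 expresses the pivot vectors by the \<open>x\<close> rows of
    \<open>g\<close>, tags 1 and 2 hold a factorisation of \<open>g\<close> of length
    \<open>L\<close>, and tag 3 the entries of \<open>A\<close> outside the pivots.\<close>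
  define I :: "(nat \<times> nat) set \<times> nat \<Rightarrow> (nat \<times> nat \<times> nat \<times> nat) set" where
    "I = (\<lambda>(P, L). (\<lambda>((k, j), i). (0, k, j, i)) ` (P \<times> {..<x}) \<union> {1} \<times> {..<L} \<times> {..<m} \<times> {..<x} \<union>
      {2} \<times> {0} \<times> {..<L} \<times> {..<v'} \<union> (\<lambda>((k, j), q). (3, k, j, q)) ` ((X - P) \<times> {..<w'}))"
  define \<Psi> :: "(nat \<times> nat) set \<times> nat \<Rightarrow> (nat \<times> nat \<times> nat \<times> nat \<Rightarrow> 'a) \<Rightarrow> nat \<times> nat \<times> nat \<Rightarrow> 'a" where
    "\<Psi> = (\<lambda>(P, L) z (k, j, q). if (k, j) \<notin> P then z (3, k, j, q)
      else - (\<Sum>(k', j')\<in>X - P. (\<Sum>i<x. z (0, k, j, i) * (\<Sum>l<L. z (1, l, k', i) * z (2, 0, l, j'))) * z (3, k', j', q)))"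
  have finX: "finite X" by (simp add: X_def)
  have "\<exists>w :: nat \<times> nat \<times> nat \<Rightarrow> 'a. \<forall>j\<in>Js. \<forall>z. \<exists>y\<in>Y. \<Psi> j z y \<noteq> w y"
  proof (rule exists_outside_polynomial_images[where I = I and c = "1 + (1 + 1) + 1", OF inf])
    show "finite Js"
      by (rule finite_subset[of _ "Pow X \<times> {..m * x}"]) (auto simp: Js_def finX)
    show "finite Y" by (simp add: Y_def)
  next
    fix b assume "b \<in> Js"
    then obtain P L where b: "b = (P, L)" and P: "P \<subseteq> X" "1 \<le> card P" "card P \<le> x" and L: "L \<le> m * x"
      and LP: "L * x + y * card P \<le> m * x * card P" by (auto simp: Js_def)
    have finP: "finite P" using P finX by (auto intro: finite_subset)
    show "finite (I b)" using finP finX by (simp add: b I_def)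
    \<comment> \<open>Bounds the variables with tags 0 and 1, independently of \<open>v'\<close> and
      \<open>w'\<close>.\<close>
    define C where "C = x * x + m * x * (m * x)"
    have PX: "card P \<le> m * v'" using card_mono[OF finX P(1)] by (simp add: X_def)
    have "card (I b) \<le> card P * x + L * (m * x) + L * v' + (m * v' - card P) * w'"
      unfolding b I_def prod.case
    proof (intro order.trans[OF card_Un_le] add_mono)
      show "card ((\<lambda>((k, j), i). (0::nat, k, j, i)) ` (P \<times> {..<x})) \<le> card P * x"
        using finP by (intro order.trans[OF card_image_le]) auto
      show "card ((\<lambda>((k, j), q). (3::nat, k, j, q)) ` ((X - P) \<times> {..<w'})) \<le> (m * v' - card P) * w'"
        using finX P by (intro order.trans[OF card_image_le]) (auto simp: card_Diff_subset finP card_cartesian_product X_def)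
    qed (simp_all add: card_cartesian_product)
    also have "\<dots> \<le> C + L * v' + (m * v' - card P) * w'"
      unfolding C_def using P L by (intro add_mono mult_mono) auto
    also have "\<dots> < card P * w' + (m * v' - card P) * w'"
    proof -
      \<comment> \<open>The factor \<open>x\<close> clears the slope \<open>y / x\<close>, and
        \<open>1 <= card P\<close> allows \<open>C\<close> to be multiplied by
        \<open>card P\<close>; the single inequality \<open>large\<close> then serves all
        ranks.\<close>
      have "x * (C + L * v') + y * card P * v' \<le> x * C * card P + (L * x + y * card P) * v'"
        using P(2) by (cases "card P") (auto simp: algebra_simps)
      also have "\<dots> \<le> x * C * card P + m * x * card P * v'"
        using LP by (intro add_left_mono mult_right_mono) auto
      also have "\<dots> = card P * (x * C + m * x * v')" by (simp add: algebra_simps)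
      also have "\<dots> < card P * (x * w' + y * v')" using large P(2) unfolding C_def by simp
      also have "\<dots> = x * (card P * w') + y * card P * v'" by (simp add: algebra_simps)
      finally have "x * (C + L * v') < x * (card P * w')" by linarith
      then show ?thesis by simp
    qed
    also have "\<dots> = (card P + (m * v' - card P)) * w'" by (simp only: add_mult_distrib)
    also have "\<dots> = card Y" using PX by (simp add: Y_def card_cartesian_product)
    finally show "card (I b) < card Y" .
    fix t assume "t \<in> Y"
    then obtain k j q where t: "t = (k, j, q)" "k < m" "j < v'" "q < w'" by (auto simp: Y_def)
    have var: "polyfun (I b) 1 (\<lambda>z. z v)" if "v \<in> I b" for v
      using polyfun_var[OF that, of 0] by simp
    show "polyfun (I b) (1 + (1 + 1) + 1) (\<lambda>z. \<Psi> b z t)"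
    proof (cases "(k, j) \<in> P")
      case False
      then have "(3, k, j, q) \<in> I b" using t by (force simp: I_def b X_def)
      then have "polyfun (I b) (1 + (1 + 1) + 1) (\<lambda>z. z (3, k, j, q) :: 'a)" by (intro polyfun_mono[OF var]) auto
      then show ?thesis using False by (simp add: \<Psi>_def b t)
    next
      case True
      have "polyfun (I b) (1 + (1 + 1) + 1) (\<lambda>z. - (\<Sum>p\<in>X - P. (\<Sum>i<x. z (0, k, j, i) *
          (\<Sum>l<L. z (1, l, fst p, i) * z (2, 0, l, snd p))) * z (3, fst p, snd p, q)))"
        by (intro polyfun_uminus polyfun_sum polyfun_mult var)
          (use True t in \<open>force simp: I_def b X_def\<close>)+
      then show ?thesis using True by (simp add: \<Psi>_def b t split_beta)
    qed
  qed
  then obtain w :: "nat \<times> nat \<times> nat \<Rightarrow> 'a" where w: "\<And>j z. j \<in> Js \<Longrightarrow> \<exists>y\<in>Y. \<Psi> j z y \<noteq> w y" by blast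
  define A where "A = (\<lambda>k j q. w (k, j, q))"
  show thesis
  proof (rule that[of A], rule ccontr)
    fix g :: "nat \<Rightarrow> nat \<Rightarrow> nat \<Rightarrow> 'a" and k0 i0 j0
    assume gD: "\<And>l j. l < y \<Longrightarrow> j < v' \<Longrightarrow> (\<Sum>k<m. \<Sum>i<x. D k i l * g k i j) = 0"
      and gA: "\<And>i q. i < x \<Longrightarrow> q < w' \<Longrightarrow> (\<Sum>k<m. \<Sum>j<v'. A k j q * g k i j) = 0"
      and ne: "k0 < m" "i0 < x" "j0 < v'" "g k0 i0 j0 \<noteq> 0"
    define r where "r = (\<lambda>i (k, j). if k < m \<and> j < v' then g k i j else 0)"
    define G where "G = (\<lambda>j (k, i). if k < m \<and> i < x then g k i j else 0)"
    define Row where "Row = fs.span (r ` {..<x})"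
    define T where "T = fs.span {\<lambda>i. G j (k, i) | j k. j \<in> {..<v'} \<and> k < m}"
    have "fs.subspace {v :: nat \<times> nat \<Rightarrow> 'a. \<forall>i. i \<notin> X \<longrightarrow> v i = 0}"
      by (auto simp: fs.subspace_def fsc_apply)
    then have Row0: "Row \<subseteq> {v. \<forall>i. i \<notin> X \<longrightarrow> v i = 0}"
      unfolding Row_def by (intro fs.span_minimal) (auto simp: r_def X_def)
    obtain P u where P: "P \<subseteq> X" and u: "pivot_basis Row P u"
      using pivot_basis_exists[OF valuation_ring_UNIV fs.subspace_span finX, of "r ` {..<x}"] Row0
      unfolding Row_def by blast
    have rRow: "r i \<in> Row" if "i < x" for i using that by (auto simp: Row_def intro: fs.span_base)
    have finP: "finite P" using P finX by (rule finite_subset)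
    have cardP: "card P \<le> x"
      unfolding pivot_basis_dim[OF u, symmetric] Row_def
      by (metis card_image_le card_lessThan finite_lessThan fs.dim_span fs.dim_le_card' order.trans finite_imageI)
    have "P \<noteq> {}"
    proof
      assume "P = {}"
      then have "r i0 = 0" using pivot_basis_expand[OF u rRow[OF ne(2)]] by simp
      then have "r i0 (k0, j0) = 0" by simp
      then show False using ne by (simp add: r_def)
    qed
    then have cardP1: "1 \<le> card P" using finP by (simp add: Suc_le_eq card_gt_0_iff)
    define Col where "Col = fs.span (G ` {..<v'})"
    define Z where "Z = {..<m} \<times> {..<x}"
    have finZ: "finite Z" by (simp add: Z_def)
    have "fs.subspace {v :: nat \<times> nat \<Rightarrow> 'a. \<forall>i. i \<notin> Z \<longrightarrow> v i = 0}"
      by (auto simp: fs.subspace_def fsc_apply)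
    then have Col0: "Col \<subseteq> {v. \<forall>i. i \<notin> Z \<longrightarrow> v i = 0}"
      unfolding Col_def by (intro fs.span_minimal) (auto simp: G_def Z_def)
    obtain Q \<beta> where Q: "Q \<subseteq> Z" and \<beta>: "pivot_basis Col Q \<beta>"
      using pivot_basis_exists[OF valuation_ring_UNIV fs.subspace_span finZ, of "G ` {..<v'}"] Col0
      unfolding Col_def by blast
    have finQ: "finite Q" using Q finZ by (rule finite_subset)
    define L where "L = card Q"
    have L: "L \<le> m * x" using card_mono[OF finZ Q] by (simp add: L_def Z_def)
    obtain h where h: "bij_betw h {..<L} Q"
      using ex_bij_betw_nat_finite[OF finQ] by (auto simp: L_def atLeast0LessThan)
    have "real (fs.dim Col) + s * real (fs.dim T) \<le> real m * real (fs.dim T)"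
      unfolding Col_def
    proof (rule semistable_killed_dim[OF D _ _ T_def])
      fix j l assume "j \<in> {..<v'}" "l < y"
      then show "(\<Sum>k<m. \<Sum>i<x. D k i l * G j (k, i)) = 0"
        using gD[of l j] by (simp add: G_def)
    qed (auto simp: G_def)
    then have LT: "real L + s * real (fs.dim T) \<le> real m * real (fs.dim T)"
      by (simp add: pivot_basis_dim[OF \<beta>] L_def)
    \<comment> \<open>\<open>T\<close> is spanned by the columns of the matrix with rows
      \<open>r i\<close>, so its dimension is at most the row rank \<open>card P\<close>.\<close>
    have "fs.dim T \<le> card ((\<lambda>p i. if i < x then r i p else 0) ` P)"
      unfolding T_def fs.dim_span
    proof (rule fs.dim_le_card)
      show "{\<lambda>i. G j (k, i) | j k. j \<in> {..<v'} \<and> k < m} \<subseteq> fs.span ((\<lambda>p i. if i < x then r i p else 0) ` P)"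
      proof
        fix v assume "v \<in> {\<lambda>i. G j (k, i) | j k. j \<in> {..<v'} \<and> k < m}"
        then obtain j k where jk: "v = (\<lambda>i. G j (k, i))" "j < v'" "k < m" by auto
        have eq: "v = (\<Sum>p\<in>P. fsc (u p (k, j)) (\<lambda>i. if i < x then r i p else 0))"
        proof
          fix i
          show "v i = (\<Sum>p\<in>P. fsc (u p (k, j)) (\<lambda>i. if i < x then r i p else 0)) i"
          proof (cases "i < x")
            case True
            have "r i (k, j) = (\<Sum>p\<in>P. r i p * u p (k, j))"
              using u rRow[OF True] unfolding pivot_basis_def by blast
            then show ?thesis using True jk by (simp add: sum_fun_apply fsc_apply G_def r_def mult.commute)
          qed (simp add: jk G_def sum_fun_apply fsc_apply)
        qed
        show "v \<in> fs.span ((\<lambda>p i. if i < x then r i p else 0) ` P)"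
          unfolding eq by (rule span_combination) auto
      qed
    qed (simp add: finP)
    also have "\<dots> \<le> card P" by (rule card_image_le[OF finP])
    finally have TP: "fs.dim T \<le> card P" .
    have "real L * real x + real y * real (card P) \<le> real m * real x * real (card P)"
    proof -
      have "real y \<le> real m * real x" using ym by (metis of_nat_le_iff of_nat_mult)
      then have "s \<le> real m" using x y by simp
      then have "(real m - s) * real (fs.dim T) \<le> (real m - s) * real (card P)"
        using TP by (intro mult_left_mono) auto
      then have "real L \<le> (real m - s) * real (card P)" using LT by (simp add: algebra_simps)
      then have "real L * real x \<le> (real m - s) * real (card P) * real x" by (intro mult_right_mono) auto
      then show ?thesis unfolding y by (simp add: algebra_simps)
    qed
    then have "L * x + y * card P \<le> m * x * card P"
      by (simp only: of_nat_mult[symmetric] of_nat_add[symmetric] of_nat_le_iff)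
    then have PL: "(P, L) \<in> Js" using P cardP cardP1 L by (simp add: Js_def)
    have "\<exists>c. u p = (\<Sum>i<x. fsc (c i) (r i))" if "p \<in> P" for p
      using that u by (intro span_image_expand) (auto simp: pivot_basis_def Row_def)
    then obtain H where H: "\<And>p. p \<in> P \<Longrightarrow> u p = (\<Sum>i<x. fsc (H p i) (r i))" by metis
    define z where "z = (\<lambda>(c::nat, a::nat, b::nat, d::nat). if c = 0 then H (a, b) d
      else if c = 1 then \<beta> (h a) (b, d) else if c = 2 then G d (h b) else A a b d)"
    have z0: "z (0, a, b, d) = H (a, b) d" and z3: "z (3, a, b, d) = A a b d" for a b d
      by (auto simp: z_def)
    have g_eq: "(\<Sum>l<L. z (1, l, k, i) * z (2, 0, l, j)) = g k i j" if "k < m" "i < x" "j < v'" for k i j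
    proof -
      have "G j \<in> Col" using that by (auto simp: Col_def intro: fs.span_base)
      then have "G j (k, i) = (\<Sum>q\<in>Q. G j q * \<beta> q (k, i))"
        using \<beta> unfolding pivot_basis_def by blast
      also have "\<dots> = (\<Sum>l<L. G j (h l) * \<beta> (h l) (k, i))"
        by (rule sum.reindex_bij_betw[OF h, symmetric])
      finally show ?thesis using that by (simp add: G_def z_def mult.commute)
    qed
    have "\<Psi> (P, L) z t = w t" if tY: "t \<in> Y" for t
    proof -
      obtain k j q where t: "t = (k, j, q)" "k < m" "j < v'" "q < w'" using tY by (auto simp: Y_def)
      show ?thesis
      proof (cases "(k, j) \<in> P")
        case False
        then show ?thesis by (simp add: \<Psi>_def t z_def A_def)
      next
        case True
        have ueq: "u (k, j) (k', j') = (\<Sum>i<x. z (0, k, j, i) * (\<Sum>l<L. z (1, l, k', i) * z (2, 0, l, j')))"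
          if "(k', j') \<in> X" for k' j'
        proof -
          have "k' < m" "j' < v'" using that by (auto simp: X_def)
          then have "(\<Sum>i<x. H (k, j) i * r i (k', j')) =
              (\<Sum>i<x. z (0, k, j, i) * (\<Sum>l<L. z (1, l, k', i) * z (2, 0, l, j')))"
            by (intro sum.cong) (simp_all add: g_eq z0 r_def del: One_nat_def)
          then show ?thesis unfolding H[OF True] by (simp add: sum_fun_apply fsc_apply)
        qed
        have "(\<Sum>p\<in>X. A (fst p) (snd p) q * r i p) = 0" if "i < x" for i
        proof -
          have "(\<Sum>p\<in>X. A (fst p) (snd p) q * r i p) = (\<Sum>k<m. \<Sum>j<v'. A k j q * g k i j)"
            unfolding X_def sum.cartesian_product[symmetric] by (auto simp: sum.cartesian_product r_def intro!: sum.cong)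
          then show ?thesis using gA that t by simp
        qed
        \<comment> \<open>\<open>A\<close> kills every row of \<open>g\<close>, hence also the pivot
          vector at \<open>(k, j)\<close>. Its entry 1 at the pivot allows the equation to be solved
          for \<open>A k j q\<close>.\<close>
        then have "0 = (\<Sum>i<x. H (k, j) i * (\<Sum>p\<in>X. A (fst p) (snd p) q * r i p))" by simp
        also have "\<dots> = (\<Sum>p\<in>X. A (fst p) (snd p) q * u (k, j) p)"
          unfolding H[OF True] sum_fun_apply fsc_apply sum_distrib_left
          by (subst sum.swap) (simp add: algebra_simps)
        also have "\<dots> = (\<Sum>p\<in>X - P. A (fst p) (snd p) q * u (k, j) p) + (\<Sum>p\<in>P. A (fst p) (snd p) q * u (k, j) p)"
          using P finX by (subst sum.subset_diff[of P]) auto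
        also have "(\<Sum>p\<in>P. A (fst p) (snd p) q * u (k, j) p) = (\<Sum>p\<in>P. if p = (k, j) then A k j q else 0)"
          by (rule sum.cong) (use u True in \<open>auto simp: pivot_basis_def\<close>)
        also have "\<dots> = A k j q" using True finP by simp
        finally have "A k j q = - (\<Sum>p\<in>X - P. A (fst p) (snd p) q * u (k, j) p)"
          by (simp add: eq_neg_iff_add_eq_0 add.commute)
        also have "(\<Sum>p\<in>X - P. A (fst p) (snd p) q * u (k, j) p) =
          (\<Sum>(k', j')\<in>X - P. (\<Sum>i<x. z (0, k, j, i) * (\<Sum>l<L. z (1, l, k', i) * z (2, 0, l, j'))) * z (3, k', j', q))"
          by (rule sum.cong) (auto simp: ueq z3)
        finally show ?thesis using True by (simp add: \<Psi>_def t A_def)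
      qed
    qed
    then show False using w[OF PL, of z] by blast
  qed
qed

text \<open>If some \<open>n\<close> in \<open>N\<close> were not a pivot, \<open>v n\<close> minus
  the sum of \<open>v i * u i n\<close> over the pivots would be a nonzero functional that kills
  \<open>S\<close>. So every coordinate is a pivot.\<close>

lemma mem_subspace_by_functionals:
  fixes S :: "('i \<Rightarrow> 'a::field) set"
  assumes S: "fs.subspace S" and N: "finite N" and supp: "\<And>v i. v \<in> S \<Longrightarrow> i \<notin> N \<Longrightarrow> v i = 0"
    and dual: "\<And>\<eta> i. (\<And>v. v \<in> S \<Longrightarrow> (\<Sum>i\<in>N. \<eta> i * v i) = 0) \<Longrightarrow> i \<in> N \<Longrightarrow> \<eta> i = 0"
    and v: "\<And>i. i \<notin> N \<Longrightarrow> v i = 0"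
  shows "v \<in> S"
proof -
  obtain P u where P: "P \<subseteq> N" and u: "pivot_basis S P u"
    using pivot_basis_exists[OF valuation_ring_UNIV S N] supp by blast
  have finP: "finite P" using P N by (rule finite_subset)
  have "P = N"
  proof (rule ccontr)
    assume "P \<noteq> N"
    then obtain n where n: "n \<in> N" "n \<notin> P" using P by blast
    define \<eta> where "\<eta> = (\<lambda>i. if i = n then 1 else if i \<in> P then - u i n else 0)"
    have kill: "(\<Sum>i\<in>N. \<eta> i * v i) = 0" if "v \<in> S" for v
    proof -
      have vn: "v n = (\<Sum>i\<in>P. v i * u i n)"
        using u that unfolding pivot_basis_def by blast
      have "(\<Sum>i\<in>N. \<eta> i * v i) = (\<Sum>i\<in>insert n P. \<eta> i * v i)"
        using P N n by (intro sum.mono_neutral_right) (auto simp: \<eta>_def)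
      also have "\<dots> = v n + (\<Sum>i\<in>P. \<eta> i * v i)" using n finP by (simp add: \<eta>_def)
      also have "(\<Sum>i\<in>P. \<eta> i * v i) = - (\<Sum>i\<in>P. v i * u i n)"
        unfolding sum_negf[symmetric] by (rule sum.cong) (use n in \<open>auto simp: \<eta>_def\<close>)
      finally show ?thesis using vn by simp
    qed
    have "\<eta> n = 0" by (rule dual[of \<eta> n, OF kill n(1)])
    then show False by (simp add: \<eta>_def)
  qed
  have "v = (\<Sum>p\<in>P. fsc (v p) (u p))"
  proof
    fix i
    show "v i = (\<Sum>p\<in>P. fsc (v p) (u p)) i"
    proof (cases "i \<in> P")
      case True
      have "(\<Sum>p\<in>P. v p * u p i) = (\<Sum>p\<in>P. if p = i then v p else 0)"
        by (rule sum.cong) (use u True in \<open>auto simp: pivot_basis_def\<close>)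
      then show ?thesis using True finP by (simp add: sum_fun_apply fsc_apply)
    next
      case False
      then have "i \<notin> N" using \<open>P = N\<close> by simp
      moreover from this have "u p i = 0" if "p \<in> P" for p
        using supp[of "u p" i] u that by (auto simp: pivot_basis_def)
      ultimately show ?thesis using v by (simp add: sum_fun_apply fsc_apply)
    qed
  qed
  moreover have "(\<Sum>p\<in>P. fsc (v p) (u p)) \<in> S"
    using u by (intro fs.subspace_sum[OF S] fs.subspace_scale[OF S]) (auto simp: pivot_basis_def)
  ultimately show ?thesis by simp
qed

text \<open>\<open>Ext(A, B) = 0\<close> for the diagonal blocks \<open>A\<close>, of dimension vector \<open>(e1, e2)\<close>, and \<open>B\<close>, of
  dimension vector \<open>(d1 - e1, d2 - e2)\<close>, of \<open>M\<close>: the \<open>g\<close> below form the dual space.\<close>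

definition ext_vanishing :: "nat \<Rightarrow> nat \<Rightarrow> nat \<Rightarrow> nat \<Rightarrow> nat \<Rightarrow> (nat \<Rightarrow> nat \<Rightarrow> nat \<Rightarrow> 'a::field) \<Rightarrow> bool" where
  "ext_vanishing m d1 d2 e1 e2 M \<longleftrightarrow> (\<forall>g.
    (\<forall>p\<in>{e1..<d1}. \<forall>j<e1. (\<Sum>k<m. \<Sum>q\<in>{e2..<d2}. M k p q * g k q j) = 0) \<longrightarrow>
    (\<forall>r<e2. \<forall>q\<in>{e2..<d2}. (\<Sum>k<m. \<Sum>j<e1. M k j r * g k q j) = 0) \<longrightarrow>
    (\<forall>k<m. \<forall>q\<in>{e2..<d2}. \<forall>j<e1. g k q j = 0))"

text \<open>Ext(A, B) is the cokernel of the map (a, b) |-> M a - b M, where a and b map the two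
  spaces of A to those of B. A functional that kills the image is tested on elementary matrices
  \<open>a\<close> and \<open>b\<close>, which yields the two equations of
  \<open>ext_vanishing\<close>.\<close>

lemma ext_vanishing_surjective:
  fixes M :: "nat \<Rightarrow> nat \<Rightarrow> nat \<Rightarrow> 'a::field"
  assumes ext: "ext_vanishing m d1 d2 e1 e2 M"
  shows "\<exists>a b. \<forall>k<m. \<forall>j<e1. \<forall>q\<in>{e2..<d2}.
    (\<Sum>p\<in>{e1..<d1}. M k p q * a j p) - (\<Sum>r<e2. b r q * M k j r) = E k j q"
proof -
  note dual = ext[unfolded ext_vanishing_def, rule_format]
  define N where "N = {..<m} \<times> {..<e1} \<times> {e2..<d2}"
  define \<Theta> where "\<Theta> = (\<lambda>(a :: nat \<Rightarrow> nat \<Rightarrow> 'a) b (k, j, q). if (k, j, q) \<in> N then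
    (\<Sum>p\<in>{e1..<d1}. M k p q * a j p) - (\<Sum>r<e2. b r q * M k j r) else 0)"
  define S where "S = {\<Theta> a b | a b. True}"
  have finN: "finite N" by (simp add: N_def)
  have subS: "fs.subspace S"
  proof (rule fs.subspaceI)
    have "0 = \<Theta> (\<lambda>_ _. 0) (\<lambda>_ _. 0)" by (auto simp: \<Theta>_def fun_eq_iff)
    then show "0 \<in> S" unfolding S_def by blast
    fix u v assume "u \<in> S" "v \<in> S"
    then obtain a b a' b' where "u = \<Theta> a b" "v = \<Theta> a' b'" by (auto simp: S_def)
    then have "u + v = \<Theta> (\<lambda>i j. a i j + a' i j) (\<lambda>i j. b i j + b' i j)"
      by (auto simp: \<Theta>_def fun_eq_iff algebra_simps sum.distrib)
    then show "u + v \<in> S" unfolding S_def by blast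
  next
    fix c u assume "u \<in> S"
    then obtain a b where "u = \<Theta> a b" by (auto simp: S_def)
    then have "fsc c u = \<Theta> (\<lambda>i j. c * a i j) (\<lambda>i j. c * b i j)"
      by (auto simp: \<Theta>_def fun_eq_iff fsc_apply algebra_simps sum_distrib_left)
    then show "fsc c u \<in> S" unfolding S_def by blast
  qed
  define v where "v = (\<lambda>(k, j, q). if (k, j, q) \<in> N then E k j q else 0)"
  have "v \<in> S"
  proof (rule mem_subspace_by_functionals[OF subS finN])
    show "u i = 0" if "u \<in> S" "i \<notin> N" for u i
      using that by (auto simp: S_def \<Theta>_def split: prod.splits)
    show "v i = 0" if "i \<notin> N" for i using that by (auto simp: v_def split: prod.splits)
    fix \<eta> i assume \<eta>: "\<And>v. v \<in> S \<Longrightarrow> (\<Sum>i\<in>N. \<eta> i * v i) = 0" and "i \<in> N"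
    then obtain k0 j0 q0 where i: "i = (k0, j0, q0)" "k0 < m" "j0 < e1" "q0 \<in> {e2..<d2}" by (auto simp: N_def)
    have \<eta>\<Theta>: "(\<Sum>k<m. \<Sum>j<e1. \<Sum>q\<in>{e2..<d2}. \<eta> (k, j, q) *
        ((\<Sum>p\<in>{e1..<d1}. M k p q * a j p) - (\<Sum>r<e2. b r q * M k j r))) = 0" for a b
    proof -
      have "(\<Sum>i\<in>N. \<eta> i * \<Theta> a b i) = 0" by (rule \<eta>) (auto simp: S_def)
      moreover have "(\<Sum>i\<in>N. \<eta> i * \<Theta> a b i) = (\<Sum>k<m. \<Sum>j<e1. \<Sum>q\<in>{e2..<d2}. \<eta> (k, j, q) * \<Theta> a b (k, j, q))"
        by (simp add: N_def sum.cartesian_product split_beta)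
      moreover have "\<dots> = (\<Sum>k<m. \<Sum>j<e1. \<Sum>q\<in>{e2..<d2}. \<eta> (k, j, q) *
        ((\<Sum>p\<in>{e1..<d1}. M k p q * a j p) - (\<Sum>r<e2. b r q * M k j r)))"
        by (intro sum.cong refl) (auto simp: \<Theta>_def N_def)
      ultimately show ?thesis by simp
    qed
    have "(\<lambda>k q j. \<eta> (k, j, q)) k0 q0 j0 = 0"
    proof (rule dual[OF _ _ i(2,4,3)])
      fix p j assume pj: "p \<in> {e1..<d1}" "j < e1"
      have "(\<Sum>k<m. \<Sum>j'<e1. \<Sum>q\<in>{e2..<d2}. \<eta> (k, j', q) *
        ((\<Sum>p'\<in>{e1..<d1}. M k p' q * (if j' = j \<and> p' = p then 1 else 0)) - (\<Sum>r<e2. 0 * M k j' r))) =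
        (\<Sum>k<m. \<Sum>j'<e1. if j' = j then \<Sum>q\<in>{e2..<d2}. \<eta> (k, j, q) * M k p q else 0)"
      proof (intro sum.cong refl)
        fix k j'
        have "(\<Sum>p'\<in>{e1..<d1}. M k p' q * (if j' = j \<and> p' = p then 1 else 0)) = (if j' = j then M k p q else 0)" for q
        proof -
          have "(\<Sum>p'\<in>{e1..<d1}. M k p' q * (if j' = j \<and> p' = p then 1 else 0)) =
            (\<Sum>p'\<in>{e1..<d1}. if p' = p then (if j' = j then M k p q else 0) else 0)"
            by (rule sum.cong) auto
          then show ?thesis using pj by simp
        qed
        then show "(\<Sum>q\<in>{e2..<d2}. \<eta> (k, j', q) *
          ((\<Sum>p'\<in>{e1..<d1}. M k p' q * (if j' = j \<and> p' = p then 1 else 0)) - (\<Sum>r<e2. 0 * M k j' r))) =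
          (if j' = j then \<Sum>q\<in>{e2..<d2}. \<eta> (k, j, q) * M k p q else 0)" by simp
      qed
      then show "(\<Sum>k<m. \<Sum>q\<in>{e2..<d2}. M k p q * \<eta> (k, j, q)) = 0"
        using \<eta>\<Theta>[of "\<lambda>j' p'. if j' = j \<and> p' = p then 1 else 0" "\<lambda>_ _. 0"] pj
        by (simp add: mult.commute)
    next
      fix r q assume rq: "r < e2" "q \<in> {e2..<d2}"
      have "(\<Sum>k<m. \<Sum>j<e1. \<Sum>q'\<in>{e2..<d2}. \<eta> (k, j, q') *
        ((\<Sum>p\<in>{e1..<d1}. M k p q' * 0) - (\<Sum>r'<e2. (if r' = r \<and> q' = q then 1 else 0) * M k j r'))) =
        (\<Sum>k<m. \<Sum>j<e1. \<Sum>q'\<in>{e2..<d2}. if q' = q then - (\<eta> (k, j, q) * M k j r) else 0)"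
      proof (intro sum.cong refl)
        fix k j q'
        have "(\<Sum>r'<e2. (if r' = r \<and> q' = q then 1 else 0) * M k j r') =
            (\<Sum>r'<e2. if r' = r then (if q' = q then M k j r else 0) else 0)"
          by (rule sum.cong) auto
        then show "\<eta> (k, j, q') *
          ((\<Sum>p\<in>{e1..<d1}. M k p q' * 0) - (\<Sum>r'<e2. (if r' = r \<and> q' = q then 1 else 0) * M k j r')) =
          (if q' = q then - (\<eta> (k, j, q) * M k j r) else 0)" using rq by simp
      qed
      then show "(\<Sum>k<m. \<Sum>j<e1. M k j r * \<eta> (k, j, q)) = 0"
        using \<eta>\<Theta>[of "\<lambda>_ _. 0" "\<lambda>r' q'. if r' = r \<and> q' = q then 1 else 0"] rq
        by (simp add: mult.commute sum_negf)
    qed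
    then show "\<eta> i = 0" by (simp add: i)
  qed
  then obtain a b where "v = \<Theta> a b" by (auto simp: S_def)
  moreover have "v (k, j, q) = E k j q" if "(k, j, q) \<in> N" for k j q
    using that by (simp add: v_def)
  ultimately have "\<Theta> a b (k, j, q) = E k j q" if "(k, j, q) \<in> N" for k j q
    using that by simp
  then show ?thesis by (intro exI[of _ a] exI[of _ b]) (auto simp: \<Theta>_def N_def)
qed

section \<open>Formal deformation of subrepresentations\<close>

lemma fps_mult_nth_cong:
  assumes "\<And>i. i \<le> n \<Longrightarrow> f $ i = f' $ i" "\<And>i. i \<le> n \<Longrightarrow> g $ i = g' $ i"
  shows "(f * g) $ n = (f' * g') $ (n :: nat)"
  unfolding fps_mult_nth by (rule sum.cong) (use assms in auto)

text \<open>For block diagonal M, this quadratic equation of Riccati type says that the graphs of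
  \<open>a\<close> and \<open>b\<close> form a subrepresentation of M + X N. The factor
  \<open>fps_X\<close> leaves only lower coefficients of \<open>a\<close> and \<open>b\<close> on
  the right, so \<open>surj\<close> solves it order by order.\<close>

lemma riccati_lift:
  fixes M N :: "nat \<Rightarrow> nat \<Rightarrow> nat \<Rightarrow> 'a::field"
  assumes surj: "\<And>E. \<exists>a b. \<forall>k<m. \<forall>j<e1. \<forall>q\<in>W.
    (\<Sum>p\<in>V. M k p q * a j p) - (\<Sum>r<e2. b r q * M k j r) = E k j q"
  obtains a b :: "nat \<Rightarrow> nat \<Rightarrow> 'a fps" where "\<And>k j q. k < m \<Longrightarrow> j < e1 \<Longrightarrow> q \<in> W \<Longrightarrow>
    (\<Sum>p\<in>V. fps_const (M k p q) * a j p) - (\<Sum>r<e2. b r q * fps_const (M k j r)) =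
    fps_X * ((\<Sum>r<e2. b r q * (fps_const (N k j r) + (\<Sum>p\<in>V. fps_const (N k p r) * a j p)))
      - fps_const (N k j q) - (\<Sum>p\<in>V. fps_const (N k p q) * a j p))"
proof -
  define R where "R = (\<lambda>a b k j q. (\<Sum>r<e2. b r q * (fps_const (N k j r) + (\<Sum>p\<in>V. fps_const (N k p r) * a j p)))
      - fps_const (N k j q) - (\<Sum>p\<in>V. fps_const (N k p q) * a j p))"
  define trunc :: "nat \<Rightarrow> (nat \<Rightarrow> nat \<Rightarrow> nat \<Rightarrow> 'a) \<Rightarrow> nat \<Rightarrow> nat \<Rightarrow> 'a fps" where
    "trunc = (\<lambda>n f j p. Abs_fps (\<lambda>i. if i < n then f i j p else 0))"
  \<comment> \<open>Truncation makes the condition on the n-th pair depend on earlier pairs only;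
    the shift to \<open>n - 1\<close> is the factor \<open>fps_X\<close>. In order 0 any solution of
    the homogeneous equation will do.\<close>
  define Q where "Q = (\<lambda>f n (s :: (nat \<Rightarrow> nat \<Rightarrow> 'a) \<times> (nat \<Rightarrow> nat \<Rightarrow> 'a)). \<forall>k<m. \<forall>j<e1. \<forall>q\<in>W.
    (\<Sum>p\<in>V. M k p q * fst s j p) - (\<Sum>r<e2. snd s r q * M k j r) =
    (if n = 0 then 0 else R (trunc n (\<lambda>i. fst (f i))) (trunc n (\<lambda>i. snd (f i))) k j q $ (n - 1)))"
  have "\<exists>f. \<forall>n. Q f n (f n)"
  proof (rule dependent_wf_choice[OF wf_less_than])
    fix f g :: "nat \<Rightarrow> (nat \<Rightarrow> nat \<Rightarrow> 'a) \<times> (nat \<Rightarrow> nat \<Rightarrow> 'a)" and n s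
    assume fg: "\<And>z. (z, n) \<in> less_than \<Longrightarrow> f z = g z"
    have "trunc n (\<lambda>i. fst (f i)) = trunc n (\<lambda>i. fst (g i))" "trunc n (\<lambda>i. snd (f i)) = trunc n (\<lambda>i. snd (g i))"
      unfolding trunc_def by (auto simp: fun_eq_iff fps_eq_iff fg)
    then show "Q f n s = Q g n s" by (simp add: Q_def)
  next
    fix n and f :: "nat \<Rightarrow> (nat \<Rightarrow> nat \<Rightarrow> 'a) \<times> (nat \<Rightarrow> nat \<Rightarrow> 'a)"
    obtain a b where "\<forall>k<m. \<forall>j<e1. \<forall>q\<in>W. (\<Sum>p\<in>V. M k p q * a j p) - (\<Sum>r<e2. b r q * M k j r) =
      (if n = 0 then 0 else R (trunc n (\<lambda>i. fst (f i))) (trunc n (\<lambda>i. snd (f i))) k j q $ (n - 1))"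
      using surj[of "\<lambda>k j q. if n = 0 then 0 else R (trunc n (\<lambda>i. fst (f i))) (trunc n (\<lambda>i. snd (f i))) k j q $ (n - 1)"]
      by (elim exE)
    then have "Q f n (a, b)" by (simp add: Q_def)
    then show "\<exists>s. Q f n s" by blast
  qed
  then obtain f where f: "\<And>n. Q f n (f n)" by blast
  define a where "a = (\<lambda>j p. Abs_fps (\<lambda>i. fst (f i) j p))"
  define b where "b = (\<lambda>j p. Abs_fps (\<lambda>i. snd (f i) j p))"
  have R_eq: "R (trunc (Suc n) (\<lambda>i. fst (f i))) (trunc (Suc n) (\<lambda>i. snd (f i))) k j q $ n = R a b k j q $ n" for n k j q
  proof -
    have 1: "trunc (Suc n) (\<lambda>i. fst (f i)) j p $ i = a j p $ i" "trunc (Suc n) (\<lambda>i. snd (f i)) j p $ i = b j p $ i"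
      if "i \<le> n" for i j p using that by (auto simp: trunc_def a_def b_def)
    show ?thesis
      unfolding R_def fps_sub_nth fps_sum_nth
      by (intro arg_cong2[of _ _ _ _ "(-)"] sum.cong refl fps_mult_nth_cong)
        (simp_all add: 1 fps_sum_nth)
  qed
  show thesis
  proof (rule that[of a b], rule fps_ext)
    fix k j q n assume kjq: "k < m" "j < e1" "q \<in> W"
    have "((\<Sum>p\<in>V. fps_const (M k p q) * a j p) - (\<Sum>r<e2. b r q * fps_const (M k j r))) $ n =
      (\<Sum>p\<in>V. M k p q * fst (f n) j p) - (\<Sum>r<e2. snd (f n) r q * M k j r)"
      by (simp add: fps_sum_nth a_def b_def)
    also have "\<dots> = (if n = 0 then 0 else R a b k j q $ (n - 1))"
      using f[of n] kjq R_eq[of "n - 1" k j q] by (auto simp: Q_def)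
    also have "\<dots> = (fps_X * R a b k j q) $ n" by simp
    finally show "((\<Sum>p\<in>V. fps_const (M k p q) * a j p) - (\<Sum>r<e2. b r q * fps_const (M k j r))) $ n =
      (fps_X * ((\<Sum>r<e2. b r q * (fps_const (N k j r) + (\<Sum>p\<in>V. fps_const (N k p r) * a j p)))
      - fps_const (N k j q) - (\<Sum>p\<in>V. fps_const (N k p q) * a j p))) $ n"
      unfolding R_def .
  qed
qed

section \<open>Places\<close>

text \<open>A ring homomorphism from a subring of \<open>'k\<close> to \<open>'a\<close> is encoded by its graph, so that its
  extensions are the supersets.\<close>

definition hom_graph :: "('k::field \<times> 'a::field) set \<Rightarrow> bool" where
  "hom_graph G \<longleftrightarrow> (1, 1) \<in> G \<and> (\<forall>x c y d. (x, c) \<in> G \<longrightarrow> (y, d) \<in> G \<longrightarrow> (x + y, c + d) \<in> G \<and> (x * y, c * d) \<in> G)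
     \<and> (\<forall>x c. (x, c) \<in> G \<longrightarrow> (- x, - c) \<in> G) \<and> (\<forall>c. (0, c) \<in> G \<longrightarrow> c = 0)"

lemma hom_graphD:
  assumes "hom_graph G"
  shows "(1, 1) \<in> G" "(0, 0) \<in> G" "(x, c) \<in> G \<Longrightarrow> (y, d) \<in> G \<Longrightarrow> (x + y, c + d) \<in> G"
    "(x, c) \<in> G \<Longrightarrow> (y, d) \<in> G \<Longrightarrow> (x * y, c * d) \<in> G" "(x, c) \<in> G \<Longrightarrow> (- x, - c) \<in> G"
    "(0, c) \<in> G \<Longrightarrow> c = 0" "(x, c) \<in> G \<Longrightarrow> (x, d) \<in> G \<Longrightarrow> c = d"
proof -
  show *: "(1, 1) \<in> G" "(x, c) \<in> G \<Longrightarrow> (y, d) \<in> G \<Longrightarrow> (x + y, c + d) \<in> G"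
    "(x, c) \<in> G \<Longrightarrow> (y, d) \<in> G \<Longrightarrow> (x * y, c * d) \<in> G" "(x, c) \<in> G \<Longrightarrow> (- x, - c) \<in> G"
    "(0, c) \<in> G \<Longrightarrow> c = 0" for x y c d
    using assms unfolding hom_graph_def by blast+
  show "(0, 0) \<in> G" using *(2)[OF *(1) *(4)[OF *(1)]] by simp
  show "(x, c) \<in> G \<Longrightarrow> (x, d) \<in> G \<Longrightarrow> c = d"
    using *(2)[of x c "- x" "- d"] *(4)[of x d] *(5)[of "c - d"] by simp
qed

lemma hom_graph_sum:
  assumes "hom_graph G" "\<And>i. i \<in> A \<Longrightarrow> (f i, g i) \<in> G"
  shows "(sum f A, sum g A) \<in> G"
  using assms(2) by (induction A rule: infinite_finite_induct) (auto intro: hom_graphD[OF assms(1)])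

lemma hom_graph_power:
  assumes "hom_graph G" "(x, c) \<in> G"
  shows "(x ^ n, c ^ n) \<in> G"
  using assms by (induction n) (auto intro: hom_graphD)

section \<open>Extension of homomorphisms to places\<close>

definition coeffwise :: "('k::field \<times> 'a::field) set \<Rightarrow> 'k poly \<Rightarrow> 'a poly \<Rightarrow> bool" where
  "coeffwise G p q \<longleftrightarrow> (\<forall>i. (coeff p i, coeff q i) \<in> G)"

lemma coeffwise_ring:
  assumes "hom_graph G"
  shows "coeffwise G p q \<Longrightarrow> coeffwise G p' q' \<Longrightarrow> coeffwise G (p + p') (q + q')"
    and "coeffwise G p q \<Longrightarrow> coeffwise G p' q' \<Longrightarrow> coeffwise G (p * p') (q * q')"
    and "coeffwise G p q \<Longrightarrow> coeffwise G (- p) (- q)"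
    and "(x, c) \<in> G \<Longrightarrow> coeffwise G [:x:] [:c:]"
    and "coeffwise G [:0, 1:] [:0, 1:]"
  using assms unfolding coeffwise_def coeff_mult
  by (auto simp: coeff_pCons split: nat.splits intro: hom_graphD intro!: hom_graph_sum)

lemma poly_eq_sum:
  fixes p :: "'a::field poly"
  assumes "degree p \<le> n"
  shows "poly p x = (\<Sum>i\<le>n. coeff p i * x ^ i)"
  unfolding poly_altdef using assms
  by (intro sum.mono_neutral_left) (auto simp: coeff_eq_0)

text \<open>The extension to the ring generated by \<open>x\<close> that sends \<open>x\<close> to
  \<open>c\<close>. It is single-valued exactly if the image of every polynomial relation for
  \<open>x\<close> has the root \<open>c\<close>.\<close>

definition adjoin :: "('k::field \<times> 'a::field) set \<Rightarrow> 'k \<Rightarrow> 'a \<Rightarrow> ('k \<times> 'a) set" where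
  "adjoin G x c = {(poly p x, poly q c) | p q. coeffwise G p q}"

lemma adjoin_props:
  assumes G: "hom_graph G"
  shows "G \<subseteq> adjoin G x c" "(x, c) \<in> adjoin G x c"
    and "(\<And>p q. coeffwise G p q \<Longrightarrow> poly p x = 0 \<Longrightarrow> poly q c = 0) \<Longrightarrow> hom_graph (adjoin G x c)"
proof -
  show sub: "G \<subseteq> adjoin G x c"
  proof
    fix z assume "z \<in> G"
    then have "coeffwise G [:fst z:] [:snd z:]" using coeffwise_ring(4)[OF G] by simp
    then show "z \<in> adjoin G x c" unfolding adjoin_def
      by (intro CollectI exI[of _ "[:fst z:]"] exI[of _ "[:snd z:]"]) auto
  qed
  show "(x, c) \<in> adjoin G x c" unfolding adjoin_def using coeffwise_ring(5)[OF G]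
    by (intro CollectI exI[of _ "[:0, 1:]"] exI[of _ "[:0, 1:]"]) auto
  assume *: "\<And>p q. coeffwise G p q \<Longrightarrow> poly p x = 0 \<Longrightarrow> poly q c = 0"
  show "hom_graph (adjoin G x c)"
    unfolding hom_graph_def
  proof (intro conjI allI impI)
    show "(1, 1) \<in> adjoin G x c" using sub hom_graphD(1)[OF G] by blast
    fix y d assume "(y, d) \<in> adjoin G x c"
    then obtain p q where pq: "y = poly p x" "d = poly q c" "coeffwise G p q" by (auto simp: adjoin_def)
    show "(- y, - d) \<in> adjoin G x c" unfolding adjoin_def using pq coeffwise_ring(3)[OF G pq(3)]
      by (intro CollectI exI[of _ "- p"] exI[of _ "- q"]) auto
    fix y' d' assume "(y', d') \<in> adjoin G x c"
    then obtain p' q' where pq': "y' = poly p' x" "d' = poly q' c" "coeffwise G p' q'" by (auto simp: adjoin_def)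
    show "(y + y', d + d') \<in> adjoin G x c" unfolding adjoin_def using pq pq' coeffwise_ring(1)[OF G pq(3) pq'(3)]
      by (intro CollectI exI[of _ "p + p'"] exI[of _ "q + q'"]) auto
    show "(y * y', d * d') \<in> adjoin G x c" unfolding adjoin_def using pq pq' coeffwise_ring(2)[OF G pq(3) pq'(3)]
      by (intro CollectI exI[of _ "p * p'"] exI[of _ "q * q'"]) auto
  next
    fix d assume "(0, d) \<in> adjoin G x c"
    then show "d = 0" using * by (auto simp: adjoin_def)
  qed
qed

text \<open>The ideal is generated by a nonzero element of least degree; a nonconstant generator
  would have a root, common to the whole ideal.\<close>

lemma ideal_without_root_contains_1:
  fixes J :: "'a::alg_closed_field poly set"
  assumes add: "\<And>p q. p \<in> J \<Longrightarrow> q \<in> J \<Longrightarrow> p + q \<in> J" and mult: "\<And>p q. q \<in> J \<Longrightarrow> p * q \<in> J"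
    and noroot: "\<And>c. \<exists>p\<in>J. poly p c \<noteq> 0"
  shows "1 \<in> J"
proof -
  obtain p0 where "p0 \<in> J" "p0 \<noteq> 0" using noroot[of 0] by force
  then obtain p where p: "p \<in> J" "p \<noteq> 0" and minp: "\<And>q. q \<in> J \<Longrightarrow> q \<noteq> 0 \<Longrightarrow> degree p \<le> degree q"
    using ex_has_least_nat[of "\<lambda>p. p \<in> J \<and> p \<noteq> 0" p0 degree] by blast
  have dvd: "p dvd q" if "q \<in> J" for q
  proof (rule ccontr)
    assume "\<not> p dvd q"
    then have "q mod p \<noteq> 0" by (simp add: mod_eq_0_iff_dvd)
    have "q mod p = q + (- (q div p)) * p" by (simp add: minus_div_mult_eq_mod[symmetric])
    also have "\<dots> \<in> J" by (intro add mult that p)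
    finally have "degree p \<le> degree (q mod p)" using minp \<open>q mod p \<noteq> 0\<close> by blast
    moreover have "degree (q mod p) < degree p" using degree_mod_less[OF p(2), of q] \<open>q mod p \<noteq> 0\<close> by auto
    ultimately show False by simp
  qed
  have "degree p = 0"
  proof (rule ccontr)
    assume "degree p \<noteq> 0"
    then obtain c where "poly p c = 0" using alg_closed_imp_poly_has_root[of p] by auto
    moreover obtain q where "q \<in> J" "poly q c \<noteq> 0" using noroot by blast
    ultimately show False using dvd[of q] by (auto simp: dvd_def)
  qed
  then obtain c where "p = [:c:]" by (rule degree_eq_zeroE)
  then have "[:inverse c:] * p = 1" using p by simp
  then show ?thesis using mult[OF p(1), of "[:inverse c:]"] by simp
qed

text \<open>Chevalley's extension theorem, by Zorn's lemma. As \<open>G0\<close> is already onto an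
  algebraically closed field, the target field need not grow.\<close>

lemma place_extension:
  fixes G0 :: "('k::field \<times> 'a::alg_closed_field) set"
  assumes G0: "hom_graph G0" and onto: "\<And>c. \<exists>x. (x, c) \<in> G0"
  obtains G where "G0 \<subseteq> G" "hom_graph G" "\<And>x. x \<in> Domain G \<or> inverse x \<in> Domain G"
proof -
  define \<A> where "\<A> = {G. hom_graph G \<and> G0 \<subseteq> G}"
  have "\<exists>M\<in>\<A>. \<forall>X\<in>\<A>. M \<subseteq> X \<longrightarrow> X = M"
  proof (rule subset_Zorn_nonempty)
    show "\<A> \<noteq> {}" using G0 by (auto simp: \<A>_def)
    fix \<C> assume ne: "\<C> \<noteq> {}" and chain: "subset.chain \<A> \<C>"
    have hg: "hom_graph G" "G0 \<subseteq> G" if "G \<in> \<C>" for G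
      using chain that by (auto simp: subset.chain_def \<A>_def)
    have two: "\<exists>G\<in>\<C>. z \<in> G \<and> z' \<in> G" if "z \<in> \<Union>\<C>" "z' \<in> \<Union>\<C>" for z z'
      using that chain unfolding subset.chain_def by blast
    have "hom_graph (\<Union>\<C>)"
      unfolding hom_graph_def
    proof (intro conjI allI impI)
      show "(1, 1) \<in> \<Union>\<C>" using ne hg hom_graphD(1) by fast
      fix x c assume x: "(x, c) \<in> \<Union>\<C>"
      then show "(- x, - c) \<in> \<Union>\<C>" using hg hom_graphD(5) by fast
      fix y d assume "(y, d) \<in> \<Union>\<C>"
      from two[OF x this] obtain G where G: "G \<in> \<C>" "(x, c) \<in> G" "(y, d) \<in> G" by blast
      then show "(x + y, c + d) \<in> \<Union>\<C>" "(x * y, c * d) \<in> \<Union>\<C>"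
        using hom_graphD(3,4)[OF hg(1)[OF G(1)] G(2,3)] by blast+
    next
      fix c assume "(0, c) \<in> \<Union>\<C>"
      then show "c = 0" using hg hom_graphD(6) by fast
    qed
    then show "\<Union>\<C> \<in> \<A>" using ne hg by (auto simp: \<A>_def)
  qed
  then obtain G where G: "hom_graph G" "G0 \<subseteq> G" and maxG: "\<And>X. hom_graph X \<Longrightarrow> G \<subseteq> X \<Longrightarrow> X = G"
    unfolding \<A>_def by (auto intro: order.trans)
  note hG = hom_graphD[OF G(1)]
  have maximal: "(x, c) \<in> G"
    if "\<And>p q. coeffwise G p q \<Longrightarrow> poly p x = 0 \<Longrightarrow> poly q c = 0" for x c
    using adjoin_props[OF G(1), of x c] maxG[of "adjoin G x c"] that by blast
  \<comment> \<open>The domain is local: multiplication by \<open>x ^ n\<close> turns a relation for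
    \<open>inverse x\<close> into an element of \<open>G\<close> with first component 0.\<close>
  have inv: "(inverse x, inverse c) \<in> G" if xc: "(x, c) \<in> G" "c \<noteq> 0" for x c
  proof (rule maximal)
    fix p q assume pq: "coeffwise G p q" "poly p (inverse x) = 0"
    have x0: "x \<noteq> 0" using xc hG(6) by auto
    have rev: "(\<Sum>i\<le>n. coeff r i * z ^ (n - i)) = z ^ n * poly r (inverse z)"
      if "degree r \<le> n" "z \<noteq> 0" for n z and r :: "'b::field poly"
      unfolding poly_eq_sum[OF that(1)] sum_distrib_left
      by (rule sum.cong) (use that in \<open>auto simp: power_diff field_simps\<close>)
    define n where "n = max (degree p) (degree q)"
    have "(\<Sum>i\<le>n. coeff p i * x ^ (n - i), \<Sum>i\<le>n. coeff q i * c ^ (n - i)) \<in> G"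
      using pq xc by (intro hom_graph_sum[OF G(1)] hG(4) hom_graph_power[OF G(1)]) (auto simp: coeffwise_def)
    then have "(x ^ n * poly p (inverse x), c ^ n * poly q (inverse c)) \<in> G"
      using rev[of p n x] rev[of q n c] x0 xc by (simp add: n_def)
    then have "(0, c ^ n * poly q (inverse c)) \<in> G" using pq by simp
    then have "c ^ n * poly q (inverse c) = 0" by (rule hG(6))
    then show "poly q (inverse c) = 0" using xc by simp
  qed
  \<comment> \<open>By maximality \<open>y\<close> can be given no value, so the images of its
    relations have no common root. Hence some relation has image 1: its constant term has value 1
    and all other coefficients have value 0.\<close>
  have relation: "\<exists>p. coeffwise G p 1 \<and> poly p y = 0" if y: "y \<notin> Domain G" for y
  proof -
    define J where "J = {q. \<exists>p. coeffwise G p q \<and> poly p y = 0}"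
    have "1 \<in> J"
    proof (rule ideal_without_root_contains_1)
      fix q q' assume "q \<in> J" "q' \<in> J"
      then obtain p p' where "coeffwise G p q" "poly p y = 0" "coeffwise G p' q'" "poly p' y = 0"
        by (auto simp: J_def)
      then show "q + q' \<in> J" unfolding J_def
        using coeffwise_ring(1)[OF G(1)] by (intro CollectI exI[of _ "p + p'"]) auto
    next
      fix r q assume "q \<in> J"
      then obtain p where p: "coeffwise G p q" "poly p y = 0" by (auto simp: J_def)
      have "\<exists>t. coeffwise G t r"
      proof (induction r)
        case 0
        then show ?case using hG(2) by (intro exI[of _ 0]) (simp add: coeffwise_def)
      next
        case (pCons c r)
        then obtain t where t: "coeffwise G t r" by blast
        obtain x where x: "(x, c) \<in> G" using onto G(2) by blast
        have "coeffwise G (pCons x t) (pCons c r)"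
          using t x by (auto simp: coeffwise_def coeff_pCons split: nat.splits)
        then show ?case by blast
      qed
      then obtain t where "coeffwise G t r" by blast
      then show "r * q \<in> J" unfolding J_def using p coeffwise_ring(2)[OF G(1)]
        by (intro CollectI exI[of _ "t * p"]) auto
    next
      fix c
      show "\<exists>q\<in>J. poly q c \<noteq> 0"
      proof (rule ccontr)
        assume "\<not> ?thesis"
        then have "(y, c) \<in> G" by (intro maximal) (auto simp: J_def)
        then show False using y by blast
      qed
    qed
    then show ?thesis by (simp add: J_def)
  qed
  \<comment> \<open>The reversal of the relation \<open>r\<close> for \<open>inverse x\<close>
    cancels the leading term of the relation \<open>p\<close> for \<open>x\<close>. The multiplier
    \<open>u\<close> has value 0, because the leading coefficient of \<open>p\<close> has, so the
    image remains 1, against the minimality of \<open>p\<close>.\<close>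
  have reduce: False if p: "coeffwise G p 1" "poly p x = 0" and r: "coeffwise G r 1" "poly r (inverse x) = 0"
    and x: "x \<noteq> 0" and deg: "degree r \<le> degree p"
    and minp: "\<And>p'. coeffwise G p' 1 \<Longrightarrow> poly p' x = 0 \<Longrightarrow> degree p \<le> degree p'" for p r x
  proof -
    define n where "n = degree p"
    have c0: "coeff (1 :: 'a poly) 0 = 1" by simp
    have r0: "(coeff r 0, 1) \<in> G" using r(1) c0 unfolding coeffwise_def by metis
    have n: "n \<noteq> 0"
    proof
      assume "n = 0"
      then have "coeff p 0 = 0" using p(2) unfolding n_def by (auto elim: degree_eq_zeroE)
      moreover have "(coeff p 0, 1) \<in> G" using p(1) c0 unfolding coeffwise_def by metis
      ultimately show False using hG(6)[of 1] by simp
    qed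
    have "coeff (1 :: 'a poly) n = 0" using n by (intro coeff_eq_0) simp
    then have pn: "(coeff p n, 0) \<in> G" using p(1) unfolding coeffwise_def by metis
    have r0': "(inverse (coeff r 0), 1) \<in> G" using inv[OF r0] by simp
    have "coeff r 0 \<noteq> 0" using r0 hG(6)[of 1] by auto
    define u where "u = coeff p n * inverse (coeff r 0)"
    have u: "(u, 0) \<in> G" using hG(4)[OF pn r0'] by (simp add: u_def)
    define R where "R = (\<Sum>i\<le>n. monom (coeff r (n - i)) i)"
    have coeffR: "coeff R i = (if i \<le> n then coeff r (n - i) else 0)" for i
      by (simp add: R_def coeff_sum)
    have "poly R x = (\<Sum>i\<le>n. coeff r (n - i) * x ^ i)" by (simp add: R_def poly_sum poly_monom)
    also have "\<dots> = (\<Sum>i\<le>n. coeff r i * x ^ (n - i))"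
      by (rule sum.reindex_bij_witness[of _ "\<lambda>i. n - i" "\<lambda>i. n - i"]) auto
    also have "\<dots> = x ^ n * poly r (inverse x)"
      unfolding poly_eq_sum[OF deg[folded n_def]] sum_distrib_left
      by (rule sum.cong) (use x in \<open>auto simp: power_diff field_simps\<close>)
    finally have R0: "poly R x = 0" using r by simp
    define p' where "p' = p - smult u R"
    have "coeffwise G p' 1"
      unfolding coeffwise_def
    proof
      fix i
      obtain d where "(coeff R i, d) \<in> G"
        using r(1) hG(2) unfolding coeffwise_def coeffR by (cases "i \<le> n") auto
      then have "(u * coeff R i, 0 * d) \<in> G" by (rule hG(4)[OF u])
      then have "(coeff p i + - (u * coeff R i), coeff 1 i + - (0 * d)) \<in> G"
        using p(1) unfolding coeffwise_def by (intro hG(3) hG(5)) auto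
      then show "(coeff p' i, coeff 1 i) \<in> G" by (simp add: p'_def)
    qed
    moreover have "poly p' x = 0" using p R0 by (simp add: p'_def)
    ultimately have "n \<le> degree p'" unfolding n_def by (rule minp)
    moreover have "degree p' < n"
    proof -
      have "coeff p' i = 0" if "i \<ge> n" for i
      proof (cases "i = n")
        case True
        then show ?thesis using \<open>coeff r 0 \<noteq> 0\<close> by (simp add: p'_def coeffR u_def)
      next
        case False
        then show ?thesis using that by (simp add: p'_def coeffR coeff_eq_0 n_def)
      qed
      then have "degree p' \<le> n - 1" by (intro degree_le) auto
      then show ?thesis using n by simp
    qed
    ultimately show False by simp
  qed
  have minimal: "\<exists>p. coeffwise G p 1 \<and> poly p y = 0 \<and>
      (\<forall>p'. coeffwise G p' 1 \<longrightarrow> poly p' y = 0 \<longrightarrow> degree p \<le> degree p')" if "y \<notin> Domain G" for y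
    using ex_has_least_nat[of "\<lambda>p. coeffwise G p 1 \<and> poly p y = 0" _ degree] relation[OF that] by blast
  have "x \<in> Domain G \<or> inverse x \<in> Domain G" for x
  proof (rule ccontr)
    assume c: "\<not> ?thesis"
    have "x \<noteq> 0" using c hG(2) by auto
    obtain p where p: "coeffwise G p 1" "poly p x = 0"
      "\<And>p'. coeffwise G p' 1 \<Longrightarrow> poly p' x = 0 \<Longrightarrow> degree p \<le> degree p'"
      using minimal[of x] c by blast
    obtain r where r: "coeffwise G r 1" "poly r (inverse x) = 0"
      "\<And>p'. coeffwise G p' 1 \<Longrightarrow> poly p' (inverse x) = 0 \<Longrightarrow> degree r \<le> degree p'"
      using minimal[of "inverse x"] c by blast
    show False
    proof (cases "degree r \<le> degree p")
      case True
      show ?thesis by (rule reduce[OF p(1,2) r(1,2) \<open>x \<noteq> 0\<close> True p(3)])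
    next
      case False
      have "poly p (inverse (inverse x)) = 0" "inverse x \<noteq> 0" "degree p \<le> degree r"
        using p(2) \<open>x \<noteq> 0\<close> False by simp_all
      then show ?thesis by (rule reduce[OF r(1,2) p(1) _ _ _ r(3)])
    qed
  qed
  then show thesis using that G by blast
qed

lemma place_valuation_ring:
  assumes "hom_graph G" "\<And>x. x \<in> Domain G \<or> inverse x \<in> Domain G"
  shows "valuation_ring (Domain G)"
  unfolding valuation_ring_def using assms(2) hom_graphD[OF assms(1)] by blast

section \<open>Specialisation of subrepresentations\<close>

definition reduction :: "('k::field \<times> 'a::field) set \<Rightarrow> ('i \<Rightarrow> 'k) set \<Rightarrow> ('i \<Rightarrow> 'a) set" where
  "reduction G U = {v. \<exists>w\<in>U. \<forall>i. (w i, v i) \<in> G}"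

text \<open>An echelon basis with entries in the valuation ring reduces to an echelon basis with the
  same pivots, as its identity block is preserved. That the dimension survives is the properness of
  the Grassmannian.\<close>

lemma reduction_props:
  fixes U :: "(nat \<Rightarrow> 'k::field) set" and G :: "('k \<times> 'a::field) set"
  assumes G: "hom_graph G" and onto: "\<And>c. \<exists>x. (x, c) \<in> G"
    and val: "\<And>x. x \<in> Domain G \<or> inverse x \<in> Domain G"
    and U: "fs.subspace U" "U \<subseteq> coord_space d"
  shows "fs.subspace (reduction G U)" "reduction G U \<subseteq> coord_space d"
    "fs.dim (reduction G U) = fs.dim U"
proof -
  note hG = hom_graphD[OF G]
  show "fs.subspace (reduction G U)"
  proof (rule fs.subspaceI)
    show "0 \<in> reduction G U"
      unfolding reduction_def using fs.subspace_0[OF U(1)] hG(2) by (intro CollectI bexI[of _ 0]) auto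
    fix v v' assume "v \<in> reduction G U" "v' \<in> reduction G U"
    then obtain w w' where "w \<in> U" "w' \<in> U" "\<And>i. (w i, v i) \<in> G" "\<And>i. (w' i, v' i) \<in> G"
      by (auto simp: reduction_def)
    then show "v + v' \<in> reduction G U"
      unfolding reduction_def by (intro CollectI bexI[of _ "w + w'"]) (auto intro: hG(3) fs.subspace_add[OF U(1)])
  next
    fix c v assume "v \<in> reduction G U"
    then obtain w where w: "w \<in> U" "\<And>i. (w i, v i) \<in> G" by (auto simp: reduction_def)
    obtain x where "(x, c) \<in> G" using onto by blast
    then show "fsc c v \<in> reduction G U"
      unfolding reduction_def using w
      by (intro CollectI bexI[of _ "fsc x w"]) (auto simp: fsc_apply intro: hG(4) fs.subspace_scale[OF U(1)])
  qed
  show "reduction G U \<subseteq> coord_space d"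
  proof
    fix v assume "v \<in> reduction G U"
    then obtain w where w: "w \<in> U" "\<And>i. (w i, v i) \<in> G" by (auto simp: reduction_def)
    have "v i = 0" if "i \<ge> d" for i
    proof -
      have "w i = 0" using w(1) U(2) that by (auto simp: coord_space_def)
      then show ?thesis using w(2)[of i] hG(6) by simp
    qed
    then show "v \<in> coord_space d" by (simp add: coord_space_def)
  qed
  obtain P u where P: "pivot_basis U P u" and uG: "\<forall>p\<in>P. \<forall>i. u p i \<in> Domain G"
    using pivot_basis_exists[OF place_valuation_ring[OF G val] U(1), of "{..<d}"] U(2)
    by (auto simp: coord_space_def subset_iff)
  have "\<forall>p i. \<exists>c. p \<in> P \<longrightarrow> (u p i, c) \<in> G" using uG by blast
  then obtain u0 where u0: "\<And>p i. p \<in> P \<Longrightarrow> (u p i, u0 p i) \<in> G" by metis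
  have "pivot_basis (reduction G U) P u0"
    unfolding pivot_basis_def
  proof (intro conjI ballI allI)
    show "finite P" using P by (simp add: pivot_basis_def)
    fix p assume p: "p \<in> P"
    show "u0 p \<in> reduction G U" unfolding reduction_def
      using P p u0 by (intro CollectI bexI[of _ "u p"]) (auto simp: pivot_basis_def)
    fix q assume q: "q \<in> P"
    have "u p q = (if p = q then 1 else 0)" using P p q by (simp add: pivot_basis_def)
    then show "u0 p q = (if p = q then 1 else 0)"
      using u0[OF p, of q] hG(7)[of 1 1 "u0 p q"] hG(1) hG(6)[of "u0 p q"] by (auto split: if_splits)
  next
    fix v i assume "v \<in> reduction G U"
    then obtain w where w: "w \<in> U" "\<And>i. (w i, v i) \<in> G" by (auto simp: reduction_def)
    have "(\<Sum>p\<in>P. w p * u p i, \<Sum>p\<in>P. v p * u0 p i) \<in> G"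
      by (intro hom_graph_sum[OF G] hG(4) w(2) u0)
    moreover have "w i = (\<Sum>p\<in>P. w p * u p i)" using P w(1) unfolding pivot_basis_def by blast
    ultimately show "v i = (\<Sum>p\<in>P. v p * u0 p i)" using w(2)[of i] hG(7)[of "w i"] by simp
  qed
  then show "fs.dim (reduction G U) = fs.dim U"
    using pivot_basis_dim P by metis
qed

lemma mat_rep_reduction:
  assumes G: "hom_graph G" and M: "\<And>i q. i < d1 \<Longrightarrow> q < d2 \<Longrightarrow> (M k i q, M0 k i q) \<in> G"
    and f: "mat_rep d1 d2 M k ` U \<subseteq> W"
  shows "mat_rep d1 d2 M0 k ` reduction G U \<subseteq> reduction G W"
proof
  fix y assume "y \<in> mat_rep d1 d2 M0 k ` reduction G U"
  then obtain v w where vw: "y = mat_rep d1 d2 M0 k v" "w \<in> U" "\<And>i. (w i, v i) \<in> G"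
    by (auto simp: reduction_def)
  have "(mat_rep d1 d2 M k w q, y q) \<in> G" for q
    unfolding vw mat_rep_def using hom_graphD(2)[OF G] M vw(3)
    by (auto intro!: hom_graph_sum[OF G] hom_graphD(4)[OF G])
  then show "y \<in> reduction G W" using f vw(2) unfolding reduction_def by blast
qed

lemma graph_subspace:
  fixes a :: "nat \<Rightarrow> nat \<Rightarrow> 'k::field"
  assumes e: "e \<le> d"
  defines "U \<equiv> {v \<in> coord_space d. \<forall>p\<in>{e..<d}. v p = (\<Sum>j<e. v j * a j p)}"
  shows "fs.subspace U" "fs.dim U = e"
proof -
  show "fs.subspace U"
    by (auto simp: U_def fs.subspace_def coord_space_def fsc_apply algebra_simps sum.distrib sum_distrib_left)
  define u where "u = (\<lambda>j i. if i < e then (if i = j then 1 else 0) else if i < d then a j i else 0)"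
  have "pivot_basis U {..<e} u"
    unfolding pivot_basis_def
  proof (intro conjI ballI allI)
    fix p q assume p: "p \<in> {..<e}" and q: "q \<in> {..<e}"
    show "u p q = (if p = q then 1 else 0)" using q by (simp add: u_def)
  next
    fix p assume p: "p \<in> {..<e}"
    have "(\<Sum>j<e. u p j * a j i) = a p i" for i
    proof -
      have "(\<Sum>j<e. u p j * a j i) = (\<Sum>j<e. if j = p then a j i else 0)"
        by (rule sum.cong) (auto simp: u_def)
      then show ?thesis using p by simp
    qed
    then show "u p \<in> U" using e by (auto simp: U_def coord_space_def u_def)
  next
    fix v i assume v: "v \<in> U"
    show "v i = (\<Sum>p\<in>{..<e}. v p * u p i)"
    proof (cases "i < e")
      case True
      have "(\<Sum>p<e. v p * u p i) = (\<Sum>p<e. if p = i then v p else 0)"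
        using True by (intro sum.cong) (auto simp: u_def)
      then show ?thesis using True by simp
    next
      case False
      then show ?thesis using v by (cases "i < d") (auto simp: U_def u_def coord_space_def)
    qed
  qed simp
  then show "fs.dim U = e" using pivot_basis_dim by fastforce
qed

lemma fps_to_fls_sum: "fps_to_fls (sum f A) = (\<Sum>i\<in>A. fps_to_fls (f i))"
  by (induction A rule: infinite_finite_induct) auto

text \<open>On the line \<open>M + s (M0 - M)\<close> the
  subrepresentation of \<open>M\<close> deforms formally along \<open>s = 0\<close>, and a place of the field of Laurent series
  that sends \<open>s\<close> to \<open>1\<close> specialises the deformed subrepresentation to one of \<open>M0\<close>.\<close>

lemma subrep_of_every_rep:
  fixes M M0 :: "nat \<Rightarrow> nat \<Rightarrow> nat \<Rightarrow> 'a::alg_closed_field"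
  assumes e: "e1 \<le> d1" "e2 \<le> d2"
    and block: "\<And>k j q. j < e1 \<Longrightarrow> q \<in> {e2..<d2} \<Longrightarrow> M k j q = 0"
      "\<And>k p r. p \<in> {e1..<d1} \<Longrightarrow> r < e2 \<Longrightarrow> M k p r = 0"
    and ext: "ext_vanishing m d1 d2 e1 e2 M"
  obtains U W where "fs.subspace U" "U \<subseteq> coord_space d1" "fs.dim U = e1"
    "fs.subspace W" "W \<subseteq> coord_space d2" "fs.dim W = e2" "\<And>k. k < m \<Longrightarrow> mat_rep d1 d2 M0 k ` U \<subseteq> W"
proof -
  define N where "N = (\<lambda>k i q. M0 k i q - M k i q)"
  obtain a b :: "nat \<Rightarrow> nat \<Rightarrow> 'a fps" where ab: "\<And>k j q. k < m \<Longrightarrow> j < e1 \<Longrightarrow> q \<in> {e2..<d2} \<Longrightarrow>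
    (\<Sum>p\<in>{e1..<d1}. fps_const (M k p q) * a j p) - (\<Sum>r<e2. b r q * fps_const (M k j r)) =
    fps_X * ((\<Sum>r<e2. b r q * (fps_const (N k j r) + (\<Sum>p\<in>{e1..<d1}. fps_const (N k p r) * a j p)))
      - fps_const (N k j q) - (\<Sum>p\<in>{e1..<d1}. fps_const (N k p q) * a j p))"
    by (rule riccati_lift[OF ext_vanishing_surjective[OF ext], of N]) (erule that)
  define F where "F = (\<lambda>k i q. fps_const (M k i q) + fps_X * fps_const (N k i q))"
  \<comment> \<open>The image of the j-th basis vector of the graph of \<open>a\<close> under M + s
    N; the claim \<open>C\<close> puts it into the graph of \<open>b\<close>.\<close>
  define C where "C = (\<lambda>k j q. F k j q + (\<Sum>p\<in>{e1..<d1}. a j p * F k p q))"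
  have C: "C k j q = (\<Sum>r<e2. C k j r * b r q)" if kjq: "k < m" "j < e1" "q \<in> {e2..<d2}" for k j q
  proof -
    have Cr: "C k j r = fps_const (M k j r) + fps_X * (fps_const (N k j r) + (\<Sum>p\<in>{e1..<d1}. fps_const (N k p r) * a j p))"
      if "r < e2" for r
    proof -
      have "(\<Sum>p\<in>{e1..<d1}. a j p * F k p r) = (\<Sum>p\<in>{e1..<d1}. fps_X * (fps_const (N k p r) * a j p))"
        by (rule sum.cong) (use that block(2) in \<open>auto simp: F_def algebra_simps\<close>)
      then show ?thesis by (simp add: C_def F_def algebra_simps sum_distrib_left)
    qed
    have "C k j q = fps_X * fps_const (N k j q) + (\<Sum>p\<in>{e1..<d1}. fps_const (M k p q) * a j p)
        + fps_X * (\<Sum>p\<in>{e1..<d1}. fps_const (N k p q) * a j p)"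
      using kjq block(1)[of j q k] by (simp add: C_def F_def algebra_simps sum.distrib sum_distrib_left)
    also have "\<dots> = (\<Sum>r<e2. b r q * fps_const (M k j r)) +
        fps_X * (\<Sum>r<e2. b r q * (fps_const (N k j r) + (\<Sum>p\<in>{e1..<d1}. fps_const (N k p r) * a j p)))"
      using ab[OF kjq] by (simp add: algebra_simps)
    also have "\<dots> = (\<Sum>r<e2. b r q * fps_const (M k j r) +
        fps_X * (b r q * (fps_const (N k j r) + (\<Sum>p\<in>{e1..<d1}. fps_const (N k p r) * a j p))))"
      by (simp add: sum.distrib sum_distrib_left)
    also have "\<dots> = (\<Sum>r<e2. C k j r * b r q)"
      by (rule sum.cong) (simp_all add: Cr algebra_simps)
    finally show ?thesis .
  qed
  define Ms where "Ms = (\<lambda>k i q. fps_to_fls (F k i q))"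
  define U where "U = {v \<in> coord_space d1. \<forall>p\<in>{e1..<d1}. v p = (\<Sum>j<e1. v j * fps_to_fls (a j p))}"
  define W where "W = {v \<in> coord_space d2. \<forall>p\<in>{e2..<d2}. v p = (\<Sum>j<e2. v j * fps_to_fls (b j p))}"
  note U = graph_subspace[OF e(1), of "\<lambda>j p. fps_to_fls (a j p)", folded U_def]
  note W = graph_subspace[OF e(2), of "\<lambda>j p. fps_to_fls (b j p)", folded W_def]
  have UW: "mat_rep d1 d2 Ms k ` U \<subseteq> W" if k: "k < m" for k
  proof
    fix w assume "w \<in> mat_rep d1 d2 Ms k ` U"
    then obtain v where v: "v \<in> U" "w = mat_rep d1 d2 Ms k v" by auto
    have w: "w q = (\<Sum>j<e1. v j * fps_to_fls (C k j q))" if "q < d2" for q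
    proof -
      have "w q = (\<Sum>i\<in>{..<e1} \<union> {e1..<d1}. v i * Ms k i q)"
        using that e(1) by (simp add: v mat_rep_def ivl_disj_un(8))
      also have "\<dots> = (\<Sum>j<e1. v j * Ms k j q) + (\<Sum>p\<in>{e1..<d1}. v p * Ms k p q)"
        by (rule sum.union_disjoint) auto
      also have "(\<Sum>p\<in>{e1..<d1}. v p * Ms k p q) =
          (\<Sum>p\<in>{e1..<d1}. \<Sum>j<e1. v j * fps_to_fls (a j p * F k p q))"
        using v(1) by (intro sum.cong) (auto simp: U_def Ms_def sum_distrib_right fls_times_fps_to_fls mult.assoc)
      also have "\<dots> = (\<Sum>j<e1. v j * (\<Sum>p\<in>{e1..<d1}. fps_to_fls (a j p * F k p q)))"
        by (subst sum.swap) (simp add: sum_distrib_left)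
      finally show ?thesis
        by (simp add: C_def Ms_def fps_to_fls_sum sum.distrib algebra_simps)
    qed
    have "w q = (\<Sum>r<e2. w r * fps_to_fls (b r q))" if q: "q \<in> {e2..<d2}" for q
    proof -
      have "w q = (\<Sum>j<e1. \<Sum>r<e2. v j * fps_to_fls (C k j r * b r q))"
        using w[of q] q C[OF k _ q] by (simp add: fps_to_fls_sum sum_distrib_left)
      also have "\<dots> = (\<Sum>r<e2. w r * fps_to_fls (b r q))"
        using w e(2) by (subst sum.swap) (simp add: sum_distrib_right fls_times_fps_to_fls mult.assoc)
      finally show ?thesis .
    qed
    then show "w \<in> W" by (auto simp: W_def v(2) coord_space_def mat_rep_def)
  qed
  \<comment> \<open>Evaluation at s = 1 on polynomials in s. The entries of \<open>Ms\<close> are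
    such polynomials and keep their values in any extension, whereas those of \<open>a\<close> and
    \<open>b\<close> may acquire poles; \<open>reduction\<close> copes with these.\<close>
  define G0 :: "('a fls \<times> 'a) set" where "G0 = {(fps_to_fls (fps_of_poly p), poly p 1) | p. True}"
  have G0: "(fps_to_fls (fps_of_poly p), poly p 1) \<in> G0" for p by (auto simp: G0_def)
  have "hom_graph G0"
    unfolding hom_graph_def
  proof (intro conjI allI impI)
    show "(1, 1) \<in> G0" using G0[of 1] by simp
    fix x c assume "(x, c) \<in> G0"
    then obtain p where p: "x = fps_to_fls (fps_of_poly p)" "c = poly p 1" by (auto simp: G0_def)
    show "(- x, - c) \<in> G0" using G0[of "- p"] by (simp add: p fps_of_poly_uminus)
    fix y d assume "(y, d) \<in> G0"
    then obtain q where q: "y = fps_to_fls (fps_of_poly q)" "d = poly q 1" by (auto simp: G0_def)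
    show "(x + y, c + d) \<in> G0" using G0[of "p + q"] by (simp add: p q fps_of_poly_add)
    show "(x * y, c * d) \<in> G0" using G0[of "p * q"] by (simp add: p q fps_of_poly_mult fls_times_fps_to_fls)
  next
    fix c assume "(0, c) \<in> G0"
    then obtain p where "fps_to_fls (fps_of_poly p) = 0" "c = poly p 1" by (auto simp: G0_def)
    then show "c = 0" using fps_of_poly_eq_iff[of p 0] by simp
  qed
  moreover have onto0: "\<exists>x. (x, c) \<in> G0" for c using G0[of "[:c:]"] by auto
  ultimately obtain G where G: "G0 \<subseteq> G" "hom_graph G" "\<And>x. x \<in> Domain G \<or> inverse x \<in> Domain G"
    using place_extension by metis
  have onto: "\<exists>x. (x, c) \<in> G" for c using onto0 G(1) by blast
  have MsG: "(Ms k i q, M0 k i q) \<in> G" for k i q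
    using G0[of "[:M k i q, N k i q:]"] G(1)
    by (auto simp: Ms_def F_def N_def fps_of_poly_pCons algebra_simps)
  have "U \<subseteq> coord_space d1" "W \<subseteq> coord_space d2" by (auto simp: U_def W_def)
  note rU = reduction_props[OF G(2) onto G(3) U(1) this(1)]
    and rW = reduction_props[OF G(2) onto G(3) W(1) this(2)]
  have "mat_rep d1 d2 M0 k ` reduction G U \<subseteq> reduction G W" if "k < m" for k
    by (rule mat_rep_reduction[OF G(2) _ UW[OF that]]) (rule MsG)
  then show thesis
    using that[of "reduction G U" "reduction G W"] rU rW U(2) W(2) by blast
qed

section \<open>Optimality of the bound\<close>

text \<open>The Tits form \<open>\<langle>b, b\<rangle>\<close> of the dimension vector \<open>b = (1 - x, \<alpha> - t * x)\<close>.\<close>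

definition quot_form :: "real \<Rightarrow> real \<Rightarrow> real \<Rightarrow> real \<Rightarrow> real" where
  "quot_form m \<alpha> x t = (1 - x)^2 - m * (1 - x) * (\<alpha> - t * x) + (\<alpha> - t * x)^2"

text \<open>\<open>1 - x\<close> and \<open>\<alpha> - t * x\<close> are the components of the
  quotient dimension vector, divided by d1.\<close>

lemma euler_fn_alt: "euler_fn m \<alpha> x t = (1 - x) + (t - m) * (\<alpha> - t * x)"
  by (simp add: euler_fn_def algebra_simps power2_eq_square)

text \<open>At \<open>x = \<delta>\<close> and the critical slope the Euler form is 0, while the
  quotient is positive with negative Tits form. These are open conditions: \<open>t\<close> is
  raised to a rational number, which makes the Euler form positive, and then \<open>x\<close> is
  lowered to one, since \<open>\<delta>\<close> may be irrational.\<close>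

lemma rational_above_crit_slope:
  fixes m :: nat
  assumes \<delta>: "0 < \<delta>" "\<delta> < 1" and q: "\<alpha>^2 - real m * \<alpha> + 1 < 0"
    and pos: "real m * \<delta> + \<alpha> - 2 * \<alpha> * \<delta> > 0" and \<beta>: "crit_slope m \<alpha> \<delta> < \<beta>"
  obtains x t where "x \<in> \<rat>" "t \<in> \<rat>" "0 < x" "x \<le> \<delta>" "0 < t" "t < \<beta>" "euler_fn m \<alpha> x t > 0"
    "\<alpha> - t * x > 0" "quot_form m \<alpha> x t < 0"
proof -
  define t0 where "t0 = crit_slope m \<alpha> \<delta>"
  note \<alpha> = quadratic_neg_bounds[OF _ q, simplified]
  have t0: "\<alpha> < t0" "t0 < m"
    using eps_m_pos[OF \<delta> q pos] \<alpha> crit_slope_less[OF \<delta> q] unfolding t0_def crit_slope_def by auto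
  have "\<delta> * euler_fn m \<alpha> \<delta> t0 = 0" by (simp add: euler_fn_factor[OF \<delta> q] t0_def)
  then have e0: "euler_fn m \<alpha> \<delta> t0 = 0" using \<delta> by simp
  define w where "w = \<alpha> - t0 * \<delta>"
  \<comment> \<open>Vanishing of the Euler form makes the quotient \<open>w\<close> times (m - t0,
    1), a vector with the same Tits form as (1, t0).\<close>
  have w1: "1 - \<delta> = (m - t0) * w" using e0 unfolding euler_fn_alt w_def by (simp add: algebra_simps)
  then have "(m - t0) * w > 0" using \<delta> by linarith
  then have w: "w > 0" using t0 by (simp add: zero_less_mult_iff)
  \<comment> \<open>The Tits form of (1, t0) is minus the slope in \<open>x\<close> of an affine
    function that is 0 at \<open>\<delta>\<close> and positive at 1.\<close>
  have "euler_fn m \<alpha> 1 t0 = euler_fn m \<alpha> \<delta> t0 - (1 - \<delta>) * (1 + t0^2 - m * t0)"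
    by (simp add: euler_fn_def algebra_simps)
  moreover have "euler_fn m \<alpha> 1 t0 = (t0 - \<alpha>) * (m - t0)" by (simp add: euler_fn_def algebra_simps power2_eq_square)
  moreover have "(t0 - \<alpha>) * (m - t0) > 0" using t0 by simp
  ultimately have "(1 - \<delta>) * (1 + t0^2 - m * t0) < 0" using e0 by linarith
  then have r: "1 + t0^2 - m * t0 < 0" using \<delta> by (simp add: mult_less_0_iff)
  have "quot_form m \<alpha> \<delta> t0 = (w * w) * (1 + t0^2 - m * t0)"
    unfolding quot_form_def w1 w_def[symmetric] by (simp add: algebra_simps power2_eq_square)
  then have q0: "quot_form m \<alpha> \<delta> t0 < 0" using w r by (simp add: mult_pos_neg)
  have "\<forall>\<^sub>F t in at_right t0. quot_form m \<alpha> \<delta> t < 0"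
    by (rule order_tendstoD(2)[OF _ q0]) (auto simp: quot_form_def intro!: tendsto_eq_intros)
  moreover have "\<forall>\<^sub>F t in at_right t0. \<alpha> - t * \<delta> > 0"
    by (rule order_tendstoD(1)[OF _ w]) (auto simp: w_def intro!: tendsto_eq_intros)
  moreover have "\<forall>\<^sub>F t in at_right t0. \<delta> * t < real m * \<delta> + \<alpha> - \<delta> * t0"
    by (rule order_tendstoD(2)[OF _ crit_slope_gap[OF \<delta> q, folded t0_def]]) (auto intro!: tendsto_eq_intros)
  moreover have "\<forall>\<^sub>F t in at_right t0. t < \<beta>"
    by (rule order_tendstoD(2)[OF tendsto_ident_at]) (use \<beta> in \<open>simp add: t0_def\<close>)
  ultimately have "\<forall>\<^sub>F t in at_right t0. quot_form m \<alpha> \<delta> t < 0 \<and> \<alpha> - t * \<delta> > 0 \<and>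
      \<delta> * t < real m * \<delta> + \<alpha> - \<delta> * t0 \<and> t < \<beta>"
    by eventually_elim auto
  then obtain t1 where t1: "t1 > t0" "\<And>t. t0 < t \<Longrightarrow> t < t1 \<Longrightarrow> quot_form m \<alpha> \<delta> t < 0 \<and> \<alpha> - t * \<delta> > 0 \<and>
      \<delta> * t < real m * \<delta> + \<alpha> - \<delta> * t0 \<and> t < \<beta>"
    unfolding eventually_at_right_field by blast
  obtain t where t: "t \<in> \<rat>" "t0 < t" "t < t1" using Rats_dense_in_real[OF t1(1)] by blast
  note t' = t1(2)[OF t(2,3)]
  have "\<delta> * euler_fn m \<alpha> \<delta> t > 0"
    unfolding euler_fn_factor[OF \<delta> q] t0_def[symmetric] using t t' \<delta> by (intro mult_pos_pos) auto
  then have et: "euler_fn m \<alpha> \<delta> t > 0" using \<delta> by (simp add: zero_less_mult_iff)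
  have "\<forall>\<^sub>F x in at_left \<delta>. quot_form m \<alpha> x t < 0"
    by (rule order_tendstoD(2)[OF _ t'[THEN conjunct1]]) (auto simp: quot_form_def intro!: tendsto_eq_intros)
  moreover have "\<forall>\<^sub>F x in at_left \<delta>. \<alpha> - t * x > 0"
    by (rule order_tendstoD(1)[OF _ t'[THEN conjunct2, THEN conjunct1]]) (auto intro!: tendsto_eq_intros)
  moreover have "\<forall>\<^sub>F x in at_left \<delta>. euler_fn m \<alpha> x t > 0"
    by (rule order_tendstoD(1)[OF _ et]) (auto simp: euler_fn_def intro!: tendsto_eq_intros)
  moreover have "\<forall>\<^sub>F x in at_left \<delta>. x > 0"
    by (rule order_tendstoD(1)[OF tendsto_ident_at \<delta>(1)])
  ultimately have "\<forall>\<^sub>F x in at_left \<delta>. quot_form m \<alpha> x t < 0 \<and> \<alpha> - t * x > 0 \<and> euler_fn m \<alpha> x t > 0 \<and> x > 0"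
    by eventually_elim auto
  then obtain x1 where x1: "x1 < \<delta>" "\<And>x. x1 < x \<Longrightarrow> x < \<delta> \<Longrightarrow>
      quot_form m \<alpha> x t < 0 \<and> \<alpha> - t * x > 0 \<and> euler_fn m \<alpha> x t > 0 \<and> x > 0"
    unfolding eventually_at_left_field by blast
  obtain x where x: "x \<in> \<rat>" "x1 < x" "x < \<delta>" using Rats_dense_in_real[OF x1(1)] by blast
  show thesis
    by (rule that[of x t]) (use x x1(2)[OF x(2,3)] t t' t0 \<alpha> in auto)
qed

section \<open>Integral dimension vectors and the failure of expansion\<close>

lemma rational_denominator:
  assumes "r \<in> \<rat>" "r \<ge> 0"
  obtains n :: nat where "n > 0" "\<And>c. \<exists>k::nat. r * real (c * n) = real k"
proof -
  from Rats_abs_nat_div_natE[OF assms(1)] obtain a n :: nat where "n \<noteq> 0" "\<bar>r\<bar> = real a / real n" .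
  then have *: "r * real n = real a" "n > 0" using assms(2) by (auto simp: field_simps)
  show thesis
  proof (rule that[OF *(2)])
    fix c show "\<exists>k::nat. r * real (c * n) = real k"
      using *(1) by (intro exI[of _ "c * a"]) (simp add: algebra_simps)
  qed
qed

lemma Km_rep_eq_mat_rep:
  assumes f: "Km_rep m d1 d2 f" and k: "k < m" and v: "v \<in> coord_space d1"
  shows "f k v = mat_rep d1 d2 (\<lambda>k i. f k (\<lambda>j. if j = i then 1 else 0)) k v"
proof -
  define b :: "nat \<Rightarrow> nat \<Rightarrow> 'a" where "b = (\<lambda>i j. if j = i then 1 else 0)"
  have lin: "f k (u + w) = f k u + f k w" "f k (fsc c u) = fsc c (f k u)" for u w c
    using f k unfolding Km_rep_def fscale_eq_fsc Vector_Spaces.linear_iff by blast+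
  have f0: "f k 0 = 0" using lin(2)[of 0 0] by (simp add: fsc_def zero_fun_def)
  have sum: "f k (\<Sum>i\<in>A. fsc (c i) (b i)) = (\<Sum>i\<in>A. fsc (c i) (f k (b i)))" for A c
    by (induction A rule: infinite_finite_induct)
      (simp_all only: sum.infinite sum.empty sum.insert lin f0 not_False_eq_True)
  have v_eq: "v = (\<Sum>i<d1. fsc (v i) (b i))"
  proof
    fix j show "v j = (\<Sum>i<d1. fsc (v i) (b i)) j"
      using v by (simp add: sum_fun_apply fsc_apply b_def coord_space_def if_distrib cong: if_cong)
  qed
  show ?thesis
  proof
    fix q
    have "f k v = (\<Sum>i<d1. fsc (v i) (f k (b i)))" using sum[of v "{..<d1}"] v_eq by simp
    then have *: "f k v q = (\<Sum>i<d1. v i * f k (b i) q)" by (simp add: sum_fun_apply fsc_apply)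
    have "f k v \<in> coord_space d2" using f k v by (auto simp: Km_rep_def)
    then show "f k v q = mat_rep d1 d2 (\<lambda>k i. f k (\<lambda>j. if j = i then 1 else 0)) k v q"
      using * by (auto simp: mat_rep_def b_def coord_space_def)
  qed
qed

text \<open>The ambient function space has infinite dimension, so the comparison goes through a
  finite spanning set of \<open>W\<close>.\<close>

lemma dim_mono_coord_space:
  assumes "fs.subspace W" "W \<subseteq> coord_space d" "V \<subseteq> W"
  shows "fs.dim V \<le> fs.dim W"
proof -
  obtain P u where u: "pivot_basis W P u"
    using pivot_basis_exists[OF valuation_ring_UNIV assms(1), of "{..<d}"] assms(2)
    by (auto simp: coord_space_def subset_iff)
  have "V \<subseteq> fs.span (u ` P)"
  proof
    fix v assume "v \<in> V"
    then have eq: "v = (\<Sum>p\<in>P. fsc (v p) (u p))" using pivot_basis_expand[OF u] assms(3) by blast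
    show "v \<in> fs.span (u ` P)" by (subst eq, rule span_combination) auto
  qed
  moreover have "finite P" using u by (simp add: pivot_basis_def)
  ultimately have "fs.dim V \<le> card (u ` P)" by (intro fs.dim_le_card) auto
  also have "\<dots> \<le> card P" using \<open>finite P\<close> by (rule card_image_le)
  finally show ?thesis by (simp add: pivot_basis_dim[OF u])
qed

text \<open>For e = (l0, w0) and the quotient (y, x), \<open>ext\<close> is positivity of the Euler
  form. The representation \<open>D\<close> has dimension vector (x, y), and \<open>b\<close> copies
  of its transpose form the quotient block.\<close>

lemma subrep_of_every_rep_multiple:
  fixes M0 :: "nat \<Rightarrow> nat \<Rightarrow> nat \<Rightarrow> nat \<Rightarrow> nat \<Rightarrow> 'a::alg_closed_field"
  assumes x: "x > 0" and y: "y > 0" and q: "(real y / real x)^2 - real m * (real y / real x) + 1 < 0"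
    and ext: "m * x * l0 < x * w0 + y * l0"
  obtains b where "b > 0" "\<And>M0 :: nat \<Rightarrow> nat \<Rightarrow> nat \<Rightarrow> 'a::alg_closed_field. \<exists>U W. fs.subspace U \<and> U \<subseteq> coord_space (b * l0 + b * y) \<and> fs.dim U = b * l0 \<and>
    fs.subspace W \<and> W \<subseteq> coord_space (b * w0 + b * x) \<and> fs.dim W = b * w0 \<and>
    (\<forall>k<m. mat_rep (b * l0 + b * y) (b * w0 + b * x) M0 k ` U \<subseteq> W)"
proof -
  have inf: "infinite (UNIV :: 'a set)" by (rule alg_closed_infinite)
  define s where "s = real y / real x"
  have s: "real y = s * real x" using x by (simp add: s_def)
  define C where "C = x * (x * x + m * x * (m * x))"
  \<comment> \<open>The gap in \<open>ext\<close> is at least 1; scaled by \<open>b\<close> it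
    exceeds \<open>C\<close>, the part of the count that does not scale.\<close>
  define b where "b = C + 1"
  define v' where "v' = b * l0"
  define w' where "w' = b * w0"
  have "s < real m" using quadratic_neg_bounds(2)[OF _ q] by (simp add: s_def)
  then have "real y \<le> real m * real x" unfolding s using x by (intro mult_right_mono) auto
  then have ym: "y \<le> m * x" by (metis of_nat_le_iff of_nat_mult)
  have large: "C + m * x * v' < x * w' + y * v'"
  proof -
    have "C + m * x * v' < b + b * (m * x * l0)" by (simp add: b_def v'_def algebra_simps)
    also have "\<dots> = b * Suc (m * x * l0)" by simp
    also have "\<dots> \<le> b * (x * w0 + y * l0)" using ext by (intro mult_left_mono) auto
    finally show ?thesis by (simp add: v'_def w'_def algebra_simps)
  qed
  obtain D :: "nat \<Rightarrow> nat \<Rightarrow> nat \<Rightarrow> 'a" where D: "semistable s m x y D"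
    by (rule semistable_rep_exists[OF inf x s q[folded s_def]]) (erule that)
  obtain A :: "nat \<Rightarrow> nat \<Rightarrow> nat \<Rightarrow> 'a" where A:
    "\<And>g k i j. (\<And>l j. l < y \<Longrightarrow> j < v' \<Longrightarrow> (\<Sum>k<m. \<Sum>i<x. D k i l * g k i j) = 0) \<Longrightarrow>
      (\<And>i q. i < x \<Longrightarrow> q < w' \<Longrightarrow> (\<Sum>k<m. \<Sum>j<v'. A k j q * g k i j) = 0) \<Longrightarrow>
      k < m \<Longrightarrow> i < x \<Longrightarrow> j < v' \<Longrightarrow> g k i j = 0"
    by (rule generic_ext_vanishing[OF inf D x s ym large[unfolded C_def]]) (erule that)
  define d1 where "d1 = v' + b * y"
  define d2 where "d2 = w' + b * x"
  \<comment> \<open>Block diagonal: \<open>A\<close>, then \<open>b\<close> transposed copies of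
    \<open>D\<close>. Quotients by \<open>y\<close> and \<open>x\<close> number the copies,
    remainders give the position inside a copy.\<close>
  define M where "M = (\<lambda>k i q. if i < v' then (if q < w' then A k i q else 0) else if q < w' then 0
     else if (i - v') div y = (q - w') div x then D k ((q - w') mod x) ((i - v') mod y) else 0)"
  have MD: "M k (v' + (\<beta> * y + l)) (w' + (\<beta>' * x + i)) = (if \<beta> = \<beta>' then D k i l else 0)"
    if "l < y" "i < x" for k \<beta> \<beta>' l i
    using that by (simp add: M_def)
  have dual: "g k q j = 0"
    if g1: "\<And>p j. p \<in> {v'..<d1} \<Longrightarrow> j < v' \<Longrightarrow> (\<Sum>k<m. \<Sum>q\<in>{w'..<d2}. M k p q * g k q j) = 0"
    and g2: "\<And>r q. r < w' \<Longrightarrow> q \<in> {w'..<d2} \<Longrightarrow> (\<Sum>k<m. \<Sum>j<v'. M k j r * g k q j) = 0"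
    and kqj: "k < m" "q \<in> {w'..<d2}" "j < v'" for g :: "nat \<Rightarrow> nat \<Rightarrow> nat \<Rightarrow> 'a" and k q j
  proof -
    define \<beta> where "\<beta> = (q - w') div x"
    define i where "i = (q - w') mod x"
    have i: "i < x" using x by (simp add: i_def)
    have "q - w' < b * x" using kqj by (auto simp: d2_def)
    then have \<beta>: "\<beta> < b" unfolding \<beta>_def by (rule less_mult_imp_div_less)
    have qeq: "q = w' + (\<beta> * x + i)" using kqj by (simp add: \<beta>_def i_def)
    have \<beta>x: "\<beta> * x + x \<le> b * x" using mult_le_mono1[of "Suc \<beta>" b x] \<beta> by simp
    have \<beta>y: "\<beta> * y + y \<le> b * y" using mult_le_mono1[of "Suc \<beta>" b y] \<beta> by simp
    \<comment> \<open>The part of \<open>g\<close> at copy \<open>\<beta>\<close> satisfies the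
      equations of a tensor for \<open>A\<close> and \<open>D\<close> alone, so it vanishes.\<close>
    have "(\<lambda>k i j. g k (w' + (\<beta> * x + i)) j) k i j = 0"
    proof (rule A[OF _ _ kqj(1) i kqj(3)])
      fix l j assume l: "l < y" and j: "j < v'"
      have "(\<Sum>q\<in>{w'..<d2}. M k (v' + (\<beta> * y + l)) q * g k q j) =
          (\<Sum>i<x. D k i l * g k (w' + (\<beta> * x + i)) j)" for k
      proof -
        have "(\<Sum>q\<in>{w'..<d2}. M k (v' + (\<beta> * y + l)) q * g k q j) =
          (\<Sum>q\<in>(\<lambda>i. w' + (\<beta> * x + i)) ` {..<x}. M k (v' + (\<beta> * y + l)) q * g k q j)"
        proof (rule sum.mono_neutral_right)
          show "(\<lambda>i. w' + (\<beta> * x + i)) ` {..<x} \<subseteq> {w'..<d2}" using \<beta>x by (auto simp: d2_def)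
          show "\<forall>q\<in>{w'..<d2} - (\<lambda>i. w' + (\<beta> * x + i)) ` {..<x}. M k (v' + (\<beta> * y + l)) q * g k q j = 0"
          proof
            fix q assume q: "q \<in> {w'..<d2} - (\<lambda>i. w' + (\<beta> * x + i)) ` {..<x}"
            have *: "q = w' + ((q - w') div x * x + (q - w') mod x)" using q by simp
            have "(q - w') div x \<noteq> \<beta>"
            proof
              assume "(q - w') div x = \<beta>"
              then have "q = w' + (\<beta> * x + (q - w') mod x)" using * by simp
              moreover have "(q - w') mod x \<in> {..<x}" using x by simp
              ultimately show False using q by blast
            qed
            then have "M k (v' + (\<beta> * y + l)) q = 0"
              using MD[OF l mod_less_divisor[OF x], of k \<beta> "(q - w') div x" "q - w'"] * by simp
            then show "M k (v' + (\<beta> * y + l)) q * g k q j = 0" by simp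
          qed
        qed simp
        also have "\<dots> = (\<Sum>i<x. M k (v' + (\<beta> * y + l)) (w' + (\<beta> * x + i)) * g k (w' + (\<beta> * x + i)) j)"
          by (subst sum.reindex) (auto simp: inj_on_def)
        also have "\<dots> = (\<Sum>i<x. D k i l * g k (w' + (\<beta> * x + i)) j)"
          by (rule sum.cong) (auto simp: MD l)
        finally show ?thesis .
      qed
      then show "(\<Sum>k<m. \<Sum>i<x. D k i l * g k (w' + (\<beta> * x + i)) j) = 0"
        using g1[of "v' + (\<beta> * y + l)" j] l j \<beta>y by (simp add: d1_def)
    next
      fix i r assume "i < x" "r < w'"
      then show "(\<Sum>k<m. \<Sum>j<v'. A k j r * g k (w' + (\<beta> * x + i)) j) = 0"
        using g2[of r "w' + (\<beta> * x + i)"] \<beta>x by (simp add: d2_def M_def)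
    qed
    then show ?thesis by (simp add: qeq)
  qed
  have "\<exists>U W. fs.subspace U \<and> U \<subseteq> coord_space d1 \<and> fs.dim U = v' \<and>
    fs.subspace W \<and> W \<subseteq> coord_space d2 \<and> fs.dim W = w' \<and> (\<forall>k<m. mat_rep d1 d2 M0 k ` U \<subseteq> W)"
    for M0 :: "nat \<Rightarrow> nat \<Rightarrow> nat \<Rightarrow> 'a"
  proof (rule subrep_of_every_rep[of v' d1 w' d2 M m M0])
    show "v' \<le> d1" "w' \<le> d2" by (simp_all add: d1_def d2_def)
    show "M k j q = 0" if "j < v'" "q \<in> {w'..<d2}" for k j q using that by (simp add: M_def)
    show "M k p r = 0" if "p \<in> {v'..<d1}" "r < w'" for k p r using that by (simp add: M_def)
    show "ext_vanishing m d1 d2 v' w' M"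
      unfolding ext_vanishing_def by (intro allI impI ballI, rule dual) blast+
  qed blast
  then show thesis using that[of b] unfolding d1_def d2_def v'_def w'_def by (simp add: b_def)
qed

lemma no_expander_rep:
  fixes m :: nat and \<delta> \<epsilon> \<alpha> :: real
  assumes \<delta>: "0 < \<delta>" "\<delta> < 1" and "\<alpha> \<in> \<rat>" and q: "\<alpha>^2 - real m * \<alpha> + 1 < 0"
    and pos: "real m * \<delta> + \<alpha> - 2 * \<alpha> * \<delta> > 0" and \<epsilon>: "eps_m m \<alpha> \<delta> < \<epsilon>"
  obtains d1 d2 where "d1 > 0" "d2 > 0" "real d2 / real d1 = \<alpha>"
    "\<nexists>f :: nat \<Rightarrow> (nat \<Rightarrow> 'a::alg_closed_field) \<Rightarrow> (nat \<Rightarrow> 'a). expander_rep \<delta> \<epsilon> m d1 d2 f"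
proof -
  note \<alpha> = quadratic_neg_bounds[OF _ q, simplified]
  have "crit_slope m \<alpha> \<delta> < (1 + \<epsilon>) * \<alpha>" unfolding crit_slope_def using \<epsilon> \<alpha> by simp
  then obtain u t where u: "u \<in> \<rat>" "0 < u" "u \<le> \<delta>" and t: "t \<in> \<rat>" "0 < t" "t < (1 + \<epsilon>) * \<alpha>"
    and e: "euler_fn m \<alpha> u t > 0" and w: "\<alpha> - t * u > 0" and qf: "quot_form m \<alpha> u t < 0"
    by (rule rational_above_crit_slope[OF \<delta> q pos]) blast
  obtain n1 where n1: "n1 > 0" "\<And>c. \<exists>k::nat. u * real (c * n1) = real k"
    using rational_denominator[OF u(1)] u by auto
  obtain n2 where n2: "n2 > 0" "\<And>c. \<exists>k::nat. (t * u) * real (c * n2) = real k"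
    using rational_denominator[of "t * u"] u t by auto
  obtain n3 where n3: "n3 > 0" "\<And>c. \<exists>k::nat. \<alpha> * real (c * n3) = real k"
    using rational_denominator[OF \<open>\<alpha> \<in> \<rat>\<close>] \<alpha> by auto
  define n where "n = n1 * n2 * n3"
  have n: "n > 0" using n1 n2 n3 by (simp add: n_def)
  obtain l0 where l0: "u * real n = real l0" using n1(2)[of "n2 * n3"] by (auto simp: n_def mult_ac)
  obtain w0 where w0: "t * u * real n = real w0" using n2(2)[of "n1 * n3"] by (auto simp: n_def mult_ac)
  obtain a0 where a0: "\<alpha> * real n = real a0" using n3(2)[of "n1 * n2"] by (auto simp: n_def mult_ac)
  have "u * real n < 1 * real n" using u \<delta> n by (intro mult_strict_right_mono) auto
  then have l0n: "l0 < n" unfolding l0 by simp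
  have "t * u * real n < \<alpha> * real n" using w n by (intro mult_strict_right_mono) auto
  then have w0a: "w0 < a0" unfolding w0 a0 by simp
  define x where "x = a0 - w0"
  define y where "y = n - l0"
  have xr: "real x = (\<alpha> - t * u) * real n" using w0a by (simp add: x_def of_nat_diff w0[symmetric] a0[symmetric] algebra_simps)
  have yr: "real y = (1 - u) * real n" using l0n by (simp add: y_def of_nat_diff l0[symmetric] algebra_simps)
  have x: "x > 0" and y: "y > 0" using l0n w0a by (simp_all add: x_def y_def)
  \<comment> \<open>The Tits form is symmetric, so its negativity for the quotient (y, x) also holds
    for the dual vector (x, y) of \<open>D\<close>.\<close>
  have "real x * real x * ((real y / real x)^2 - real m * (real y / real x) + 1) =
      real y * real y - real m * real y * real x + real x * real x"
    using x by (simp add: field_simps power2_eq_square)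
  also have "\<dots> = real n * real n * quot_form m \<alpha> u t"
    unfolding xr yr quot_form_def by (simp add: algebra_simps power2_eq_square)
  also have "\<dots> < 0" using qf n by (simp add: mult_pos_neg)
  finally have qxy: "(real y / real x)^2 - real m * (real y / real x) + 1 < 0"
    using x by (simp add: mult_less_0_iff)
  have "real (x * w0 + y * l0) - real (m * x * l0) = u * real n * real n * euler_fn m \<alpha> u t"
    unfolding of_nat_add of_nat_mult xr yr l0[symmetric] w0[symmetric] euler_fn_alt by (simp add: algebra_simps)
  moreover have "\<dots> > 0" using u n e by simp
  ultimately have "real (m * x * l0) < real (x * w0 + y * l0)" by linarith
  then have ext: "m * x * l0 < x * w0 + y * l0" by (simp only: of_nat_less_iff)
  obtain b where b: "b > 0" and sub: "\<And>M0 :: nat \<Rightarrow> nat \<Rightarrow> nat \<Rightarrow> 'a. \<exists>U W. fs.subspace U \<and> U \<subseteq> coord_space (b * l0 + b * y) \<and> fs.dim U = b * l0 \<and>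
    fs.subspace W \<and> W \<subseteq> coord_space (b * w0 + b * x) \<and> fs.dim W = b * w0 \<and>
    (\<forall>k<m. mat_rep (b * l0 + b * y) (b * w0 + b * x) M0 k ` U \<subseteq> W)"
    by (rule subrep_of_every_rep_multiple[where 'a = 'a, OF x y qxy ext]) (erule that)
  have d: "b * l0 + b * y = b * n" "b * w0 + b * x = b * a0"
    using l0n w0a by (simp_all add: x_def y_def add_mult_distrib2[symmetric])
  have a0_pos: "a0 > 0" using w0a by simp
  show thesis
  proof (rule that[of "b * n" "b * a0"])
    show "b * n > 0" "b * a0 > 0" using b n a0_pos by auto
    show "real (b * a0) / real (b * n) = \<alpha>" using b n a0 by (simp add: field_simps)
    then have ratio: "real (b * a0) / real (b * n) = \<alpha>" .
    show "\<nexists>f :: nat \<Rightarrow> (nat \<Rightarrow> 'a) \<Rightarrow> (nat \<Rightarrow> 'a). expander_rep \<delta> \<epsilon> m (b * n) (b * a0) f"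
    proof
      assume "\<exists>f :: nat \<Rightarrow> (nat \<Rightarrow> 'a) \<Rightarrow> (nat \<Rightarrow> 'a). expander_rep \<delta> \<epsilon> m (b * n) (b * a0) f"
      then obtain f :: "nat \<Rightarrow> (nat \<Rightarrow> 'a) \<Rightarrow> (nat \<Rightarrow> 'a)" where f: "expander_rep \<delta> \<epsilon> m (b * n) (b * a0) f" by blast
      have rep: "Km_rep m (b * n) (b * a0) f" using f by (simp add: expander_rep_def)
      obtain U W where U: "fs.subspace U" "U \<subseteq> coord_space (b * n)" "fs.dim U = b * l0"
        and W: "fs.subspace W" "W \<subseteq> coord_space (b * a0)" "fs.dim W = b * w0"
        and UW: "\<forall>k<m. mat_rep (b * n) (b * a0) (\<lambda>k i. f k (\<lambda>j. if j = i then 1 else 0)) k ` U \<subseteq> W"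
        using sub[of "\<lambda>k i. f k (\<lambda>j. if j = i then 1 else 0)"] unfolding d by blast
      have fU: "f k ` U \<subseteq> W" if "k < m" for k
        using Km_rep_eq_mat_rep[OF rep that] UW that U(2) by (auto simp: image_subset_iff subset_iff)
      have l0_pos: "l0 > 0" using l0 u n by (cases l0) auto
      have "fs.dim {0 :: nat \<Rightarrow> 'a} \<le> card ({} :: (nat \<Rightarrow> 'a) set)" by (rule fs.dim_le_card) auto
      then have "U \<noteq> {0}" using U(3) l0_pos b by auto
      moreover have "real (fs.dim U) / real (b * n) \<le> \<delta>"
      proof -
        have "real (fs.dim U) / real (b * n) = u" using U(3) l0 b n by (simp add: field_simps)
        then show ?thesis using u by simp
      qed
      ultimately have exp: "(1 + \<epsilon>) * \<alpha> * real (fs.dim U) \<le> real (fs.dim (img_sum m f U))"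
        using f U unfolding expander_rep_def is_subspace_def vdim_def fscale_eq_fsc ratio by blast
      have "img_sum m f U \<subseteq> W"
        unfolding img_sum_def fscale_eq_fsc using fU by (intro fs.span_minimal W(1)) auto
      then have "fs.dim (img_sum m f U) \<le> b * w0"
        using dim_mono_coord_space[OF W(1,2)] W(3) by metis
      then have "real (fs.dim (img_sum m f U)) \<le> real (b * w0)" by (simp only: of_nat_le_iff)
      also have "\<dots> = t * real (fs.dim U)" using w0 l0 by (simp add: U(3) algebra_simps)
      also have "\<dots> < (1 + \<epsilon>) * \<alpha> * real (fs.dim U)"
        using t U(3) b l0_pos by (intro mult_strict_right_mono) auto
      finally show False using exp by simp
    qed
  qed
qed

theorem theorem4p3:
  fixes m :: nat and \<delta> \<epsilon> \<alpha> :: real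
  assumes "m \<ge> 1" and "0 < \<delta>" and "\<delta> < 1" and "\<epsilon> > 0" and "\<alpha> \<in> \<rat>"
    and "\<alpha>^2 - real m * \<alpha> + 1 < 0" and "real m * \<delta> + \<alpha> - 2 * \<alpha> * \<delta> > 0"
  shows "eps_m m \<alpha> \<delta> > 0 \<and>
    ((\<forall>d1 d2 :: nat. d1 > 0 \<and> d2 > 0 \<and> real d2 / real d1 = \<alpha> \<longrightarrow>
        (\<exists>f :: nat \<Rightarrow> (nat \<Rightarrow> 'a::alg_closed_field) \<Rightarrow> (nat \<Rightarrow> 'a). expander_rep \<delta> \<epsilon> m d1 d2 f))
     \<longleftrightarrow> \<epsilon> \<le> eps_m m \<alpha> \<delta>)"
proof (intro conjI iffI allI impI)
  show "eps_m m \<alpha> \<delta> > 0" using assms by (intro eps_m_pos)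
next
  assume *: "\<forall>d1 d2 :: nat. d1 > 0 \<and> d2 > 0 \<and> real d2 / real d1 = \<alpha> \<longrightarrow>
        (\<exists>f :: nat \<Rightarrow> (nat \<Rightarrow> 'a::alg_closed_field) \<Rightarrow> (nat \<Rightarrow> 'a). expander_rep \<delta> \<epsilon> m d1 d2 f)"
  show "\<epsilon> \<le> eps_m m \<alpha> \<delta>"
  proof (rule ccontr)
    assume "\<not> ?thesis"
    then have "eps_m m \<alpha> \<delta> < \<epsilon>" by simp
    then show False
      by (rule no_expander_rep[where 'a = 'a, OF assms(2,3,5,6,7)]) (use * in blast)
  qed
next
  fix d1 d2 :: nat
  assume "\<epsilon> \<le> eps_m m \<alpha> \<delta>" "d1 > 0 \<and> d2 > 0 \<and> real d2 / real d1 = \<alpha>"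
  then show "\<exists>f :: nat \<Rightarrow> (nat \<Rightarrow> 'a::alg_closed_field) \<Rightarrow> (nat \<Rightarrow> 'a). expander_rep \<delta> \<epsilon> m d1 d2 f"
    using assms by (intro expander_rep_exists[OF alg_closed_infinite]) auto
qed

end
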